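(* Let $\mathcal{V}=(\mathcal{G},\mathcal{L},P)$ be an algebraically closed densely valued $\ell$-group. Then $\mathcal{V}$ is existentially closed (in the class of densely valued $\ell$-groups) if and only if $\mathcal{L}$ is atomless, i.e. for every $l\in\mathcal{L}$ with $\bot<l$ there exists $k\in\mathcal{L}$ with $\bot<k<l$.
   Context: All $\ell$-groups are abelian lattice-ordered groups. A valued $\ell$-group is a triple $(\mathcal{G},\mathcal{L},P)$ with $\mathcal{G}$ an $\ell$-group, $\mathcal{L}$ a bounded distributive lattice ($\sqcap,\sqcup,\bot,\top,\sqsubseteq$), and $P:\mathcal{G}\to\mathcal{L}$ such that for all $a,b$: $P(a\wedge b)=P(a)\sqcap P(b)$, $P(a\vee b)=P(a)\sqcup P(b)$, $P(0)=\top$, $P(a)\sqcap P(b)\sqsubseteq P(a+b)$, and every element of $\mathcal{L}$ other than $\bot$ is of the form $P(a)$; it is densely valued if moreover $P(a)=\top$ implies $a\geq0$. Valued $\ell$-groups are structures in the two-sorted language $\mathcal{L}_{\mathrm{vlgrp}}$ with a group sort (symbols $0,+,-,\wedge,\vee$), a lattice sort (symbols $\bot,\top,\sqcap,\sqcup$) and a function symbol $P$ from the group sort to the lattice sort; $\mathcal{V}\leq\mathcal{W}$ means substructure. A densely valued $\ell$-group $\mathcal{V}$ is algebraically closed (resp. existentially closed) if for every densely valued $\ell$-group $\mathcal{W}\geq\mathcal{V}$, every positive existential (resp. existential) $\mathcal{L}_{\mathrm{vlgrp}}$-formula $\phi(\bar v)$ and every tuple $\bar c$ from $\mathcal{V}$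 of matching sorts, $\mathcal{W}\models\phi(\bar c)$ implies $\mathcal{V}\models\phi(\bar c)$. *)

theory Defs
  imports "HOL-Algebra.Group"
begin

section \<open>Valued \<open>\<ell>\<close>-groups\<close>

text \<open>
  Structures for the two-sorted language: a group sort with \<open>0, +, -, \<and>, \<or>\<close>, a lattice sort with
  \<open>\<bottom>, \<top>, \<sqinter>, \<squnion>\<close>, and \<open>P\<close> from the group sort to the lattice sort. Sorts are carrier sets, so that
  structures of arbitrary size can live on one type; operations matter on the carriers only.
\<close>

record ('g, 'l) vlgrp =
  gdom :: "'g set"
  gzero :: 'g
  gadd :: "'g \<Rightarrow> 'g \<Rightarrow> 'g"
  gneg :: "'g \<Rightarrow> 'g"
  gmeet :: "'g \<Rightarrow> 'g \<Rightarrow> 'g"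
  gjoin :: "'g \<Rightarrow> 'g \<Rightarrow> 'g"
  ldom :: "'l set"
  lbot :: 'l
  ltop :: 'l
  lmeet :: "'l \<Rightarrow> 'l \<Rightarrow> 'l"
  ljoin :: "'l \<Rightarrow> 'l \<Rightarrow> 'l"
  val :: "'g \<Rightarrow> 'l"

locale lattice_ops =
  fixes A :: "'a set" and meet join :: "'a \<Rightarrow> 'a \<Rightarrow> 'a"
  assumes meet_closed: "\<lbrakk>x \<in> A; y \<in> A\<rbrakk> \<Longrightarrow> meet x y \<in> A"
    and join_closed: "\<lbrakk>x \<in> A; y \<in> A\<rbrakk> \<Longrightarrow> join x y \<in> A"
    and meet_assoc: "\<lbrakk>x \<in> A; y \<in> A; z \<in> A\<rbrakk> \<Longrightarrow> meet (meet x y) z = meet x (meet y z)"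
    and join_assoc: "\<lbrakk>x \<in> A; y \<in> A; z \<in> A\<rbrakk> \<Longrightarrow> join (join x y) z = join x (join y z)"
    and meet_comm: "\<lbrakk>x \<in> A; y \<in> A\<rbrakk> \<Longrightarrow> meet x y = meet y x"
    and join_comm: "\<lbrakk>x \<in> A; y \<in> A\<rbrakk> \<Longrightarrow> join x y = join y x"
    and meet_absorb: "\<lbrakk>x \<in> A; y \<in> A\<rbrakk> \<Longrightarrow> meet x (join x y) = x"
    and join_absorb: "\<lbrakk>x \<in> A; y \<in> A\<rbrakk> \<Longrightarrow> join x (meet x y) = x"

locale bounded_distrib_lattice_ops = lattice_ops A meet join
  for A :: "'a set" and meet join :: "'a \<Rightarrow> 'a \<Rightarrow> 'a" +
  fixes bt tp :: 'a
  assumes bt_closed: "bt \<in> A" and tp_closed: "tp \<in> A"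
    and bt_least: "x \<in> A \<Longrightarrow> meet bt x = bt"
    and tp_greatest: "x \<in> A \<Longrightarrow> meet x tp = x"
    and meet_join_distrib:
      "\<lbrakk>x \<in> A; y \<in> A; z \<in> A\<rbrakk> \<Longrightarrow> meet x (join y z) = join (meet x y) (meet x z)"

definition add_group :: "('g, 'l) vlgrp \<Rightarrow> 'g monoid" where
  "add_group V = \<lparr>carrier = gdom V, mult = gadd V, one = gzero V\<rparr>"

definition abelian_lgroup :: "('g, 'l) vlgrp \<Rightarrow> bool" where
  "abelian_lgroup V \<longleftrightarrow>
     comm_group (add_group V) \<and>
     (\<forall>a\<in>gdom V. gneg V a = m_inv (add_group V) a) \<and>
     lattice_ops (gdom V) (gmeet V) (gjoin V) \<and>
     (\<forall>a\<in>gdom V. \<forall>b\<in>gdom V. \<forall>c\<in>gdom V.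
        gadd V a (gmeet V b c) = gmeet V (gadd V a b) (gadd V a c) \<and>
        gadd V a (gjoin V b c) = gjoin V (gadd V a b) (gadd V a c))"

definition gle :: "('g, 'l) vlgrp \<Rightarrow> 'g \<Rightarrow> 'g \<Rightarrow> bool" where
  "gle V a b \<longleftrightarrow> gmeet V a b = a"

definition lle :: "('g, 'l) vlgrp \<Rightarrow> 'l \<Rightarrow> 'l \<Rightarrow> bool" where
  "lle V k l \<longleftrightarrow> lmeet V k l = k"

definition lless :: "('g, 'l) vlgrp \<Rightarrow> 'l \<Rightarrow> 'l \<Rightarrow> bool" where
  "lless V k l \<longleftrightarrow> lle V k l \<and> k \<noteq> l"

definition valued_lgroup :: "('g, 'l) vlgrp \<Rightarrow> bool" where
  "valued_lgroup V \<longleftrightarrow>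
     abelian_lgroup V \<and>
     bounded_distrib_lattice_ops (ldom V) (lmeet V) (ljoin V) (lbot V) (ltop V) \<and>
     (\<forall>a\<in>gdom V. val V a \<in> ldom V) \<and>
     (\<forall>a\<in>gdom V. \<forall>b\<in>gdom V.
        val V (gmeet V a b) = lmeet V (val V a) (val V b) \<and>
        val V (gjoin V a b) = ljoin V (val V a) (val V b) \<and>
        lle V (lmeet V (val V a) (val V b)) (val V (gadd V a b))) \<and>
     val V (gzero V) = ltop V \<and>
     (\<forall>l\<in>ldom V. l \<noteq> lbot V \<longrightarrow> (\<exists>a\<in>gdom V. l = val V a))"

definition densely_valued_lgroup :: "('g, 'l) vlgrp \<Rightarrow> bool" where
  "densely_valued_lgroup V \<longleftrightarrow>
     valued_lgroup V \<and> (\<forall>a\<in>gdom V. val V a = ltop V \<longrightarrow> gle V (gzero V) a)"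

definition atomless :: "('g, 'l) vlgrp \<Rightarrow> bool" where
  "atomless V \<longleftrightarrow>
     (\<forall>l\<in>ldom V. lless V (lbot V) l \<longrightarrow> (\<exists>k\<in>ldom V. lless V (lbot V) k \<and> lless V k l))"

text \<open>
  \<open>V\<close> is, up to renaming its elements along \<open>f\<close> and \<open>h\<close>, a substructure of \<open>W\<close>. The language has no
  relation symbols besides equality, so injective maps commuting with all symbols suffice.
\<close>

definition embedding ::
  "('g \<Rightarrow> 'a) \<Rightarrow> ('l \<Rightarrow> 'b) \<Rightarrow> ('g, 'l) vlgrp \<Rightarrow> ('a, 'b) vlgrp \<Rightarrow> bool" where
  "embedding f h V W \<longleftrightarrow>
     inj_on f (gdom V) \<and> f ` gdom V \<subseteq> gdom W \<and>
     inj_on h (ldom V) \<and> h ` ldom V \<subseteq> ldom W \<and>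
     f (gzero V) = gzero W \<and>
     (\<forall>a\<in>gdom V. f (gneg V a) = gneg W (f a)) \<and>
     (\<forall>a\<in>gdom V. \<forall>b\<in>gdom V.
        f (gadd V a b) = gadd W (f a) (f b) \<and>
        f (gmeet V a b) = gmeet W (f a) (f b) \<and>
        f (gjoin V a b) = gjoin W (f a) (f b)) \<and>
     h (lbot V) = lbot W \<and> h (ltop V) = ltop W \<and>
     (\<forall>k\<in>ldom V. \<forall>l\<in>ldom V.
        h (lmeet V k l) = lmeet W (h k) (h l) \<and>
        h (ljoin V k l) = ljoin W (h k) (h l)) \<and>
     (\<forall>a\<in>gdom V. h (val V a) = val W (f a))"


section \<open>First-order formulas of the two-sorted language\<close>

datatype gterm =
    GVar nat | GZero | GAdd gterm gterm | GNeg gterm | GMeet gterm gterm | GJoin gterm gterm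

datatype lterm =
    LVar nat | LBot | LTop | LMeet lterm lterm | LJoin lterm lterm | Val gterm

datatype fm =
    GEq gterm gterm | LEq lterm lterm
  | Neg fm | Conj fm fm | Disj fm fm
  | ExG nat fm | ExL nat fm | AllG nat fm | AllL nat fm

primrec geval :: "('g, 'l) vlgrp \<Rightarrow> (nat \<Rightarrow> 'g) \<Rightarrow> gterm \<Rightarrow> 'g" where
  "geval V e (GVar n) = e n"
| "geval V e GZero = gzero V"
| "geval V e (GAdd s t) = gadd V (geval V e s) (geval V e t)"
| "geval V e (GNeg t) = gneg V (geval V e t)"
| "geval V e (GMeet s t) = gmeet V (geval V e s) (geval V e t)"
| "geval V e (GJoin s t) = gjoin V (geval V e s) (geval V e t)"

primrec leval :: "('g, 'l) vlgrp \<Rightarrow> (nat \<Rightarrow> 'g) \<Rightarrow> (nat \<Rightarrow> 'l) \<Rightarrow> lterm \<Rightarrow> 'l" where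
  "leval V e d (LVar n) = d n"
| "leval V e d LBot = lbot V"
| "leval V e d LTop = ltop V"
| "leval V e d (LMeet s t) = lmeet V (leval V e d s) (leval V e d t)"
| "leval V e d (LJoin s t) = ljoin V (leval V e d s) (leval V e d t)"
| "leval V e d (Val t) = val V (geval V e t)"

primrec sat :: "('g, 'l) vlgrp \<Rightarrow> (nat \<Rightarrow> 'g) \<Rightarrow> (nat \<Rightarrow> 'l) \<Rightarrow> fm \<Rightarrow> bool" where
  "sat V e d (GEq s t) \<longleftrightarrow> geval V e s = geval V e t"
| "sat V e d (LEq s t) \<longleftrightarrow> leval V e d s = leval V e d t"
| "sat V e d (Neg p) \<longleftrightarrow> \<not> sat V e d p"
| "sat V e d (Conj p q) \<longleftrightarrow> sat V e d p \<and> sat V e d q"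
| "sat V e d (Disj p q) \<longleftrightarrow> sat V e d p \<or> sat V e d q"
| "sat V e d (ExG n p) \<longleftrightarrow> (\<exists>a\<in>gdom V. sat V (e(n := a)) d p)"
| "sat V e d (ExL n p) \<longleftrightarrow> (\<exists>l\<in>ldom V. sat V e (d(n := l)) p)"
| "sat V e d (AllG n p) \<longleftrightarrow> (\<forall>a\<in>gdom V. sat V (e(n := a)) d p)"
| "sat V e d (AllL n p) \<longleftrightarrow> (\<forall>l\<in>ldom V. sat V e (d(n := l)) p)"

inductive quantifier_free :: "fm \<Rightarrow> bool" where
  "quantifier_free (GEq s t)"
| "quantifier_free (LEq s t)"
| "quantifier_free p \<Longrightarrow> quantifier_free (Neg p)"
| "\<lbrakk>quantifier_free p; quantifier_free q\<rbrakk> \<Longrightarrow> quantifier_free (Conj p q)"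
| "\<lbrakk>quantifier_free p; quantifier_free q\<rbrakk> \<Longrightarrow> quantifier_free (Disj p q)"

inductive existential :: "fm \<Rightarrow> bool" where
  "quantifier_free p \<Longrightarrow> existential p"
| "existential p \<Longrightarrow> existential (ExG n p)"
| "existential p \<Longrightarrow> existential (ExL n p)"

inductive positive :: "fm \<Rightarrow> bool" where
  "positive (GEq s t)"
| "positive (LEq s t)"
| "\<lbrakk>positive p; positive q\<rbrakk> \<Longrightarrow> positive (Conj p q)"
| "\<lbrakk>positive p; positive q\<rbrakk> \<Longrightarrow> positive (Disj p q)"
| "positive p \<Longrightarrow> positive (ExG n p)"
| "positive p \<Longrightarrow> positive (ExL n p)"
| "positive p \<Longrightarrow> positive (AllG n p)"
| "positive p \<Longrightarrow> positive (AllL n p)"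

definition positive_existential :: "fm \<Rightarrow> bool" where
  "positive_existential p \<longleftrightarrow> existential p \<and> positive p"


section \<open>Algebraically and existentially closed densely valued \<open>\<ell>\<close>-groups\<close>

text \<open>
  Every formula in \<open>Phi\<close>, with parameters from \<open>V\<close>, that holds in \<open>W\<close> holds in \<open>V\<close>. A parameter
  tuple is given as a pair of assignments of all variables of the two sorts.
\<close>

definition reflects ::
  "(fm \<Rightarrow> bool) \<Rightarrow> ('g \<Rightarrow> 'a) \<Rightarrow> ('l \<Rightarrow> 'b) \<Rightarrow> ('g, 'l) vlgrp \<Rightarrow> ('a, 'b) vlgrp \<Rightarrow> bool" where
  "reflects Phi f h V W \<longleftrightarrow>
     (\<forall>p e d. Phi p \<and> range e \<subseteq> gdom V \<and> range d \<subseteq> ldom V \<and> sat W (f \<circ> e) (h \<circ> d) p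
        \<longrightarrow> sat V e d p)"

text \<open>
  A quantifier over all extensions \<open>W\<close> must name the types of their sorts. The infinite type
  \<open>'g + 'l + nat\<close> is large enough by downward Loewenheim-Skolem: the theorems
  \<open>algebraically_closed_reflects\<close> and \<open>existentially_closed_reflects\<close> below derive the same property
  for extensions on arbitrary types.
\<close>

definition algebraically_closed :: "('g, 'l) vlgrp \<Rightarrow> bool" where
  "algebraically_closed V \<longleftrightarrow>
     densely_valued_lgroup V \<and>
     (\<forall>(W :: ('g + 'l + nat, 'g + 'l + nat) vlgrp) f h.
        densely_valued_lgroup W \<and> embedding f h V W \<longrightarrow> reflects positive_existential f h V W)"

definition existentially_closed :: "('g, 'l) vlgrp \<Rightarrow> bool" where
  "existentially_closed V \<longleftrightarrow>
     densely_valued_lgroup V \<and>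
     (\<forall>(W :: ('g + 'l + nat, 'g + 'l + nat) vlgrp) f h.
        densely_valued_lgroup W \<and> embedding f h V W \<longrightarrow> reflects existential f h V W)"


section \<open>Extensions on arbitrary types\<close>

lemma geval_closed:
  assumes "densely_valued_lgroup V" "range e \<subseteq> gdom V"
  shows "geval V e t \<in> gdom V"
proof -
  have L: "lattice_ops (gdom V) (gmeet V) (gjoin V)" and G: "comm_group (add_group V)"
    and N: "\<And>a. a \<in> gdom V \<Longrightarrow> gneg V a = m_inv (add_group V) a"
    using assms(1) by (auto simp: densely_valued_lgroup_def valued_lgroup_def abelian_lgroup_def)
  interpret lattice_ops "gdom V" "gmeet V" "gjoin V" by (rule L)
  interpret comm_group "add_group V" by (rule G)
  have [simp]: "carrier (add_group V) = gdom V" by (simp add: add_group_def)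
  have "gzero V \<in> gdom V" using one_closed by (simp add: add_group_def)
  moreover have "gadd V a b \<in> gdom V" if "a \<in> gdom V" "b \<in> gdom V" for a b
    using m_closed[of a b] that by (simp add: add_group_def)
  moreover have "gneg V a \<in> gdom V" if "a \<in> gdom V" for a
    using inv_closed[of a] that N by simp
  ultimately show ?thesis
    using assms(2) by (induction t) (auto intro: meet_closed join_closed)
qed

lemma densely_valued_closed:
  assumes "densely_valued_lgroup V"
  shows "gzero V \<in> gdom V" "\<And>a. a \<in> gdom V \<Longrightarrow> gneg V a \<in> gdom V"
    "\<And>a b. \<lbrakk>a \<in> gdom V; b \<in> gdom V\<rbrakk> \<Longrightarrow> gadd V a b \<in> gdom V"
    "\<And>a b. \<lbrakk>a \<in> gdom V; b \<in> gdom V\<rbrakk> \<Longrightarrow> gmeet V a b \<in> gdom V"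
    "\<And>a b. \<lbrakk>a \<in> gdom V; b \<in> gdom V\<rbrakk> \<Longrightarrow> gjoin V a b \<in> gdom V"
    "lbot V \<in> ldom V" "ltop V \<in> ldom V"
    "\<And>a b. \<lbrakk>a \<in> ldom V; b \<in> ldom V\<rbrakk> \<Longrightarrow> lmeet V a b \<in> ldom V"
    "\<And>a b. \<lbrakk>a \<in> ldom V; b \<in> ldom V\<rbrakk> \<Longrightarrow> ljoin V a b \<in> ldom V"
    "\<And>a. a \<in> gdom V \<Longrightarrow> val V a \<in> ldom V"
proof -
  have B: "bounded_distrib_lattice_ops (ldom V) (lmeet V) (ljoin V) (lbot V) (ltop V)"
    and v: "\<And>a. a \<in> gdom V \<Longrightarrow> val V a \<in> ldom V"
    and G: "comm_group (add_group V)"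
    using assms by (auto simp: densely_valued_lgroup_def valued_lgroup_def abelian_lgroup_def)
  interpret bounded_distrib_lattice_ops "ldom V" "lmeet V" "ljoin V" "lbot V" "ltop V" by (rule B)
  interpret comm_group "add_group V" by (rule G)
  show z: "gzero V \<in> gdom V" using one_closed by (simp add: add_group_def)
  show "gneg V a \<in> gdom V" if "a \<in> gdom V" for a
    using geval_closed[OF assms, of "\<lambda>_. a" "GNeg (GVar 0)"] that by auto
  have *: "range (\<lambda>n::nat. if n = 0 then a else b) \<subseteq> gdom V"
    if "a \<in> gdom V" "b \<in> gdom V" for a b using that by auto
  show "gadd V a b \<in> gdom V" "gmeet V a b \<in> gdom V" "gjoin V a b \<in> gdom V"
    if "a \<in> gdom V" "b \<in> gdom V" for a b
    using geval_closed[OF assms *[OF that], of "GAdd (GVar 0) (GVar 1)"]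
      geval_closed[OF assms *[OF that], of "GMeet (GVar 0) (GVar 1)"]
      geval_closed[OF assms *[OF that], of "GJoin (GVar 0) (GVar 1)"] by simp_all
qed (use assms in \<open>auto simp: densely_valued_lgroup_def valued_lgroup_def
    bounded_distrib_lattice_ops_def bounded_distrib_lattice_ops_axioms_def lattice_ops_def\<close>)

lemma leval_closed:
  assumes "densely_valued_lgroup V" "range e \<subseteq> gdom V" "range d \<subseteq> ldom V"
  shows "leval V e d t \<in> ldom V"
  using assms(3)
  by (induction t) (auto simp: densely_valued_closed[OF assms(1)] geval_closed[OF assms(1,2)])

lemma geval_embedding:
  assumes "densely_valued_lgroup V" "embedding f h V W" "range e \<subseteq> gdom V"
  shows "geval W (f \<circ> e) t = f (geval V e t)"
  using assms(2) geval_closed[OF assms(1,3)] by (induction t) (simp_all add: embedding_def)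

lemma leval_embedding:
  assumes "densely_valued_lgroup V" "embedding f h V W" "range e \<subseteq> gdom V" "range d \<subseteq> ldom V"
  shows "leval W (f \<circ> e) (h \<circ> d) t = h (leval V e d t)"
  using assms(2) leval_closed[OF assms(1,3,4)] geval_closed[OF assms(1,3)]
    geval_embedding[OF assms(1-3)]
  by (induction t) (simp_all add: embedding_def)

lemma sat_embedding:
  assumes "densely_valued_lgroup V" "embedding f h V W" "range e \<subseteq> gdom V" "range d \<subseteq> ldom V"
    and "quantifier_free p"
  shows "sat W (f \<circ> e) (h \<circ> d) p \<longleftrightarrow> sat V e d p"
proof -
  have "inj_on f (gdom V)" "inj_on h (ldom V)" using assms(2) by (auto simp: embedding_def)
  with assms(5) show ?thesis
    by induction (simp_all add: geval_embedding[OF assms(1-3)] leval_embedding[OF assms(1-4)]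
      geval_closed[OF assms(1,3)] leval_closed[OF assms(1,3,4)] inj_on_eq_iff)
qed

text \<open>The witnesses for an existential formula are already in some finite part of the structure.\<close>

lemma existential_witnesses:
  assumes "existential p" "sat W e d p"
  shows "\<exists>A B. finite A \<and> A \<subseteq> gdom W \<and> finite B \<and> B \<subseteq> ldom W \<and>
    (\<forall>(U :: ('u, 'w) vlgrp) f h e' d'. densely_valued_lgroup U \<and> embedding f h U W \<and>
       A \<subseteq> f ` gdom U \<and> B \<subseteq> h ` ldom U \<and> range e' \<subseteq> gdom U \<and> range d' \<subseteq> ldom U \<and>
       f \<circ> e' = e \<and> h \<circ> d' = d \<longrightarrow> sat U e' d' p)"
  using assms
proof (induction arbitrary: e d)
  case (1 p)
  then show ?case
    by (intro exI[of _ "{}"]) (auto simp: sat_embedding simp del: comp_apply)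
next
  case (2 p n)
  then obtain a where a: "a \<in> gdom W" "sat W (e(n := a)) d p" by auto
  from "2.IH"[OF a(2)] obtain A B where AB: "finite A" "A \<subseteq> gdom W" "finite B" "B \<subseteq> ldom W"
    and *: "\<forall>(U :: ('u, 'w) vlgrp) f h e' d'. densely_valued_lgroup U \<and> embedding f h U W \<and>
       A \<subseteq> f ` gdom U \<and> B \<subseteq> h ` ldom U \<and> range e' \<subseteq> gdom U \<and> range d' \<subseteq> ldom U \<and>
       f \<circ> e' = e(n := a) \<and> h \<circ> d' = d \<longrightarrow> sat U e' d' p"
    by (elim exE conjE) (rule that)
  show ?case
  proof (intro exI[of _ "insert a A"] exI[of _ B] conjI allI impI)
    fix U :: "('u, 'w) vlgrp" and f h e' d'
    assume H: "densely_valued_lgroup U \<and> embedding f h U W \<and> insert a A \<subseteq> f ` gdom U \<and>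
      B \<subseteq> h ` ldom U \<and> range e' \<subseteq> gdom U \<and> range d' \<subseteq> ldom U \<and> f \<circ> e' = e \<and> h \<circ> d' = d"
    then obtain a' where a': "a' \<in> gdom U" "f a' = a" by auto
    have "f \<circ> e'(n := a') = e(n := a)" using H a' by auto
    moreover have "range (e'(n := a')) \<subseteq> gdom U" using H a' by auto
    ultimately have "sat U (e'(n := a')) d' p"
      using H *[THEN spec[of _ U], THEN spec[of _ f], THEN spec[of _ h],
        THEN spec[of _ "e'(n := a')"], THEN spec[of _ d']] by blast
    with a' show "sat U e' d' (ExG n p)" by auto
  qed (use a AB in auto)
next
  case (3 p n)
  then obtain a where a: "a \<in> ldom W" "sat W e (d(n := a)) p" by auto
  from "3.IH"[OF a(2)] obtain A B where AB: "finite A" "A \<subseteq> gdom W" "finite B" "B \<subseteq> ldom W"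
    and *: "\<forall>(U :: ('u, 'w) vlgrp) f h e' d'. densely_valued_lgroup U \<and> embedding f h U W \<and>
       A \<subseteq> f ` gdom U \<and> B \<subseteq> h ` ldom U \<and> range e' \<subseteq> gdom U \<and> range d' \<subseteq> ldom U \<and>
       f \<circ> e' = e \<and> h \<circ> d' = d(n := a) \<longrightarrow> sat U e' d' p"
    by (elim exE conjE) (rule that)
  show ?case
  proof (intro exI[of _ A] exI[of _ "insert a B"] conjI allI impI)
    fix U :: "('u, 'w) vlgrp" and f h e' d'
    assume H: "densely_valued_lgroup U \<and> embedding f h U W \<and> A \<subseteq> f ` gdom U \<and>
      insert a B \<subseteq> h ` ldom U \<and> range e' \<subseteq> gdom U \<and> range d' \<subseteq> ldom U \<and> f \<circ> e' = e \<and> h \<circ> d' = d"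
    then obtain a' where a': "a' \<in> ldom U" "h a' = a" by auto
    have "h \<circ> d'(n := a') = d(n := a)" using H a' by auto
    moreover have "range (d'(n := a')) \<subseteq> ldom U" using H a' by auto
    ultimately have "sat U e' (d'(n := a')) p"
      using H *[THEN spec[of _ U], THEN spec[of _ f], THEN spec[of _ h],
        THEN spec[of _ e'], THEN spec[of _ "d'(n := a')"]] by blast
    with a' show "sat U e' d' (ExL n p)" by auto
  qed (use a AB in auto)
qed

unbundle cardinal_syntax

lemma small_image: "|X| \<le>o |K| \<Longrightarrow> |g ` X| \<le>o |K|"
  using card_of_image ordLeq_transitive by blast

lemma small_Un: "\<lbrakk>infinite K; |X| \<le>o |K|; |Y| \<le>o |K|\<rbrakk> \<Longrightarrow> |X \<union> Y| \<le>o |K|"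
  using card_of_Un_ordLeq_infinite_Field[of "|K|" X Y] card_of_Card_order[of K]
  by (simp add: Field_card_of)

lemma small_finite: "\<lbrakk>infinite K; finite X\<rbrakk> \<Longrightarrow> |X| \<le>o |K|"
  using finite_ordLess_infinite[of "|X|" "|K|"] card_of_Well_order ordLess_imp_ordLeq
  by (metis Field_card_of)

lemma small_insert: "\<lbrakk>infinite K; |X| \<le>o |K|\<rbrakk> \<Longrightarrow> |insert x X| \<le>o |K|"
  using small_Un[of K "{x}" X] small_finite[of K "{x}"] by simp

text \<open>A countable family of binary operations generates from \<open>X\<close> no more than \<open>|X| + \<aleph>\<^sub>0\<close> elements.\<close>

lemma small_closure:
  fixes F :: "nat \<Rightarrow> 'c \<Rightarrow> 'c \<Rightarrow> 'c" and K :: "'k set"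
  assumes "infinite K" "|X| \<le>o |K|"
    and C: "X \<subseteq> C" "\<And>n x y. x \<in> C \<Longrightarrow> y \<in> C \<Longrightarrow> F n x y \<in> C"
  shows "\<exists>S. X \<subseteq> S \<and> S \<subseteq> C \<and> |S| \<le>o |K| \<and> (\<forall>n. \<forall>x\<in>S. \<forall>y\<in>S. F n x y \<in> S)"
proof -
  define step where "step S = S \<union> (\<Union>n. (\<lambda>(x, y). F n x y) ` (S \<times> S))" for S
  define S where "S = (\<Union>m. (step ^^ m) X)"
  have nat: "|UNIV :: nat set| \<le>o |K|"
    using assms(1) by (simp add: infinite_iff_card_of_nat)
  have step_small: "|step S| \<le>o |K|" if "|S| \<le>o |K|" for S
  proof -
    have "|S \<times> S| \<le>o |K|"
      using card_of_Times_ordLeq_infinite_Field[of "|K|" S S] that assms(1) card_of_Card_order[of K]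
      by (simp add: Field_card_of)
    then have "|(\<lambda>(x, y). F n x y) ` (S \<times> S)| \<le>o |K|" for n
      using card_of_image ordLeq_transitive by blast
    then have "|\<Union>n. (\<lambda>(x, y). F n x y) ` (S \<times> S)| \<le>o |K|"
      by (intro card_of_UNION_ordLeq_infinite[OF assms(1) nat]) auto
    with that show ?thesis unfolding step_def
      using small_Un[OF assms(1)] by blast
  qed
  have step_sub: "step S \<subseteq> C" if "S \<subseteq> C" for S
  proof
    fix z assume "z \<in> step S"
    then consider "z \<in> S" | n x y where "x \<in> S" "y \<in> S" "z = F n x y"
      by (auto simp: step_def)
    then show "z \<in> C" using that by cases (auto intro: C(2))
  qed
  have small: "|(step ^^ m) X| \<le>o |K|" for m
    by (induction m) (auto simp: assms(2) step_small)
  have sub: "(step ^^ m) X \<subseteq> C" for m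
    by (induction m) (simp_all add: C(1) step_sub)
  have mono: "(step ^^ m) X \<subseteq> (step ^^ n) X" if "m \<le> n" for m n
    using that by (induction rule: dec_induct) (auto simp: step_def)
  have "F n x y \<in> S" if xy: "x \<in> S" "y \<in> S" for n x y
  proof -
    from xy obtain i j where "x \<in> (step ^^ i) X" "y \<in> (step ^^ j) X" by (auto simp: S_def)
    with mono[of i "max i j"] mono[of j "max i j"]
    have "x \<in> (step ^^ max i j) X" "y \<in> (step ^^ max i j) X" by auto
    then have "F n x y \<in> (step ^^ Suc (max i j)) X" by (force simp: step_def)
    then show ?thesis unfolding S_def by blast
  qed
  moreover have "X \<subseteq> S" unfolding S_def by (rule subset_trans[OF _ UN_upper[of 0]]) auto
  moreover have "S \<subseteq> C" using sub by (auto simp: S_def)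
  moreover have "|S| \<le>o |K|" unfolding S_def
    by (intro card_of_UNION_ordLeq_infinite[OF assms(1) nat]) (auto simp: small)
  ultimately show ?thesis by blast
qed

lemma small_substructure:
  fixes W :: "('a, 'b) vlgrp" and K :: "'k set"
  assumes W: "densely_valued_lgroup W" and K: "infinite K"
    and A: "A \<subseteq> gdom W" "|A| \<le>o |K|" and B: "B \<subseteq> ldom W" "|B| \<le>o |K|"
  shows "\<exists>G L. A \<subseteq> G \<and> G \<subseteq> gdom W \<and> |G| \<le>o |K| \<and> B \<subseteq> L \<and> L \<subseteq> ldom W \<and> |L| \<le>o |K| \<and>
    gzero W \<in> G \<and> lbot W \<in> L \<and> ltop W \<in> L \<and> (\<forall>a\<in>G. gneg W a \<in> G \<and> val W a \<in> L) \<and>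
    (\<forall>a\<in>G. \<forall>b\<in>G. gadd W a b \<in> G \<and> gmeet W a b \<in> G \<and> gjoin W a b \<in> G) \<and>
    (\<forall>k\<in>L. \<forall>l\<in>L. lmeet W k l \<in> L \<and> ljoin W k l \<in> L) \<and>
    (\<forall>l\<in>L. l \<noteq> lbot W \<longrightarrow> (\<exists>a\<in>G. l = val W a))"
proof -
  note cl = densely_valued_closed[OF W]
  define C where "C = Inl ` gdom W \<union> Inr ` ldom W"
  define X where "X = Inl ` insert (gzero W) A \<union> Inr ` ({lbot W, ltop W} \<union> B)"
  define pre where "pre l = (if l = lbot W then gzero W else SOME a. a \<in> gdom W \<and> l = val W a)" for l
  have pre: "pre l \<in> gdom W" "l \<noteq> lbot W \<longrightarrow> l = val W (pre l)" if "l \<in> ldom W" for l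
  proof -
    have "\<exists>a. a \<in> gdom W \<and> l = val W a" if "l \<noteq> lbot W"
      using W \<open>l \<in> ldom W\<close> that by (auto simp: densely_valued_lgroup_def valued_lgroup_def)
    from someI_ex[OF this] show "pre l \<in> gdom W" "l \<noteq> lbot W \<longrightarrow> l = val W (pre l)"
      using cl(1) by (auto simp: pre_def)
  qed
  define F :: "nat \<Rightarrow> 'a + 'b \<Rightarrow> 'a + 'b \<Rightarrow> 'a + 'b" where
    "F n x y = (case (x, y) of
        (Inl a, Inl b) \<Rightarrow> [Inl (gadd W a b), Inl (gmeet W a b), Inl (gjoin W a b),
           Inl (gneg W a), Inr (val W a)] ! (n mod 5)
      | (Inr k, Inr l) \<Rightarrow> [Inr (lmeet W k l), Inr (ljoin W k l), Inl (pre k)] ! (n mod 3)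
      | _ \<Rightarrow> x)" for n x y
  have FC: "F n x y \<in> C" if "x \<in> C" "y \<in> C" for n x y
  proof -
    have n: "[a, b, c, d, e] ! (n mod 5) \<in> {a, b, c, d, e}"
      "[a, b, c] ! (n mod 3) \<in> {a, b, c}" for a b c d e :: "'a + 'b"
      using nth_mem[of "n mod 5" "[a, b, c, d, e]"] nth_mem[of "n mod 3" "[a, b, c]"] by simp_all
    show ?thesis
    proof (cases x)
      case x: (Inl a)
      show ?thesis
      proof (cases y)
        case (Inl b)
        with x that have "a \<in> gdom W" "b \<in> gdom W" by (auto simp: C_def)
        then have "{Inl (gadd W a b), Inl (gmeet W a b), Inl (gjoin W a b),
            Inl (gneg W a), Inr (val W a)} \<subseteq> C"
          by (simp add: C_def cl)
        then show ?thesis unfolding F_def x Inl prod.case sum.case using n(1) by (rule subsetD)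
      qed (use x that in \<open>simp add: F_def\<close>)
    next
      case x: (Inr k)
      show ?thesis
      proof (cases y)
        case (Inr l)
        with x that have "k \<in> ldom W" "l \<in> ldom W" by (auto simp: C_def)
        then have "{Inr (lmeet W k l), Inr (ljoin W k l), Inl (pre k)} \<subseteq> C"
          by (simp add: C_def cl pre)
        then show ?thesis unfolding F_def x Inr prod.case sum.case using n(2) by (rule subsetD)
      qed (use x that in \<open>simp add: F_def\<close>)
    qed
  qed
  have XC: "X \<subseteq> C" using A B cl by (auto simp: X_def C_def)
  have XK: "|X| \<le>o |K|"
    unfolding X_def
    by (rule small_Un[OF K small_image[OF small_insert[OF K A(2)]]
          small_image[OF small_Un[OF K small_finite[OF K] B(2)]]]) simp
  have "\<exists>S. X \<subseteq> S \<and> S \<subseteq> C \<and> |S| \<le>o |K| \<and> (\<forall>n. \<forall>x\<in>S. \<forall>y\<in>S. F n x y \<in> S)"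
    by (rule small_closure[OF K XK XC]) (rule FC)
  then
  obtain S where S: "X \<subseteq> S" "S \<subseteq> C" "|S| \<le>o |K|"
    and F': "\<forall>n. \<forall>x\<in>S. \<forall>y\<in>S. F n x y \<in> S"
    by (elim exE conjE) (rule that)
  have F: "F n x y \<in> S" if "x \<in> S" "y \<in> S" for n x y
    using F' that by simp
  have inl: "|Inl -` S| \<le>o |S|" and inr: "|Inr -` S| \<le>o |S|"
    by (rule card_of_ordLeq[THEN iffD1], rule exI[of _ Inl], auto)
      (rule card_of_ordLeq[THEN iffD1], rule exI[of _ Inr], auto)
  have G: "Inl (gadd W a b) \<in> S" "Inl (gmeet W a b) \<in> S" "Inl (gjoin W a b) \<in> S"
    if "Inl a \<in> S" "Inl b \<in> S" for a b
    using F[OF that, of 0] F[OF that, of 1] F[OF that, of 2] by (simp_all add: F_def)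
  have N: "Inl (gneg W a) \<in> S" "Inr (val W a) \<in> S" if "Inl a \<in> S" for a
    using F[OF that that, of 3] F[OF that that, of 4] by (simp_all add: F_def)
  have L: "Inr (lmeet W k l) \<in> S" "Inr (ljoin W k l) \<in> S" if "Inr k \<in> S" "Inr l \<in> S" for k l
    using F[OF that, of 0] F[OF that, of 1] by (simp_all add: F_def)
  have P: "\<exists>a\<in>Inl -` S. l = val W a" if "l \<in> Inr -` S" "l \<noteq> lbot W" for l
  proof -
    have "l \<in> ldom W" using that S(2) by (auto simp: C_def)
    moreover have "Inl (pre l) \<in> S" using F[of "Inr l" "Inr l" 2] that by (simp add: F_def)
    ultimately show ?thesis using pre that by blast
  qed
  have "|Inl -` S| \<le>o |K|" "|Inr -` S| \<le>o |K|"
    using inl inr S(3) ordLeq_transitive by blast+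
  moreover have "A \<subseteq> Inl -` S" "B \<subseteq> Inr -` S" "gzero W \<in> Inl -` S" "lbot W \<in> Inr -` S"
    "ltop W \<in> Inr -` S"
    using S(1) by (auto simp: X_def)
  moreover have "Inl -` S \<subseteq> gdom W" "Inr -` S \<subseteq> ldom W"
    using S(2) by (auto simp: C_def)
  ultimately show ?thesis
    using G N L P by (intro exI[of _ "Inl -` S"] exI[of _ "Inr -` S"] conjI ballI impI) simp_all
qed

lemma densely_valued_substructure:
  assumes W: "densely_valued_lgroup W" and em: "embedding p q U W"
    and gcl: "gzero U \<in> gdom U" "\<And>a. a \<in> gdom U \<Longrightarrow> gneg U a \<in> gdom U"
      "\<And>a b. \<lbrakk>a \<in> gdom U; b \<in> gdom U\<rbrakk> \<Longrightarrow> gadd U a b \<in> gdom U"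
      "\<And>a b. \<lbrakk>a \<in> gdom U; b \<in> gdom U\<rbrakk> \<Longrightarrow> gmeet U a b \<in> gdom U"
      "\<And>a b. \<lbrakk>a \<in> gdom U; b \<in> gdom U\<rbrakk> \<Longrightarrow> gjoin U a b \<in> gdom U"
    and lcl: "lbot U \<in> ldom U" "ltop U \<in> ldom U"
      "\<And>a b. \<lbrakk>a \<in> ldom U; b \<in> ldom U\<rbrakk> \<Longrightarrow> lmeet U a b \<in> ldom U"
      "\<And>a b. \<lbrakk>a \<in> ldom U; b \<in> ldom U\<rbrakk> \<Longrightarrow> ljoin U a b \<in> ldom U"
      "\<And>a. a \<in> gdom U \<Longrightarrow> val U a \<in> ldom U"
    and att: "\<And>l. \<lbrakk>l \<in> ldom U; l \<noteq> lbot U\<rbrakk> \<Longrightarrow> \<exists>a\<in>gdom U. l = val U a"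
  shows "densely_valued_lgroup U"
proof -
  have ginj: "\<And>a b. \<lbrakk>p a = p b; a \<in> gdom U; b \<in> gdom U\<rbrakk> \<Longrightarrow> a = b"
    and linj: "\<And>k l. \<lbrakk>q k = q l; k \<in> ldom U; l \<in> ldom U\<rbrakk> \<Longrightarrow> k = l"
    and pd: "\<And>a. a \<in> gdom U \<Longrightarrow> p a \<in> gdom W" and qd: "\<And>l. l \<in> ldom U \<Longrightarrow> q l \<in> ldom W"
    using em by (auto simp: embedding_def inj_on_def)
  have em': "p (gzero U) = gzero W" "\<And>a. a \<in> gdom U \<Longrightarrow> p (gneg U a) = gneg W (p a)"
    "\<And>a b. \<lbrakk>a \<in> gdom U; b \<in> gdom U\<rbrakk> \<Longrightarrow> p (gadd U a b) = gadd W (p a) (p b)"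
    "\<And>a b. \<lbrakk>a \<in> gdom U; b \<in> gdom U\<rbrakk> \<Longrightarrow> p (gmeet U a b) = gmeet W (p a) (p b)"
    "\<And>a b. \<lbrakk>a \<in> gdom U; b \<in> gdom U\<rbrakk> \<Longrightarrow> p (gjoin U a b) = gjoin W (p a) (p b)"
    "q (lbot U) = lbot W" "q (ltop U) = ltop W"
    "\<And>a b. \<lbrakk>a \<in> ldom U; b \<in> ldom U\<rbrakk> \<Longrightarrow> q (lmeet U a b) = lmeet W (q a) (q b)"
    "\<And>a b. \<lbrakk>a \<in> ldom U; b \<in> ldom U\<rbrakk> \<Longrightarrow> q (ljoin U a b) = ljoin W (q a) (q b)"
    "\<And>a. a \<in> gdom U \<Longrightarrow> q (val U a) = val W (p a)"
    using em by (auto simp: embedding_def)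
  note cl = gcl lcl
  have B: "bounded_distrib_lattice_ops (ldom W) (lmeet W) (ljoin W) (lbot W) (ltop W)"
    and L: "lattice_ops (gdom W) (gmeet W) (gjoin W)"
    and G: "comm_group (add_group W)"
    and N: "\<And>a. a \<in> gdom W \<Longrightarrow> gneg W a = m_inv (add_group W) a"
    and D: "\<And>a b c. \<lbrakk>a \<in> gdom W; b \<in> gdom W; c \<in> gdom W\<rbrakk> \<Longrightarrow>
        gadd W a (gmeet W b c) = gmeet W (gadd W a b) (gadd W a c)"
      "\<And>a b c. \<lbrakk>a \<in> gdom W; b \<in> gdom W; c \<in> gdom W\<rbrakk> \<Longrightarrow>
        gadd W a (gjoin W b c) = gjoin W (gadd W a b) (gadd W a c)"
    and P: "\<And>a b. \<lbrakk>a \<in> gdom W; b \<in> gdom W\<rbrakk> \<Longrightarrow> val W (gmeet W a b) = lmeet W (val W a) (val W b)"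
      "\<And>a b. \<lbrakk>a \<in> gdom W; b \<in> gdom W\<rbrakk> \<Longrightarrow> val W (gjoin W a b) = ljoin W (val W a) (val W b)"
      "\<And>a b. \<lbrakk>a \<in> gdom W; b \<in> gdom W\<rbrakk> \<Longrightarrow>
        lmeet W (lmeet W (val W a) (val W b)) (val W (gadd W a b)) = lmeet W (val W a) (val W b)"
      "val W (gzero W) = ltop W"
      "\<And>a. \<lbrakk>a \<in> gdom W; val W a = ltop W\<rbrakk> \<Longrightarrow> gmeet W (gzero W) a = gzero W"
    using W by (auto simp: densely_valued_lgroup_def valued_lgroup_def abelian_lgroup_def
        gle_def lle_def)
  interpret WL: bounded_distrib_lattice_ops "ldom W" "lmeet W" "ljoin W" "lbot W" "ltop W" by (rule B)
  interpret WM: lattice_ops "gdom W" "gmeet W" "gjoin W" by (rule L)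
  interpret WG: comm_group "add_group W" by (rule G)
  have [simp]: "carrier (add_group W) = gdom W" "one (add_group W) = gzero W"
    "mult (add_group W) = gadd W" by (simp_all add: add_group_def)
  have [simp]: "carrier (add_group U) = gdom U" "one (add_group U) = gzero U"
    "mult (add_group U) = gadd U" by (simp_all add: add_group_def)
  have neg: "gadd U (gneg U a) a = gzero U" if "a \<in> gdom U" for a
    using WG.l_inv[of "p a"] that by (intro ginj) (simp_all add: em' cl pd N)
  have UG: "comm_group (add_group U)"
  proof (rule comm_groupI)
    fix x y z assume H: "x \<in> carrier (add_group U)" "y \<in> carrier (add_group U)"
    show "mult (add_group U) x y = mult (add_group U) y x"
      using H WG.m_comm[of "p x" "p y"] by (intro ginj) (simp_all add: em' cl pd)
    assume Z: "z \<in> carrier (add_group U)"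
    show "mult (add_group U) (mult (add_group U) x y) z = mult (add_group U) x (mult (add_group U) y z)"
      using H Z WG.m_assoc[of "p x" "p y" "p z"] by (intro ginj) (simp_all add: em' cl pd)
  next
    fix x assume H: "x \<in> carrier (add_group U)"
    show "mult (add_group U) (one (add_group U)) x = x"
      using H WG.l_one[of "p x"] by (intro ginj) (simp_all add: em' cl pd)
    show "\<exists>y\<in>carrier (add_group U). mult (add_group U) y x = one (add_group U)"
      using H neg cl(2) by auto
  qed (simp_all add: cl)
  interpret UG: comm_group "add_group U" by (rule UG)
  have UN: "gneg U a = m_inv (add_group U) a" if "a \<in> gdom U" for a
    using UG.inv_equality[of "gneg U a" a] that neg cl by simp
  have UM: "lattice_ops (gdom U) (gmeet U) (gjoin U)"
  proof
    fix x y assume H: "x \<in> gdom U" "y \<in> gdom U"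
    note [simp] = em' cl pd
    show "gmeet U x y \<in> gdom U" "gjoin U x y \<in> gdom U" using H by simp_all
    show "gmeet U x y = gmeet U y x" by (rule ginj) (use H WM.meet_comm in simp_all)
    show "gjoin U x y = gjoin U y x" by (rule ginj) (use H WM.join_comm in simp_all)
    show "gmeet U x (gjoin U x y) = x" by (rule ginj) (use H WM.meet_absorb in simp_all)
    show "gjoin U x (gmeet U x y) = x" by (rule ginj) (use H WM.join_absorb in simp_all)
    fix z assume Z: "z \<in> gdom U"
    show "gmeet U (gmeet U x y) z = gmeet U x (gmeet U y z)"
      by (rule ginj) (use H Z WM.meet_assoc in simp_all)
    show "gjoin U (gjoin U x y) z = gjoin U x (gjoin U y z)"
      by (rule ginj) (use H Z WM.join_assoc in simp_all)
  qed
  have UL: "bounded_distrib_lattice_ops (ldom U) (lmeet U) (ljoin U) (lbot U) (ltop U)"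
  proof
    note [simp] = em' cl qd
    show "lbot U \<in> ldom U" "ltop U \<in> ldom U" by simp_all
    fix x assume X: "x \<in> ldom U"
    show "lmeet U (lbot U) x = lbot U" by (rule linj) (use X WL.bt_least in simp_all)
    show "lmeet U x (ltop U) = x" by (rule linj) (use X WL.tp_greatest in simp_all)
    fix y assume Y: "y \<in> ldom U"
    note H = X Y
    show "lmeet U x y \<in> ldom U" "ljoin U x y \<in> ldom U" using H by simp_all
    show "lmeet U x y = lmeet U y x" by (rule linj) (use H WL.meet_comm in simp_all)
    show "ljoin U x y = ljoin U y x" by (rule linj) (use H WL.join_comm in simp_all)
    show "lmeet U x (ljoin U x y) = x" by (rule linj) (use H WL.meet_absorb in simp_all)
    show "ljoin U x (lmeet U x y) = x" by (rule linj) (use H WL.join_absorb in simp_all)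
    fix z assume Z: "z \<in> ldom U"
    show "lmeet U (lmeet U x y) z = lmeet U x (lmeet U y z)"
      by (rule linj) (use H Z WL.meet_assoc in simp_all)
    show "ljoin U (ljoin U x y) z = ljoin U x (ljoin U y z)"
      by (rule linj) (use H Z WL.join_assoc in simp_all)
    show "lmeet U x (ljoin U y z) = ljoin U (lmeet U x y) (lmeet U x z)"
      by (rule linj) (use H Z WL.meet_join_distrib in simp_all)
  qed
  show ?thesis
    unfolding densely_valued_lgroup_def valued_lgroup_def abelian_lgroup_def gle_def lle_def
  proof (intro conjI ballI impI UG UN UM UL att)
    fix a assume a: "a \<in> gdom U" and "val U a = ltop U"
    then have "val W (p a) = ltop W" by (simp flip: em')
    with a P(5)[of "p a"] show "gmeet U (gzero U) a = gzero U"
      by (intro ginj) (simp_all add: em' cl pd)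
  next
    fix a b assume H: "a \<in> gdom U" "b \<in> gdom U"
    note [simp] = em' cl pd qd
    show "val U (gmeet U a b) = lmeet U (val U a) (val U b)"
      by (rule linj) (use H P in simp_all)
    show "val U (gjoin U a b) = ljoin U (val U a) (val U b)"
      by (rule linj) (use H P in simp_all)
    show "lmeet U (lmeet U (val U a) (val U b)) (val U (gadd U a b)) = lmeet U (val U a) (val U b)"
      by (rule linj) (use H P in simp_all)
    fix c assume C: "c \<in> gdom U"
    show "gadd U a (gmeet U b c) = gmeet U (gadd U a b) (gadd U a c)"
      by (rule ginj) (use H C D in simp_all)
    show "gadd U a (gjoin U b c) = gjoin U (gadd U a b) (gadd U a c)"
      by (rule ginj) (use H C D in simp_all)
  next
    show "val U (gzero U) = ltop U"
      by (rule linj) (use P(4) in \<open>simp_all add: em' cl\<close>)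
  qed (simp_all add: UN cl)
qed

theorem small_extension:
  fixes V :: "('g, 'l) vlgrp" and W :: "('a, 'b) vlgrp"
  assumes W: "densely_valued_lgroup W" and em: "embedding f h V W"
    and p: "existential p" and e: "range e \<subseteq> gdom V" and d: "range d \<subseteq> ldom V"
    and s: "sat W (f \<circ> e) (h \<circ> d) p"
  shows "\<exists>(U :: ('g + 'l + nat, 'g + 'l + nat) vlgrp) f' h'.
    densely_valued_lgroup U \<and> embedding f' h' V U \<and> sat U (f' \<circ> e) (h' \<circ> d) p"
proof -
  let ?K = "UNIV :: ('g + 'l + nat) set"
  have K: "infinite ?K" by simp
  from existential_witnesses[OF p s, where 'u = "'g + 'l + nat" and 'w = "'g + 'l + nat"]
  obtain A B where AB: "finite A" "A \<subseteq> gdom W" "finite B" "B \<subseteq> ldom W"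
    and wit: "\<forall>(U :: ('g + 'l + nat, 'g + 'l + nat) vlgrp) f' h' e' d'.
       densely_valued_lgroup U \<and> embedding f' h' U W \<and> A \<subseteq> f' ` gdom U \<and> B \<subseteq> h' ` ldom U \<and>
       range e' \<subseteq> gdom U \<and> range d' \<subseteq> ldom U \<and> f' \<circ> e' = f \<circ> e \<and> h' \<circ> d' = h \<circ> d
         \<longrightarrow> sat U e' d' p"
    by (elim exE conjE) (rule that)
  have "|gdom V| \<le>o |?K|" "|ldom V| \<le>o |?K|"
    by (rule card_of_ordLeq[THEN iffD1], rule exI[of _ Inl], simp)
      (rule card_of_ordLeq[THEN iffD1], rule exI[of _ "Inr \<circ> Inl"], simp add: inj_on_def)
  then have small: "|A \<union> f ` gdom V| \<le>o |?K|" "|B \<union> h ` ldom V| \<le>o |?K|"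
    using small_Un[OF K small_finite[OF K]] small_image AB(1,3) by blast+
  have sub: "A \<union> f ` gdom V \<subseteq> gdom W" "B \<union> h ` ldom V \<subseteq> ldom W"
    using AB em by (auto simp: embedding_def)
  from small_substructure[OF W K sub(1) small(1) sub(2) small(2)]
  obtain G L where GL: "A \<union> f ` gdom V \<subseteq> G" "G \<subseteq> gdom W" "|G| \<le>o |?K|"
      "B \<union> h ` ldom V \<subseteq> L" "L \<subseteq> ldom W" "|L| \<le>o |?K|"
    and cl: "gzero W \<in> G" "lbot W \<in> L" "ltop W \<in> L" "\<forall>a\<in>G. gneg W a \<in> G \<and> val W a \<in> L"
      "\<forall>a\<in>G. \<forall>b\<in>G. gadd W a b \<in> G \<and> gmeet W a b \<in> G \<and> gjoin W a b \<in> G"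
      "\<forall>k\<in>L. \<forall>l\<in>L. lmeet W k l \<in> L \<and> ljoin W k l \<in> L"
    and att: "\<forall>l\<in>L. l \<noteq> lbot W \<longrightarrow> (\<exists>a\<in>G. l = val W a)"
    by (elim exE conjE) (rule that)
  from GL obtain i j :: "_ \<Rightarrow> 'g + 'l + nat" where i: "inj_on i G" and j: "inj_on j L"
    by (auto simp flip: card_of_ordLeq)
  define i' j' where "i' = inv_into G i" and "j' = inv_into L j"
  have i': "\<And>a. a \<in> G \<Longrightarrow> i' (i a) = a" and j': "\<And>l. l \<in> L \<Longrightarrow> j' (j l) = l"
    using i j by (auto simp: i'_def j'_def)
  define U :: "('g + 'l + nat, 'g + 'l + nat) vlgrp" where
    "U = \<lparr>gdom = i ` G, gzero = i (gzero W), gadd = (\<lambda>a b. i (gadd W (i' a) (i' b))),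
       gneg = (\<lambda>a. i (gneg W (i' a))), gmeet = (\<lambda>a b. i (gmeet W (i' a) (i' b))),
       gjoin = (\<lambda>a b. i (gjoin W (i' a) (i' b))),
       ldom = j ` L, lbot = j (lbot W), ltop = j (ltop W),
       lmeet = (\<lambda>k l. j (lmeet W (j' k) (j' l))), ljoin = (\<lambda>k l. j (ljoin W (j' k) (j' l))),
       val = (\<lambda>a. j (val W (i' a)))\<rparr>"
  have UW: "embedding i' j' U W"
    unfolding embedding_def using GL(2,5)
    by (auto simp: U_def i' j' cl inj_on_def)
  have dU: "densely_valued_lgroup U"
  proof (rule densely_valued_substructure[OF W UW])
    fix l assume "l \<in> ldom U" "l \<noteq> lbot U"
    then obtain k where k: "k \<in> L" "l = j k" "k \<noteq> lbot W" by (auto simp: U_def)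
    then show "\<exists>a\<in>gdom U. l = val U a" using att by (auto simp: U_def i')
  qed (auto simp: U_def i' j' cl)
  have fh: "\<And>a. a \<in> gdom V \<Longrightarrow> f a \<in> G" "\<And>l. l \<in> ldom V \<Longrightarrow> h l \<in> L"
    using GL(1,4) by auto
  have VU: "embedding (i \<circ> f) (j \<circ> h) V U"
  proof -
    have "inj_on (i \<circ> f) (gdom V)" "inj_on (j \<circ> h) (ldom V)"
      using em i j fh by (auto simp: embedding_def inj_on_def)
    with em fh show ?thesis by (simp add: embedding_def U_def i' j' image_subset_iff)
  qed
  have "A \<subseteq> i' ` gdom U"
  proof
    fix x assume "x \<in> A"
    with GL(1) have "x \<in> G" by auto
    then show "x \<in> i' ` gdom U" by (intro image_eqI[of _ _ "i x"]) (simp_all add: U_def i')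
  qed
  moreover have "B \<subseteq> j' ` ldom U"
  proof
    fix x assume "x \<in> B"
    with GL(4) have "x \<in> L" by auto
    then show "x \<in> j' ` ldom U" by (intro image_eqI[of _ _ "j x"]) (simp_all add: U_def j')
  qed
  moreover have ed: "f (e n) \<in> G" "h (d n) \<in> L" for n
    using e d fh by auto
  then have "range ((i \<circ> f) \<circ> e) \<subseteq> gdom U" "range ((j \<circ> h) \<circ> d) \<subseteq> ldom U"
    by (simp_all add: U_def image_subset_iff)
  moreover have "i' \<circ> ((i \<circ> f) \<circ> e) = f \<circ> e" "j' \<circ> ((j \<circ> h) \<circ> d) = h \<circ> d"
    using ed by (simp_all add: fun_eq_iff i' j')
  ultimately have sU: "sat U ((i \<circ> f) \<circ> e) ((j \<circ> h) \<circ> d) p"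
    using dU UW wit[THEN spec[of _ U], THEN spec[of _ i'], THEN spec[of _ j'],
        THEN spec[of _ "(i \<circ> f) \<circ> e"], THEN spec[of _ "(j \<circ> h) \<circ> d"]] by blast
  show ?thesis
    by (rule exI[of _ U], rule exI[of _ "i \<circ> f"], rule exI[of _ "j \<circ> h"]) (intro conjI dU VU sU)
qed

unbundle no cardinal_syntax

lemma reflectsD:
  assumes "reflects Phi f h V W" "Phi p" "range e \<subseteq> gdom V" "range d \<subseteq> ldom V"
    "sat W (f \<circ> e) (h \<circ> d) p"
  shows "sat V e d p"
proof (rule mp)
  show "Phi p \<and> range e \<subseteq> gdom V \<and> range d \<subseteq> ldom V \<and> sat W (f \<circ> e) (h \<circ> d) p \<longrightarrow> sat V e d p"
    using assms(1)[unfolded reflects_def, THEN spec, THEN spec, THEN spec] .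
qed (intro conjI assms)

theorem algebraically_closed_reflects:
  fixes V :: "('g, 'l) vlgrp" and W :: "('a, 'b) vlgrp"
  assumes "algebraically_closed V" "densely_valued_lgroup W" "embedding f h V W"
  shows "reflects positive_existential f h V W"
  unfolding reflects_def
proof (intro allI impI, elim conjE)
  fix p e d
  assume H: "positive_existential p" "range e \<subseteq> gdom V" "range d \<subseteq> ldom V"
    "sat W (f \<circ> e) (h \<circ> d) p"
  then have ex: "existential p" by (simp add: positive_existential_def)
  obtain U :: "('g + 'l + nat, 'g + 'l + nat) vlgrp" and f' h' where
    U: "densely_valued_lgroup U" "embedding f' h' V U" and sU: "sat U (f' \<circ> e) (h' \<circ> d) p"
    using small_extension[OF assms(2,3) ex H(2-4)] by (elim exE conjE) (rule that)
  have "reflects positive_existential f' h' V U"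
    by (rule assms(1)[unfolded algebraically_closed_def, THEN conjunct2, rule_format, OF conjI[OF U]])
  then show "sat V e d p" by (rule reflectsD) (rule H(1-3) sU)+
qed

theorem existentially_closed_reflects:
  fixes V :: "('g, 'l) vlgrp" and W :: "('a, 'b) vlgrp"
  assumes "existentially_closed V" "densely_valued_lgroup W" "embedding f h V W"
  shows "reflects existential f h V W"
  unfolding reflects_def
proof (intro allI impI, elim conjE)
  fix p e d
  assume H: "existential p" "range e \<subseteq> gdom V" "range d \<subseteq> ldom V"
    "sat W (f \<circ> e) (h \<circ> d) p"
  obtain U :: "('g + 'l + nat, 'g + 'l + nat) vlgrp" and f' h' where
    U: "densely_valued_lgroup U" "embedding f' h' V U" and sU: "sat U (f' \<circ> e) (h' \<circ> d) p"
    using small_extension[OF assms(2,3) H(1) H(2-4)] by (elim exE conjE) (rule that)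
  have "reflects existential f' h' V U"
    by (rule assms(1)[unfolded existentially_closed_def, THEN conjunct2, rule_format, OF conjI[OF U]])
  then show "sat V e d p" by (rule reflectsD) (rule H(1-3) sU)+
qed

end

theory Submission
  imports Defs "HOL-Algebra.Elementary_Groups"
begin

text \<open>
  A prime filter \<open>x\<close> of the lattice is a point: \<open>P (b - a) \<in> x\<close> defines a total preorder on the group,
  compatible with addition, and two elements are equal if they are equivalent at all points. Hence
  \<open>V\<close> embeds in a product of linearly ordered groups whose lattice is the power set of the index set.
  In this extension every element of the lattice of \<open>V\<close> splits, so an existentially closed \<open>V\<close> is
  atomless. The extension also shows that an algebraically closed \<open>V\<close> has a Boolean lattice, glues
  any two elements along a lattice element, and has an element of value \<open>\<bottom>\<close>; it is divisible because
  \<open>a \<mapsto> n a\<close> embeds \<open>V\<close> in itself.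

  For such a \<open>V\<close> with atomless lattice, the truth of a quantifier-free formula depends only on the
  finite set of patterns (signs of finitely many linear forms, membership of finitely many lattice
  elements) that occur at the points. The patterns of a tuple are the same in \<open>V\<close> and in an
  extension. One more element of the extension refines the patterns, and \<open>V\<close> has an element with
  exactly the same refinements: at a point one has to realize a cut in a divisible ordered group
  without endpoints, and by atomlessness each pattern set is divided into as many clopen parts as
  there are refinements, on which the local solutions are glued.
\<close>

section \<open>Prime filters\<close>

text \<open>The strict inequalities in \<open>\<bottom> < k < l\<close> are negated equations, to
  which algebraic closedness does not apply directly. In terms of points, an equation says that
  certain patterns do not occur, and a negated equation says that some violating pattern does occur.
  Gluing alone can avoid unwanted patterns; to realize several refinements of one old pattern, its
  set of points must also break into several nonempty pieces, and this is what atomlessness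
  supplies. The argument transfers patterns and not elements. The extension \<open>W\<close> is an
  arbitrary densely valued group, neither divisible nor atomless; it is consulted only at single
  points, for the order of finitely many values. All construction takes place in \<open>V\<close>,
  and a local solution is read off from that finite order, so that one element serves all points
  with the same pattern. The two assignments are related only by equality of their pattern sets.
  This relation survives the choice of a witness, whereas a witness in \<open>W\<close> need not
  come from \<open>V\<close> through the embedding.\<close>

definition lattice_filter :: "('g, 'l) vlgrp \<Rightarrow> 'l set \<Rightarrow> bool" where
  "lattice_filter V x \<longleftrightarrow> x \<subseteq> ldom V \<and>
     (\<forall>a\<in>x. \<forall>b\<in>x. lmeet V a b \<in> x) \<and> (\<forall>a\<in>x. \<forall>b\<in>ldom V. lle V a b \<longrightarrow> b \<in> x)"

text \<open>Points are proper and nonempty. If \<open>\<bottom> = \<top>\<close>, there are none,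
  which agrees with the group being trivial in that case.\<close>

definition spec :: "('g, 'l) vlgrp \<Rightarrow> 'l set set" where
  "spec V = {x. lattice_filter V x \<and> ltop V \<in> x \<and> lbot V \<notin> x \<and>
     (\<forall>a\<in>ldom V. \<forall>b\<in>ldom V. ljoin V a b \<in> x \<longrightarrow> a \<in> x \<or> b \<in> x)}"

locale dense_vlgroup =
  fixes V :: "('g, 'l) vlgrp"
  assumes dense: "densely_valued_lgroup V"
begin

sublocale L: bounded_distrib_lattice_ops "ldom V" "lmeet V" "ljoin V" "lbot V" "ltop V"
  using dense by (simp add: densely_valued_lgroup_def valued_lgroup_def)

lemmas closed [simp] = densely_valued_closed[OF dense]

lemma lle_refl: "a \<in> ldom V \<Longrightarrow> lle V a a"
  using L.meet_absorb[of a "lmeet V a a"] L.join_absorb[of a a] by (simp add: lle_def)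

lemma lle_trans:
  "\<lbrakk>lle V a b; lle V b c; a \<in> ldom V; b \<in> ldom V; c \<in> ldom V\<rbrakk> \<Longrightarrow> lle V a c"
  unfolding lle_def using L.meet_assoc[of a b c] by simp

lemma lle_antisym: "\<lbrakk>lle V a b; lle V b a; a \<in> ldom V; b \<in> ldom V\<rbrakk> \<Longrightarrow> a = b"
  unfolding lle_def using L.meet_comm[of a b] by simp

lemma meet_lle:
  assumes "a \<in> ldom V" "b \<in> ldom V"
  shows "lle V (lmeet V a b) a" "lle V (lmeet V a b) b"
  unfolding lle_def
  using assms lle_refl[of a] lle_refl[of b]
    L.meet_assoc[of a b b] L.meet_assoc[of a a b] L.meet_comm[of "lmeet V a b" a]
  by (simp_all add: lle_def)

lemma lle_meetI:
  "\<lbrakk>lle V c a; lle V c b; a \<in> ldom V; b \<in> ldom V; c \<in> ldom V\<rbrakk> \<Longrightarrow> lle V c (lmeet V a b)"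
  unfolding lle_def using L.meet_assoc[of c a b] by simp

lemma lle_iff_join: "\<lbrakk>a \<in> ldom V; b \<in> ldom V\<rbrakk> \<Longrightarrow> lle V a b \<longleftrightarrow> ljoin V a b = b"
  unfolding lle_def
  using L.meet_absorb[of a b] L.join_absorb[of b a] L.meet_comm[of a b] L.join_comm[of a b]
  by auto

lemma join_lle:
  assumes "a \<in> ldom V" "b \<in> ldom V"
  shows "lle V a (ljoin V a b)" "lle V b (ljoin V a b)"
  unfolding lle_def using assms L.meet_absorb[of a b] L.meet_absorb[of b a] L.join_comm[of a b]
  by simp_all

lemma join_lleI:
  assumes "lle V a c" "lle V b c" "a \<in> ldom V" "b \<in> ldom V" "c \<in> ldom V"
  shows "lle V (ljoin V a b) c"
  using assms L.join_assoc[of a b c] by (simp add: lle_iff_join)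

lemma lle_top: "a \<in> ldom V \<Longrightarrow> lle V a (ltop V)"
  by (simp add: lle_def L.tp_greatest)

lemma bot_lle: "a \<in> ldom V \<Longrightarrow> lle V (lbot V) a"
  by (simp add: lle_def L.bt_least)

text \<open>The maximal filters disjoint from \<open>B\<close> are prime.\<close>

theorem prime_filter_separation:
  assumes A: "A \<subseteq> ldom V" "A \<noteq> {}" "\<And>a b. \<lbrakk>a \<in> A; b \<in> A\<rbrakk> \<Longrightarrow> lmeet V a b \<in> A"
    and B: "B \<subseteq> ldom V" "B \<noteq> {}" "\<And>a b. \<lbrakk>a \<in> B; b \<in> B\<rbrakk> \<Longrightarrow> ljoin V a b \<in> B"
    and AB: "\<And>a b. \<lbrakk>a \<in> A; b \<in> B\<rbrakk> \<Longrightarrow> \<not> lle V a b"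
  obtains x where "x \<in> spec V" "A \<subseteq> x" "x \<inter> B = {}"
proof -
  define F where "F = {x. lattice_filter V x \<and> A \<subseteq> x \<and> x \<inter> B = {}}"
  define up where "up S = {b \<in> ldom V. \<exists>a\<in>S. lle V a b}" for S
  have up_filter: "lattice_filter V (up S)"
    if S: "S \<subseteq> ldom V" "\<And>a b. \<lbrakk>a \<in> S; b \<in> S\<rbrakk> \<Longrightarrow> lmeet V a b \<in> S" for S
    unfolding lattice_filter_def
  proof (intro conjI ballI impI)
    show "up S \<subseteq> ldom V" by (auto simp: up_def)
    fix b assume b: "b \<in> up S"
    then obtain a where a: "b \<in> ldom V" "a \<in> S" "lle V a b" "a \<in> ldom V" using S by (auto simp: up_def)
    { fix b' assume "b' \<in> up S"
      then obtain a' where a': "b' \<in> ldom V" "a' \<in> S" "lle V a' b'" "a' \<in> ldom V"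
        using S by (auto simp: up_def)
      have "lle V (lmeet V a a') (lmeet V b b')"
        using a a' meet_lle[of a a'] lle_trans[of "lmeet V a a'" a b] lle_trans[of "lmeet V a a'" a' b']
        by (simp add: lle_meetI)
      then show "lmeet V b b' \<in> up S" using a a' S by (auto simp: up_def) }
    fix c assume "c \<in> ldom V" "lle V b c"
    then show "c \<in> up S" using a lle_trans[of a b c] by (auto simp: up_def)
  qed
  have "\<exists>M\<in>F. \<forall>X\<in>F. M \<subseteq> X \<longrightarrow> X = M"
  proof (rule subset_Zorn_nonempty)
    have "lattice_filter V (up A)" using A by (intro up_filter) auto
    moreover have "A \<subseteq> up A" using A by (auto simp: up_def intro: lle_refl)
    ultimately show "F \<noteq> {}" using AB by (auto simp: F_def up_def)
  next
    fix C assume C: "C \<noteq> {}" "subset.chain F C"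
    then have sub: "C \<subseteq> F" and ch: "\<And>x y. \<lbrakk>x \<in> C; y \<in> C\<rbrakk> \<Longrightarrow> x \<subseteq> y \<or> y \<subseteq> x"
      by (auto simp: subset_chain_def)
    have "lattice_filter V (\<Union>C)"
      unfolding lattice_filter_def
    proof (intro conjI ballI impI)
      show "\<Union>C \<subseteq> ldom V" using sub by (auto simp: F_def lattice_filter_def)
      fix a assume a: "a \<in> \<Union>C"
      { fix b assume b: "b \<in> \<Union>C"
        then obtain x where x: "x \<in> C" "a \<in> x" "b \<in> x" using a ch by blast
        then have "lattice_filter V x" using sub by (auto simp: F_def)
        then show "lmeet V a b \<in> \<Union>C" using x by (auto simp: lattice_filter_def) }
      fix b assume "b \<in> ldom V" "lle V a b"
      then show "b \<in> \<Union>C" using a sub by (fastforce simp: F_def lattice_filter_def)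
    qed
    then show "\<Union>C \<in> F" using C sub by (auto simp: F_def)
  qed
  then obtain M where M: "lattice_filter V M" "A \<subseteq> M" "M \<inter> B = {}"
    and max: "\<And>X. \<lbrakk>lattice_filter V X; A \<subseteq> X; X \<inter> B = {}; M \<subseteq> X\<rbrakk> \<Longrightarrow> X = M"
    by (auto simp: F_def)
  have Ml: "M \<subseteq> ldom V" and Mm: "\<And>a b. \<lbrakk>a \<in> M; b \<in> M\<rbrakk> \<Longrightarrow> lmeet V a b \<in> M"
    and Mu: "\<And>a b. \<lbrakk>a \<in> M; b \<in> ldom V; lle V a b\<rbrakk> \<Longrightarrow> b \<in> M"
    using M(1) by (auto simp: lattice_filter_def)
  obtain a0 b0 where a0: "a0 \<in> A" and b0: "b0 \<in> B" using A B by auto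
  have top: "ltop V \<in> M" using a0 M(2) Ml lle_top[of a0] Mu[of a0 "ltop V"] by auto
  have bot: "lbot V \<notin> M" using b0 M(3) B(1) bot_lle[of b0] Mu[of "lbot V" b0] by auto
  \<comment> \<open>By maximality, the filter generated by \<open>M\<close> and \<open>a\<close>
    meets \<open>B\<close>.\<close>
  have ext: "\<exists>m\<in>M. \<exists>\<beta>\<in>B. lle V (lmeet V m a) \<beta>" if a: "a \<in> ldom V" "a \<notin> M" for a
  proof (rule ccontr)
    assume no: "\<not> ?thesis"
    define S where "S = (\<lambda>m. lmeet V m a) ` M"
    have S: "S \<subseteq> ldom V" using Ml a by (auto simp: S_def)
    have "lmeet V s t \<in> S" if "s \<in> S" "t \<in> S" for s t
    proof -
      from that obtain m n where mn: "m \<in> M" "n \<in> M" "s = lmeet V m a" "t = lmeet V n a"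
        by (auto simp: S_def)
      then have cl: "m \<in> ldom V" "n \<in> ldom V" using Ml by auto
      have "lmeet V s t = lmeet V (lmeet V m n) a"
        using mn cl a lle_refl[of a] L.meet_assoc[of m a "lmeet V n a"] L.meet_assoc[of n a a]
          L.meet_comm[of a "lmeet V n a"] L.meet_assoc[of m n a]
        by (simp add: lle_def)
      then show ?thesis using Mm mn by (auto simp: S_def)
    qed
    then have f: "lattice_filter V (up S)" using S by (intro up_filter) auto
    have MS: "M \<subseteq> up S" using Ml a meet_lle by (auto simp: up_def S_def)
    have "a \<in> up S" using a top meet_lle(2)[of "ltop V" a] by (auto simp: up_def S_def)
    moreover have "up S \<inter> B = {}" using no by (auto simp: up_def S_def)
    ultimately show False using max[OF f] MS M(2) a by auto
  qed
  \<comment> \<open>If neither lies in \<open>M\<close>, distributivity merges the two witnesses: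
    \<open>lmeet V k (ljoin V a b)\<close> is in \<open>M\<close> and lies below
    \<open>j \<in> B\<close>, which \<open>M\<close> avoids.\<close>
  have prime: "a \<in> M \<or> b \<in> M" if ab: "a \<in> ldom V" "b \<in> ldom V" "ljoin V a b \<in> M" for a b
  proof (rule ccontr)
    assume "\<not> ?thesis"
    then obtain m \<beta> n \<gamma> where m: "m \<in> M" "\<beta> \<in> B" "lle V (lmeet V m a) \<beta>"
      and n: "n \<in> M" "\<gamma> \<in> B" "lle V (lmeet V n b) \<gamma>" using ext ab by metis
    define k where "k = lmeet V m n"
    define j where "j = ljoin V \<beta> \<gamma>"
    have cl: "m \<in> ldom V" "n \<in> ldom V" "\<beta> \<in> ldom V" "\<gamma> \<in> ldom V" using m n Ml B by auto
    have kj: "k \<in> M" "k \<in> ldom V" "j \<in> B" "j \<in> ldom V"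
      using m n cl Mm B(3) by (auto simp: k_def j_def)
    have le1: "lle V (lmeet V k a) (lmeet V m a)" "lle V (lmeet V k b) (lmeet V n b)"
      using cl ab kj meet_lle[of k a] meet_lle[of k b] meet_lle[of m n]
        lle_trans[of "lmeet V k a" k m] lle_trans[of "lmeet V k b" k n]
      by (simp_all add: lle_meetI flip: k_def)
    have "lle V (lmeet V k a) j"
      by (rule lle_trans[OF le1(1) lle_trans[OF m(3)]])
        (use join_lle(1)[of \<beta> \<gamma>] cl ab kj in \<open>auto simp: j_def\<close>)
    moreover have "lle V (lmeet V k b) j"
      by (rule lle_trans[OF le1(2) lle_trans[OF n(3)]])
        (use join_lle(2)[of \<beta> \<gamma>] cl ab kj in \<open>auto simp: j_def\<close>)
    ultimately have "lle V (lmeet V k (ljoin V a b)) j"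
      using kj ab by (simp add: L.meet_join_distrib join_lleI)
    moreover have "lmeet V k (ljoin V a b) \<in> M" using kj ab Mm by auto
    ultimately have "j \<in> M" using Mu kj by blast
    then show False using kj M(3) by auto
  qed
  show ?thesis
  proof (rule that[of M])
    show "M \<in> spec V" unfolding spec_def using M(1) top bot prime by blast
    show "A \<subseteq> M" "M \<inter> B = {}" by (fact M)+
  qed
qed

lemma spec_top: "x \<in> spec V \<Longrightarrow> ltop V \<in> x"
  and spec_bot: "x \<in> spec V \<Longrightarrow> lbot V \<notin> x"
  by (simp_all add: spec_def)

lemma spec_sub: "x \<in> spec V \<Longrightarrow> a \<in> x \<Longrightarrow> a \<in> ldom V"
  unfolding spec_def lattice_filter_def by blast

lemma spec_up: "\<lbrakk>x \<in> spec V; a \<in> x; b \<in> ldom V; lle V a b\<rbrakk> \<Longrightarrow> b \<in> x"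
  unfolding spec_def lattice_filter_def by blast

lemma spec_meet:
  assumes "x \<in> spec V" "a \<in> ldom V" "b \<in> ldom V"
  shows "lmeet V a b \<in> x \<longleftrightarrow> a \<in> x \<and> b \<in> x"
proof
  assume "lmeet V a b \<in> x"
  then show "a \<in> x \<and> b \<in> x"
    using spec_up[OF assms(1)] meet_lle[of a b] assms by blast
next
  assume "a \<in> x \<and> b \<in> x"
  then show "lmeet V a b \<in> x" using assms(1) by (simp add: spec_def lattice_filter_def)
qed

lemma spec_join:
  assumes "x \<in> spec V" "a \<in> ldom V" "b \<in> ldom V"
  shows "ljoin V a b \<in> x \<longleftrightarrow> a \<in> x \<or> b \<in> x"
proof
  assume "ljoin V a b \<in> x"
  then show "a \<in> x \<or> b \<in> x" using assms by (simp add: spec_def)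
next
  assume "a \<in> x \<or> b \<in> x"
  then show "ljoin V a b \<in> x"
    using assms spec_up[of x _ "ljoin V a b"] join_lle[of a b] by auto
qed

lemma meet_idem: "a \<in> ldom V \<Longrightarrow> lmeet V a a = a"
  and join_idem: "a \<in> ldom V \<Longrightarrow> ljoin V a a = a"
  using lle_refl[of a] lle_iff_join[of a a] by (simp_all add: lle_def)

text \<open>Prime filter separation for two singletons. From here on the order of the lattice is
  inclusion of sets of points, and identities are checked pointwise.\<close>

lemma lle_iff_spec:
  assumes "a \<in> ldom V" "b \<in> ldom V"
  shows "lle V a b \<longleftrightarrow> (\<forall>x\<in>spec V. a \<in> x \<longrightarrow> b \<in> x)"
proof
  assume R: "\<forall>x\<in>spec V. a \<in> x \<longrightarrow> b \<in> x"
  show "lle V a b"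
  proof (rule ccontr)
    assume "\<not> lle V a b"
    then obtain x where "x \<in> spec V" "{a} \<subseteq> x" "x \<inter> {b} = {}"
      using prime_filter_separation[of "{a}" "{b}"] assms meet_idem join_idem by auto
    with R show False by auto
  qed
next
  assume "lle V a b"
  then show "\<forall>x\<in>spec V. a \<in> x \<longrightarrow> b \<in> x" using spec_up assms by auto
qed

lemma lattice_eq_iff_spec:
  assumes "a \<in> ldom V" "b \<in> ldom V"
  shows "a = b \<longleftrightarrow> (\<forall>x\<in>spec V. a \<in> x \<longleftrightarrow> b \<in> x)"
  using assms lle_iff_spec[of a b] lle_iff_spec[of b a] lle_antisym[of a b] lle_refl by auto

end

section \<open>Totally preordered abelian groups\<close>

text \<open>The order is only a preorder: all elements that vanish at a point lie in the cone
  together with their inverses. Antisymmetry is added in \<open>linear_cone\<close>, after passing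
  to a quotient.\<close>

locale total_cone = comm_group G for G (structure) +
  fixes C
  assumes cone_sub: "C \<subseteq> carrier G"
    and cone_mult: "\<lbrakk>a \<in> C; b \<in> C\<rbrakk> \<Longrightarrow> a \<otimes> b \<in> C"
    and cone_total: "a \<in> carrier G \<Longrightarrow> a \<in> C \<or> inv a \<in> C"
begin

definition le where "le a b \<longleftrightarrow> b \<otimes> inv a \<in> C"

definition eqv where "eqv a b \<longleftrightarrow> le a b \<and> le b a"

lemma one_cone: "\<one> \<in> C"
  using cone_total[of "\<one>"] by auto

lemma le_refl: "a \<in> carrier G \<Longrightarrow> le a a"
  by (simp add: le_def one_cone)

lemma le_total: "\<lbrakk>a \<in> carrier G; b \<in> carrier G\<rbrakk> \<Longrightarrow> le a b \<or> le b a"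
  using cone_total[of "b \<otimes> inv a"] by (auto simp: le_def inv_mult_group)

lemma le_mult:
  assumes "le a b" "le c d" "a \<in> carrier G" "b \<in> carrier G" "c \<in> carrier G" "d \<in> carrier G"
  shows "le (a \<otimes> c) (b \<otimes> d)"
proof -
  have "(b \<otimes> d) \<otimes> inv (a \<otimes> c) = (b \<otimes> inv a) \<otimes> (d \<otimes> inv c)"
    using assms(3-) by (simp add: inv_mult m_ac)
  then show ?thesis using assms cone_mult by (simp add: le_def)
qed

lemma le_trans:
  assumes "le a b" "le b c" "a \<in> carrier G" "b \<in> carrier G" "c \<in> carrier G"
  shows "le a c"
proof -
  have "(b \<otimes> inv a) \<otimes> (c \<otimes> inv b) = (b \<otimes> inv b) \<otimes> (c \<otimes> inv a)"
    using assms(3-) by (simp only: m_ac m_closed inv_closed)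
  then have "c \<otimes> inv a = (b \<otimes> inv a) \<otimes> (c \<otimes> inv b)"
    using assms(3-) by simp
  then show ?thesis using assms cone_mult[of "b \<otimes> inv a" "c \<otimes> inv b"] by (simp add: le_def)
qed

lemma le_cancel:
  assumes "a \<in> carrier G" "b \<in> carrier G" "c \<in> carrier G"
  shows "le (a \<otimes> c) (b \<otimes> c) \<longleftrightarrow> le a b" "le (c \<otimes> a) (c \<otimes> b) \<longleftrightarrow> le a b"
proof -
  have *: "le (a \<otimes> c) (b \<otimes> c) \<longleftrightarrow> le a b"
    using le_mult[of a b c c] le_mult[of "a \<otimes> c" "b \<otimes> c" "inv c" "inv c"] assms le_refl
    by (auto simp: m_assoc)
  then show "le (a \<otimes> c) (b \<otimes> c) \<longleftrightarrow> le a b" "le (c \<otimes> a) (c \<otimes> b) \<longleftrightarrow> le a b"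
    using assms by (simp_all add: m_comm)
qed

lemma le_inv:
  assumes "a \<in> carrier G" "b \<in> carrier G"
  shows "le (inv a) (inv b) \<longleftrightarrow> le b a"
  using assms by (simp add: le_def m_comm)

text \<open>For the converse, \<open>b < a\<close> and \<open>n = m + 1\<close> would give
  \<open>a b^m \<le> a a^m \<le> b b^m\<close>, and cancelling \<open>b^m\<close> is a
  contradiction. This is why taking multiples will be an embedding of \<open>V\<close> into
  itself.\<close>

lemma le_pow:
  assumes "a \<in> carrier G" "b \<in> carrier G" "n > (0::nat)"
  shows "le (a [^] n) (b [^] n) \<longleftrightarrow> le a b"
proof
  have mono: "le (a [^] k) (b [^] k)" if "le a b" "a \<in> carrier G" "b \<in> carrier G" for a b and k :: nat
    using that by (induction k) (auto intro: le_mult simp: le_refl)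
  show "le a b \<Longrightarrow> le (a [^] n) (b [^] n)" using assms mono by blast
  assume n: "le (a [^] n) (b [^] n)"
  show "le a b"
  proof (rule ccontr)
    assume no: "\<not> le a b"
    then have ba: "le b a" using le_total assms by blast
    obtain m where m: "n = Suc m" using assms(3) by (cases n) auto
    have "le (a \<otimes> b [^] m) (a \<otimes> a [^] m)"
      using mono[OF ba] assms by (simp add: le_cancel)
    also have "a \<otimes> a [^] m = a [^] n" using assms m by (simp add: m_comm)
    finally have "le (a \<otimes> b [^] m) (b [^] n)" using n assms by (meson le_trans m_closed nat_pow_closed)
    then have "le (a \<otimes> b [^] m) (b \<otimes> b [^] m)" using assms m by (simp add: m_comm)
    with no show False using assms by (simp add: le_cancel)
  qed
qed

lemma eqv_refl: "a \<in> carrier G \<Longrightarrow> eqv a a"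
  and eqv_sym: "eqv a b \<Longrightarrow> eqv b a"
  by (simp_all add: eqv_def le_refl)

lemma eqv_trans:
  "\<lbrakk>eqv a b; eqv b c; a \<in> carrier G; b \<in> carrier G; c \<in> carrier G\<rbrakk> \<Longrightarrow> eqv a c"
  unfolding eqv_def by (meson le_trans)

lemma eqv_mult:
  "\<lbrakk>eqv a b; eqv c d; a \<in> carrier G; b \<in> carrier G; c \<in> carrier G; d \<in> carrier G\<rbrakk>
    \<Longrightarrow> eqv (a \<otimes> c) (b \<otimes> d)"
  unfolding eqv_def by (meson le_mult)

lemma eqv_inv: "\<lbrakk>eqv a b; a \<in> carrier G; b \<in> carrier G\<rbrakk> \<Longrightarrow> eqv (inv a) (inv b)"
  unfolding eqv_def by (simp add: le_inv)

lemma eqv_le_iff: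
  "\<lbrakk>eqv a a'; eqv b b'; a \<in> carrier G; b \<in> carrier G; a' \<in> carrier G; b' \<in> carrier G\<rbrakk>
    \<Longrightarrow> le a b \<longleftrightarrow> le a' b'"
  unfolding eqv_def by (meson le_trans)

lemma one_le_iff: "a \<in> carrier G \<Longrightarrow> le \<one> a \<longleftrightarrow> a \<in> C"
  by (simp add: le_def)

end


section \<open>Points of a densely valued group\<close>

context dense_vlgroup
begin

abbreviation "G \<equiv> add_group V"

lemma carrier_G [simp]: "carrier G = gdom V"
  and mult_G [simp]: "mult G = gadd V"
  and one_G [simp]: "one G = gzero V"
  by (simp_all add: add_group_def)

sublocale G: comm_group G
  using dense by (simp add: densely_valued_lgroup_def valued_lgroup_def abelian_lgroup_def)

sublocale M: lattice_ops "gdom V" "gmeet V" "gjoin V"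
  using dense by (simp add: densely_valued_lgroup_def valued_lgroup_def abelian_lgroup_def)

lemma gneg_eq: "a \<in> gdom V \<Longrightarrow> gneg V a = inv\<^bsub>G\<^esub> a"
  using dense by (simp add: densely_valued_lgroup_def valued_lgroup_def abelian_lgroup_def)

lemma gadd_gmeet:
  "\<lbrakk>a \<in> gdom V; b \<in> gdom V; c \<in> gdom V\<rbrakk> \<Longrightarrow> gadd V a (gmeet V b c) = gmeet V (gadd V a b) (gadd V a c)"
  and gadd_gjoin:
  "\<lbrakk>a \<in> gdom V; b \<in> gdom V; c \<in> gdom V\<rbrakk> \<Longrightarrow> gadd V a (gjoin V b c) = gjoin V (gadd V a b) (gadd V a c)"
  using dense by (simp_all add: densely_valued_lgroup_def valued_lgroup_def abelian_lgroup_def)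

lemma val_gmeet: "\<lbrakk>a \<in> gdom V; b \<in> gdom V\<rbrakk> \<Longrightarrow> val V (gmeet V a b) = lmeet V (val V a) (val V b)"
  and val_gjoin: "\<lbrakk>a \<in> gdom V; b \<in> gdom V\<rbrakk> \<Longrightarrow> val V (gjoin V a b) = ljoin V (val V a) (val V b)"
  and val_gadd: "\<lbrakk>a \<in> gdom V; b \<in> gdom V\<rbrakk> \<Longrightarrow> lle V (lmeet V (val V a) (val V b)) (val V (gadd V a b))"
  and val_gzero: "val V (gzero V) = ltop V"
  and val_top: "\<lbrakk>a \<in> gdom V; val V a = ltop V\<rbrakk> \<Longrightarrow> gle V (gzero V) a"
  using dense by (simp_all add: densely_valued_lgroup_def valued_lgroup_def)

lemma gle_antisym: "\<lbrakk>gle V a b; gle V b a; a \<in> gdom V; b \<in> gdom V\<rbrakk> \<Longrightarrow> a = b"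
  unfolding gle_def using M.meet_comm[of a b] by simp

lemma gle_gadd:
  assumes "gle V a b" "a \<in> gdom V" "b \<in> gdom V" "c \<in> gdom V"
  shows "gle V (gadd V c a) (gadd V c b)"
  using assms gadd_gmeet[of c a b] by (simp add: gle_def)

lemma val_top_iff: "a \<in> gdom V \<Longrightarrow> val V a = ltop V \<longleftrightarrow> gle V (gzero V) a"
proof
  assume a: "a \<in> gdom V" "gle V (gzero V) a"
  then have "lle V (ltop V) (val V a)" using val_gmeet[of "gzero V" a] by (simp add: gle_def lle_def val_gzero)
  then show "val V a = ltop V" using lle_antisym[of "val V a" "ltop V"] lle_top[of "val V a"] a by simp
qed (rule val_top)

text \<open>The meet \<open>m = c \<and> 0\<close> satisfies \<open>m + m = (c + c) \<and> c \<and> 0 = m\<close>, so it is \<open>0\<close>.\<close>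

lemma nonneg_of_double:
  assumes c: "c \<in> gdom V" and cc: "gle V (gzero V) (gadd V c c)"
  shows "gle V (gzero V) c"
proof -
  define m where "m = gmeet V c (gzero V)"
  have m: "m \<in> gdom V" using c by (simp add: m_def)
  have r0: "gadd V x (gzero V) = x" if "x \<in> gdom V" for x using G.r_one[of x] that by simp
  have "gadd V m m = gmeet V (gadd V m c) m"
    using gadd_gmeet[of m c "gzero V"] m c r0 by (simp flip: m_def)
  also have "gadd V m c = gmeet V (gadd V c c) c"
    using gadd_gmeet[of c c "gzero V"] m c r0 G.m_comm[of m c] by (simp flip: m_def)
  also have "gmeet V (gmeet V (gadd V c c) c) m = gmeet V (gmeet V c (gzero V)) m"
  proof -
    have "gmeet V (gmeet V (gadd V c c) c) m = gmeet V (gadd V c c) (gmeet V c m)"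
      using c m M.meet_assoc by simp
    also have "gmeet V c m = m"
      using c M.meet_assoc[of c c "gzero V"] M.meet_absorb[of c "gmeet V c c"] M.join_absorb[of c c]
      by (simp add: m_def)
    also have "gmeet V (gadd V c c) m = gmeet V (gmeet V (gzero V) (gadd V c c)) c"
      using c M.meet_assoc[of "gadd V c c" "gzero V" c] M.meet_comm[of c "gzero V"]
        M.meet_comm[of "gzero V" "gadd V c c"] by (simp add: m_def)
    also have "\<dots> = m" using cc c M.meet_comm[of c "gzero V"] by (simp add: gle_def m_def)
    finally show ?thesis
      using m M.meet_absorb[of m "gmeet V m m"] M.join_absorb[of m m] by (simp flip: m_def)
  qed
  also have "\<dots> = m"
    using m M.meet_absorb[of m "gmeet V m m"] M.join_absorb[of m m] by (simp flip: m_def)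
  finally have "m = gzero V" using G.l_cancel_one[of m m] m by simp
  then show ?thesis using M.meet_comm[of c "gzero V"] c by (simp add: m_def gle_def)
qed

lemma gle_gjoin: "\<lbrakk>a \<in> gdom V; b \<in> gdom V\<rbrakk> \<Longrightarrow> gle V a (gjoin V a b)"
  and gle_gjoin2: "\<lbrakk>a \<in> gdom V; b \<in> gdom V\<rbrakk> \<Longrightarrow> gle V b (gjoin V a b)"
  unfolding gle_def using M.meet_absorb[of a b] M.meet_absorb[of b a] M.join_comm[of a b] by simp_all

lemma gle_trans: "\<lbrakk>gle V a b; gle V b c; a \<in> gdom V; b \<in> gdom V; c \<in> gdom V\<rbrakk> \<Longrightarrow> gle V a c"
  unfolding gle_def using M.meet_assoc[of a b c] by simp

text \<open>Twice \<open>a \<or> -a\<close> is at least \<open>a + (a \<or> -a)\<close>, which is at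
  least \<open>a + (-a) = 0\<close>.\<close>

lemma gjoin_neg_nonneg:
  assumes "a \<in> gdom V"
  shows "gle V (gzero V) (gjoin V a (gneg V a))"
proof (rule nonneg_of_double)
  let ?c = "gjoin V a (gneg V a)"
  have "gle V (gadd V a (gneg V a)) (gadd V a ?c)"
    using assms by (intro gle_gadd gle_gjoin2) auto
  moreover have "gle V (gadd V ?c a) (gadd V ?c ?c)"
    using assms by (intro gle_gadd gle_gjoin) auto
  moreover have "gadd V a (gneg V a) = gzero V" using G.r_inv[of a] assms by (simp add: gneg_eq)
  ultimately show "gle V (gzero V) (gadd V ?c ?c)"
    using assms G.m_comm[of a ?c] gle_trans[of "gzero V" "gadd V a ?c" "gadd V ?c ?c"] by simp
qed (use assms in simp)

definition cone :: "'l set \<Rightarrow> 'g set" where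
  "cone x = {a \<in> gdom V. val V a \<in> x}"

lemma in_cone: "a \<in> cone x \<longleftrightarrow> a \<in> gdom V \<and> val V a \<in> x"
  by (simp add: cone_def)

text \<open>Closure under addition is the axiom on \<open>P (a + b)\<close>. Totality holds since
  \<open>P (a \<or> -a) = \<top>\<close> belongs to the prime filter, which therefore contains
  \<open>P a\<close> or \<open>P (-a)\<close>.\<close>

lemma cone_total_cone: "x \<in> spec V \<Longrightarrow> total_cone G (cone x)"
proof
  assume x: "x \<in> spec V"
  show "cone x \<subseteq> carrier G" by (auto simp: cone_def)
  fix a b assume ab: "a \<in> cone x" "b \<in> cone x"
  then show "a \<otimes>\<^bsub>G\<^esub> b \<in> cone x"
    using x val_gadd[of a b] spec_meet[of x "val V a" "val V b"]
      spec_up[of x "lmeet V (val V a) (val V b)" "val V (gadd V a b)"] by (simp add: cone_def)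
next
  fix a assume x: "x \<in> spec V" and "a \<in> carrier G"
  then have a: "a \<in> gdom V" by simp
  then have "val V (gjoin V a (gneg V a)) = ltop V"
    using gjoin_neg_nonneg[OF a] val_top_iff[of "gjoin V a (gneg V a)"] by simp
  then show "a \<in> cone x \<or> inv\<^bsub>G\<^esub> a \<in> cone x"
    using a x spec_join[of x "val V a" "val V (gneg V a)"] spec_top[of x]
    by (simp add: val_gjoin cone_def flip: gneg_eq)
qed

abbreviation ple :: "'l set \<Rightarrow> 'g \<Rightarrow> 'g \<Rightarrow> bool" where "ple x \<equiv> total_cone.le G (cone x)"
abbreviation peq :: "'l set \<Rightarrow> 'g \<Rightarrow> 'g \<Rightarrow> bool" where "peq x \<equiv> total_cone.eqv G (cone x)"

lemma ple_def:
  "\<lbrakk>x \<in> spec V; a \<in> gdom V; b \<in> gdom V\<rbrakk> \<Longrightarrow> ple x a b \<longleftrightarrow> val V (gadd V b (gneg V a)) \<in> x"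
  by (simp add: total_cone.le_def[OF cone_total_cone] in_cone flip: gneg_eq)

lemma ple_zero: "\<lbrakk>x \<in> spec V; a \<in> gdom V\<rbrakk> \<Longrightarrow> ple x (gzero V) a \<longleftrightarrow> val V a \<in> x"
  using total_cone.one_le_iff[OF cone_total_cone, of x a] by (simp add: in_cone)

lemma gle_diff:
  assumes "a \<in> gdom V" "b \<in> gdom V"
  shows "gle V (gzero V) (gadd V b (gneg V a)) \<longleftrightarrow> gle V a b"
proof
  have *: "gadd V a (gadd V b (gneg V a)) = b"
    using assms G.m_comm[of b "gneg V a"] G.m_assoc[of a "gneg V a" b] G.r_inv[of a]
      G.l_one[of b] by (simp add: gneg_eq[symmetric])
  have **: "gadd V (gneg V a) a = gzero V" "gadd V (gneg V a) b = gadd V b (gneg V a)"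
    using assms G.l_inv[of a] G.m_comm[of b "gneg V a"] by (simp_all add: gneg_eq[symmetric])
  show "gle V (gzero V) (gadd V b (gneg V a)) \<Longrightarrow> gle V a b"
    using gle_gadd[of "gzero V" "gadd V b (gneg V a)" a] * G.r_one[of a] assms by simp
  show "gle V a b \<Longrightarrow> gle V (gzero V) (gadd V b (gneg V a))"
    using gle_gadd[of a b "gneg V a"] ** assms by simp
qed

text \<open>Dense valuedness turns \<open>a \<le> b\<close> into \<open>P (b - a) = \<top>\<close>,
  and \<open>\<top>\<close> is the only element that belongs to every point.\<close>

lemma gle_iff_ple:
  assumes "a \<in> gdom V" "b \<in> gdom V"
  shows "gle V a b \<longleftrightarrow> (\<forall>x\<in>spec V. ple x a b)"
proof -
  have "gle V a b \<longleftrightarrow> val V (gadd V b (gneg V a)) = ltop V"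
    using assms gle_diff val_top_iff by simp
  also have "\<dots> \<longleftrightarrow> (\<forall>x\<in>spec V. ple x a b)"
    using lattice_eq_iff_spec[of "val V (gadd V b (gneg V a))" "ltop V"] assms spec_top
    by (auto simp: ple_def)
  finally show ?thesis .
qed

lemma eq_iff_peq:
  assumes "a \<in> gdom V" "b \<in> gdom V"
  shows "a = b \<longleftrightarrow> (\<forall>x\<in>spec V. peq x a b)"
proof
  show "a = b \<Longrightarrow> \<forall>x\<in>spec V. peq x a b"
    using assms total_cone.eqv_refl[OF cone_total_cone] by simp
  assume "\<forall>x\<in>spec V. peq x a b"
  then show "a = b"
    using gle_iff_ple[of a b] gle_iff_ple[of b a] assms gle_antisym
    by (simp add: total_cone.eqv_def[OF cone_total_cone])
qed

text \<open>Translation by \<open>-c\<close> reduces both claims to the values of a meet and a join;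
  the second uses that the filter is prime. So the lattice operations become minimum and maximum at
  each point.\<close>

lemma ple_gmeet:
  assumes x: "x \<in> spec V" and a: "a \<in> gdom V" "b \<in> gdom V" "c \<in> gdom V"
  shows "ple x c (gmeet V a b) \<longleftrightarrow> ple x c a \<and> ple x c b"
    and "ple x c (gjoin V a b) \<longleftrightarrow> ple x c a \<or> ple x c b"
proof -
  have eq: "gadd V (gmeet V a b) (gneg V c) = gmeet V (gadd V a (gneg V c)) (gadd V b (gneg V c))"
    "gadd V (gjoin V a b) (gneg V c) = gjoin V (gadd V a (gneg V c)) (gadd V b (gneg V c))"
    using gadd_gmeet[of "gneg V c" a b] gadd_gjoin[of "gneg V c" a b] a
      G.m_comm[of "gneg V c" a] G.m_comm[of "gneg V c" b]
      G.m_comm[of "gneg V c" "gmeet V a b"] G.m_comm[of "gneg V c" "gjoin V a b"] by simp_all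
  show "ple x c (gmeet V a b) \<longleftrightarrow> ple x c a \<and> ple x c b"
    "ple x c (gjoin V a b) \<longleftrightarrow> ple x c a \<or> ple x c b"
    using x a by (simp_all add: ple_def eq val_gmeet val_gjoin spec_meet spec_join)
qed

lemma ple_refl: "\<lbrakk>x \<in> spec V; a \<in> gdom V\<rbrakk> \<Longrightarrow> ple x a a"
  using total_cone.le_refl[OF cone_total_cone] by simp

lemma ple_trans:
  "\<lbrakk>ple x a b; ple x b c; x \<in> spec V; a \<in> gdom V; b \<in> gdom V; c \<in> gdom V\<rbrakk> \<Longrightarrow> ple x a c"
  using total_cone.le_trans[OF cone_total_cone, of x a b c] by simp

lemma ple_total: "\<lbrakk>x \<in> spec V; a \<in> gdom V; b \<in> gdom V\<rbrakk> \<Longrightarrow> ple x a b \<or> ple x b a"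
  using total_cone.le_total[OF cone_total_cone, of x a b] by simp

lemma peq_gmeet_gjoin:
  assumes x: "x \<in> spec V" and a: "a \<in> gdom V" "b \<in> gdom V" and le: "ple x a b"
  shows "peq x (gmeet V a b) a" "peq x (gmeet V b a) a" "peq x (gjoin V a b) b" "peq x (gjoin V b a) b"
proof -
  let ?m = "gmeet V a b" and ?j = "gjoin V a b"
  have "ple x ?m a" using ple_gmeet(1)[of x a b ?m] x a ple_refl by simp
  moreover have "ple x a ?m" using ple_gmeet(1)[of x a b a] x a le ple_refl by simp
  ultimately show m: "peq x ?m a" by (simp add: total_cone.eqv_def[OF cone_total_cone[OF x]])
  then show "peq x (gmeet V b a) a" using M.meet_comm[of b a] a by metis
  have "ple x b ?j" using ple_gmeet(2)[of x a b b] x a ple_refl by simp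
  moreover have "ple x ?j b"
  proof -
    have "ple x ?j a \<or> ple x ?j b" using ple_gmeet(2)[of x a b ?j] x a ple_refl by simp
    then show ?thesis using ple_trans[of x ?j a b, OF _ le x] a by force
  qed
  ultimately show j: "peq x ?j b" by (simp add: total_cone.eqv_def[OF cone_total_cone[OF x]])
  then show "peq x (gjoin V b a) b" using M.join_comm[of b a] a by metis
qed

end

section \<open>Products of linearly ordered groups\<close>

locale linear_cone = total_cone +
  assumes cone_pointed: "\<lbrakk>a \<in> C; inv a \<in> C\<rbrakk> \<Longrightarrow> a = \<one>"
begin

lemma le_antisym: "\<lbrakk>le a b; le b a; a \<in> carrier G; b \<in> carrier G\<rbrakk> \<Longrightarrow> a = b"
  using cone_pointed[of "b \<otimes> inv a"] inv_solve_right[of \<one> b a]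
  by (auto simp: le_def inv_mult_group)

definition mn where "mn a b = (if le a b then a else b)"
definition mx where "mx a b = (if le a b then b else a)"

lemma mn_mx_lattice: "lattice_ops (carrier G) mn mx"
proof
  fix x y assume xy: "x \<in> carrier G" "y \<in> carrier G"
  then show "mn x y \<in> carrier G" "mx x y \<in> carrier G" by (simp_all add: mn_def mx_def)
  show "mn x y = mn y x" "mx x y = mx y x" 
    using xy le_total[of x y] le_antisym[of x y] by (auto simp: mn_def mx_def)
  show "mn x (mx x y) = x" "mx x (mn x y) = x"
    using xy le_total[of x y] le_refl[of x] le_antisym[of x y] by (auto simp: mn_def mx_def)
  fix z assume z: "z \<in> carrier G"
  show "mn (mn x y) z = mn x (mn y z)" "mx (mx x y) z = mx x (mx y z)"
    using xy z le_total[of x y] le_total[of y z] le_total[of x z]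
      le_trans[of x y z] le_trans[of y z x] le_trans[of z x y]
      le_trans[of x z y] le_trans[of z y x] le_trans[of y x z]
      le_antisym[of x y] le_antisym[of y z] le_antisym[of x z] 
    by (auto simp: mn_def mx_def)
qed

lemma mult_mn_mx:
  assumes "a \<in> carrier G" "b \<in> carrier G" "c \<in> carrier G"
  shows "a \<otimes> mn b c = mn (a \<otimes> b) (a \<otimes> c)" "a \<otimes> mx b c = mx (a \<otimes> b) (a \<otimes> c)"
  using assms by (simp_all add: mn_def mx_def le_cancel)

lemma mn_mx_cone:
  assumes "a \<in> carrier G" "b \<in> carrier G"
  shows "mn a b \<in> C \<longleftrightarrow> a \<in> C \<and> b \<in> C" "mx a b \<in> C \<longleftrightarrow> a \<in> C \<or> b \<in> C"
proof -
  have up: "b \<in> C" if "le a b" "a \<in> C" "a \<in> carrier G" "b \<in> carrier G" for a b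
    using that le_trans[of \<one> a b] by (simp add: one_le_iff)
  show "mn a b \<in> C \<longleftrightarrow> a \<in> C \<and> b \<in> C" "mx a b \<in> C \<longleftrightarrow> a \<in> C \<or> b \<in> C"
    using assms le_total[of a b] up[of a b] up[of b a] by (auto simp: mn_def mx_def)
qed

end

definition section_group ::
  "'i set \<Rightarrow> ('i \<Rightarrow> 'c monoid) \<Rightarrow> ('i \<Rightarrow> 'c set) \<Rightarrow> ('i \<Rightarrow> 'c, 'i set) vlgrp" where
  "section_group I F C = \<lparr>gdom = (\<Pi>\<^sub>E i\<in>I. carrier (F i)), gzero = (\<lambda>i\<in>I. \<one>\<^bsub>F i\<^esub>),
     gadd = (\<lambda>f g. \<lambda>i\<in>I. f i \<otimes>\<^bsub>F i\<^esub> g i), gneg = (\<lambda>f. \<lambda>i\<in>I. inv\<^bsub>F i\<^esub> f i),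
     gmeet = (\<lambda>f g. \<lambda>i\<in>I. linear_cone.mn (F i) (C i) (f i) (g i)),
     gjoin = (\<lambda>f g. \<lambda>i\<in>I. linear_cone.mx (F i) (C i) (f i) (g i)),
     ldom = Pow I, lbot = {}, ltop = I, lmeet = (\<inter>), ljoin = (\<union>),
     val = (\<lambda>f. {i\<in>I. f i \<in> C i})\<rparr>"

lemma section_group_sel [simp]:
  "gdom (section_group I F C) = (\<Pi>\<^sub>E i\<in>I. carrier (F i))"
  "gzero (section_group I F C) = (\<lambda>i\<in>I. \<one>\<^bsub>F i\<^esub>)"
  "gadd (section_group I F C) = (\<lambda>f g. \<lambda>i\<in>I. f i \<otimes>\<^bsub>F i\<^esub> g i)"
  "gneg (section_group I F C) = (\<lambda>f. \<lambda>i\<in>I. inv\<^bsub>F i\<^esub> f i)"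
  "gmeet (section_group I F C) = (\<lambda>f g. \<lambda>i\<in>I. linear_cone.mn (F i) (C i) (f i) (g i))"
  "gjoin (section_group I F C) = (\<lambda>f g. \<lambda>i\<in>I. linear_cone.mx (F i) (C i) (f i) (g i))"
  "ldom (section_group I F C) = Pow I" "lbot (section_group I F C) = {}"
  "ltop (section_group I F C) = I" "lmeet (section_group I F C) = (\<inter>)"
  "ljoin (section_group I F C) = (\<union>)"
  "val (section_group I F C) = (\<lambda>f. {i\<in>I. f i \<in> C i})"
  by (simp_all add: section_group_def)

text \<open>The axioms hold fiber by fiber. Assumption \<open>neg\<close> serves the surjectivity of
  the value: a set \<open>S\<close> is the value of the section that is neutral on \<open>S\<close>
  and lies outside the cone elsewhere.\<close>

theorem section_group_dense:
  assumes lin: "\<And>i. i \<in> I \<Longrightarrow> linear_cone (F i) (C i)"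
    and neg: "\<And>i. i \<in> I \<Longrightarrow> \<exists>a\<in>carrier (F i). a \<notin> C i"
  shows "densely_valued_lgroup (section_group I F C)" (is "densely_valued_lgroup ?W")
proof -
  let ?D = "\<Pi>\<^sub>E i\<in>I. carrier (F i)"
  have tot: "total_cone (F i) (C i)" and cg: "comm_group (F i)" if "i \<in> I" for i
    using lin[OF that] by (auto simp: linear_cone_def total_cone_def)
  then have gr: "group (F i)" if "i \<in> I" for i using that by (simp add: comm_group_def)
  then have mo: "Group.monoid (F i)" if "i \<in> I" for i using that by (simp add: Group.group_def)
  have cm: "Group.comm_monoid (F i)" if "i \<in> I" for i using cg that by (simp add: comm_group_def)
  have fib: "f i \<in> carrier (F i)" if "f \<in> ?D" "i \<in> I" for f i using that by auto
  note [simp] = fib group.inv_closed[OF gr] monoid.m_closed[OF mo] monoid.one_closed[OF mo]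
  have eqI: "f = g" if "f \<in> ?D" "g \<in> ?D" "\<And>i. i \<in> I \<Longrightarrow> f i = g i" for f g
    using that by (rule PiE_ext)
  have add: "(\<lambda>i\<in>I. f i \<otimes>\<^bsub>F i\<^esub> g i) \<in> ?D" if "f \<in> ?D" "g \<in> ?D" for f g
    using that by simp
  have one: "(\<lambda>i\<in>I. \<one>\<^bsub>F i\<^esub>) \<in> ?D" by simp
  have inv: "(\<lambda>i\<in>I. inv\<^bsub>F i\<^esub> f i) \<in> ?D" if "f \<in> ?D" for f using that by simp
  have G: "comm_group (add_group ?W)"
  proof (rule comm_groupI)
    fix f g assume "f \<in> carrier (add_group ?W)" "g \<in> carrier (add_group ?W)"
    then have fg: "f \<in> ?D" "g \<in> ?D" by (simp_all add: add_group_def)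
    show "f \<otimes>\<^bsub>add_group ?W\<^esub> g \<in> carrier (add_group ?W)"
      using add[OF fg] by (simp add: add_group_def)
    show "f \<otimes>\<^bsub>add_group ?W\<^esub> g = g \<otimes>\<^bsub>add_group ?W\<^esub> f"
      using comm_monoid.m_comm[OF cm] fg by (auto simp: add_group_def intro!: restrict_ext)
    fix h assume "h \<in> carrier (add_group ?W)"
    then have h: "h \<in> ?D" by (simp add: add_group_def)
    show "f \<otimes>\<^bsub>add_group ?W\<^esub> g \<otimes>\<^bsub>add_group ?W\<^esub> h = f \<otimes>\<^bsub>add_group ?W\<^esub> (g \<otimes>\<^bsub>add_group ?W\<^esub> h)"
      using monoid.m_assoc[OF mo] fg h by (auto simp: add_group_def intro!: restrict_ext)
  next
    show "\<one>\<^bsub>add_group ?W\<^esub> \<in> carrier (add_group ?W)" using one by (simp add: add_group_def)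
    fix f assume "f \<in> carrier (add_group ?W)"
    then have f: "f \<in> ?D" by (simp add: add_group_def)
    show "\<one>\<^bsub>add_group ?W\<^esub> \<otimes>\<^bsub>add_group ?W\<^esub> f = f"
      using f monoid.l_one[OF mo] by (intro eqI) (simp_all add: add_group_def)
    have "(\<lambda>i\<in>I. inv\<^bsub>F i\<^esub> f i) \<otimes>\<^bsub>add_group ?W\<^esub> f = \<one>\<^bsub>add_group ?W\<^esub>"
      using group.l_inv[OF gr] f by (auto simp: add_group_def intro!: restrict_ext)
    then show "\<exists>g\<in>carrier (add_group ?W). g \<otimes>\<^bsub>add_group ?W\<^esub> f = \<one>\<^bsub>add_group ?W\<^esub>"
      using inv[OF f] by (intro bexI[of _ "\<lambda>i\<in>I. inv\<^bsub>F i\<^esub> f i"]) (simp_all add: add_group_def)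
  qed
  have N: "gneg ?W f = m_inv (add_group ?W) f" if "f \<in> gdom ?W" for f
  proof (rule group.inv_equality[symmetric])
    show "group (add_group ?W)" using G by (simp add: comm_group_def)
    show "gneg ?W f \<otimes>\<^bsub>add_group ?W\<^esub> f = \<one>\<^bsub>add_group ?W\<^esub>"
      using group.l_inv[OF gr] that by (auto simp: add_group_def intro!: restrict_ext)
    show "f \<in> carrier (add_group ?W)" "gneg ?W f \<in> carrier (add_group ?W)"
      using that inv[of f] by (simp_all add: add_group_def)
  qed
  note lat = linear_cone.mn_mx_lattice[OF lin]
  note [simp] = lattice_ops.meet_closed[OF lat] lattice_ops.join_closed[OF lat]
  have L: "lattice_ops ?D (gmeet ?W) (gjoin ?W)"
  proof
    fix f g assume fg: "f \<in> ?D" "g \<in> ?D"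
    show "gmeet ?W f g \<in> ?D" "gjoin ?W f g \<in> ?D" using fg by simp_all
    show "gmeet ?W f g = gmeet ?W g f" "gjoin ?W f g = gjoin ?W g f"
      using fg lattice_ops.meet_comm[OF lat] lattice_ops.join_comm[OF lat]
      by (auto intro!: restrict_ext)
    show "gmeet ?W f (gjoin ?W f g) = f" "gjoin ?W f (gmeet ?W f g) = f"
      using fg lattice_ops.meet_absorb[OF lat] lattice_ops.join_absorb[OF lat]
      by (auto intro!: eqI)
    fix h assume h: "h \<in> ?D"
    show "gmeet ?W (gmeet ?W f g) h = gmeet ?W f (gmeet ?W g h)"
      "gjoin ?W (gjoin ?W f g) h = gjoin ?W f (gjoin ?W g h)"
      using fg h lattice_ops.meet_assoc[OF lat] lattice_ops.join_assoc[OF lat]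
      by (auto intro!: restrict_ext)
  qed
  have B: "bounded_distrib_lattice_ops (ldom ?W) (lmeet ?W) (ljoin ?W) (lbot ?W) (ltop ?W)"
    by standard auto
  obtain u where u: "\<And>i. i \<in> I \<Longrightarrow> u i \<in> carrier (F i) \<and> u i \<notin> C i"
    using neg by metis
  have surj: "\<exists>a\<in>gdom ?W. S = val ?W a" if "S \<in> ldom ?W" for S
  proof
    let ?a = "\<lambda>i\<in>I. if i \<in> S then \<one>\<^bsub>F i\<^esub> else u i"
    show "S = val ?W ?a" using that u total_cone.one_cone[OF tot] by auto
    show "?a \<in> gdom ?W" using u by simp
  qed
  have cone: "(\<lambda>i\<in>I. f i \<otimes>\<^bsub>F i\<^esub> g i) i \<in> C i" if "f i \<in> C i" "g i \<in> C i" "i \<in> I" for f g i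
    using that total_cone.cone_mult[OF tot] by simp
  show ?thesis
    unfolding densely_valued_lgroup_def valued_lgroup_def abelian_lgroup_def
  proof (intro conjI ballI impI G B)
    fix f assume f: "f \<in> gdom ?W"
    show "gneg ?W f = m_inv (add_group ?W) f" by (rule N[OF f])
    show "val ?W f \<in> ldom ?W" by auto
    show "gle ?W (gzero ?W) f" if "val ?W f = ltop ?W"
    proof -
      have "f i \<in> C i" if "i \<in> I" for i using \<open>val ?W f = ltop ?W\<close> that by auto
      then have "total_cone.le (F i) (C i) \<one>\<^bsub>F i\<^esub> (f i)" if "i \<in> I" for i
        using that f total_cone.one_le_iff[OF tot, of i "f i"] by simp
      then show ?thesis by (auto simp: gle_def linear_cone.mn_def[OF lin] intro!: restrict_ext)
    qed
    fix g assume g: "g \<in> gdom ?W"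
    show "val ?W (gmeet ?W f g) = lmeet ?W (val ?W f) (val ?W g)"
      "val ?W (gjoin ?W f g) = ljoin ?W (val ?W f) (val ?W g)"
      using f g linear_cone.mn_mx_cone[OF lin] by auto
    show "lle ?W (lmeet ?W (val ?W f) (val ?W g)) (val ?W (gadd ?W f g))"
      using cone by (auto simp: lle_def)
    fix h assume h: "h \<in> gdom ?W"
    show "gadd ?W f (gmeet ?W g h) = gmeet ?W (gadd ?W f g) (gadd ?W f h)"
      "gadd ?W f (gjoin ?W g h) = gjoin ?W (gadd ?W f g) (gadd ?W f h)"
      using f g h linear_cone.mult_mn_mx[OF lin] by (auto intro!: restrict_ext)
  next
    show "lattice_ops (gdom ?W) (gmeet ?W) (gjoin ?W)" using L by simp
    show "val ?W (gzero ?W) = ltop ?W" using total_cone.one_cone[OF tot] by auto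
  qed (use surj in blast)
qed

section \<open>The section extension\<close>

context dense_vlgroup
begin

definition null :: "'l set \<Rightarrow> 'g set" where "null x = {a \<in> gdom V. peq x a (gzero V)}"

text \<open>The integers are added because the value group at \<open>x\<close> may be trivial: with them, every fiber
  has a negative element, so that every set of points is a value of the product.\<close>

definition fiber :: "'l set \<Rightarrow> (int \<times> 'g set) monoid" where
  "fiber x = integer_group \<times>\<times> (G Mod null x)"

text \<open>The lexicographic order with the integer first. A coset is nonnegative if some
  representative is; by \<open>coset_cone\<close> every representative then is.\<close>

definition fiber_cone :: "'l set \<Rightarrow> (int \<times> 'g set) set" where
  "fiber_cone x = {(k, A). A \<in> carrier (G Mod null x) \<and> (k > 0 \<or> k = 0 \<and> A \<inter> cone x \<noteq> {})}"

context
  fixes x assumes x: "x \<in> spec V"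
begin

interpretation total_cone G "cone x" by (rule cone_total_cone[OF x])

lemma null_subgroup: "subgroup (null x) G"
proof
  show "null x \<subseteq> carrier G" by (auto simp: null_def)
  show "\<one>\<^bsub>G\<^esub> \<in> null x" using eqv_refl by (simp add: null_def)
  fix a assume a: "a \<in> null x"
  show "inv\<^bsub>G\<^esub> a \<in> null x"
    using a eqv_inv[of a "gzero V"] G.inv_one by (simp add: null_def flip: gneg_eq)
  fix b assume "b \<in> null x"
  then show "a \<otimes>\<^bsub>G\<^esub> b \<in> null x"
    using a eqv_mult[of a "gzero V" b "gzero V"] G.r_one[of "gzero V"] by (simp add: null_def)
qed

lemma null_normal: "null x \<lhd> G"
  using null_subgroup G.normal_iff_subgroup by simp

lemma coset_cone: "a \<in> gdom V \<Longrightarrow> (null x #>\<^bsub>G\<^esub> a) \<inter> cone x \<noteq> {} \<longleftrightarrow> a \<in> cone x"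
proof
  assume a: "a \<in> gdom V"
  assume "(null x #>\<^bsub>G\<^esub> a) \<inter> cone x \<noteq> {}"
  then obtain n where n: "n \<in> gdom V" "eqv n (gzero V)" "gadd V n a \<in> cone x"
    by (auto simp: r_coset_def null_def)
  have "eqv (gadd V n a) a"
    using eqv_mult[of n "gzero V" a a] n a G.l_one[of a] eqv_refl by simp
  then show "a \<in> cone x"
    using n a eqv_le_iff[of "gzero V" "gzero V" "gadd V n a" a] eqv_refl[of "gzero V"]
      one_le_iff[of a] one_le_iff[of "gadd V n a"] by simp
next
  assume "a \<in> gdom V" "a \<in> cone x"
  then show "(null x #>\<^bsub>G\<^esub> a) \<inter> cone x \<noteq> {}"
    using G.rcos_self[OF _ null_subgroup] by auto
qed

lemma fiber_group: "comm_group (fiber x)"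
proof (rule group.group_comm_groupI)
  have Q: "comm_group (G Mod null x)" by (rule G.abelian_FactGroup[OF null_subgroup])
  then show "group (fiber x)"
    by (simp add: fiber_def DirProd_group comm_group_def)
  fix a b assume "a \<in> carrier (fiber x)" "b \<in> carrier (fiber x)"
  then show "a \<otimes>\<^bsub>fiber x\<^esub> b = b \<otimes>\<^bsub>fiber x\<^esub> a"
    using comm_monoid.m_comm[of "G Mod null x"] Q
    by (cases a; cases b) (auto simp: fiber_def comm_group_def)
qed

lemma fiber_mult:
  assumes "a \<in> gdom V" "b \<in> gdom V"
  shows "(k, null x #>\<^bsub>G\<^esub> a) \<otimes>\<^bsub>fiber x\<^esub> (l, null x #>\<^bsub>G\<^esub> b) = (k + l, null x #>\<^bsub>G\<^esub> gadd V a b)"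
  using normal.rcos_sum[OF null_normal, of a b] assms by (simp add: fiber_def)

lemma fiber_inv:
  assumes "a \<in> gdom V"
  shows "inv\<^bsub>fiber x\<^esub> (k, null x #>\<^bsub>G\<^esub> a) = (- k, null x #>\<^bsub>G\<^esub> gneg V a)"
proof -
  have "group (G Mod null x)" by (rule normal.factorgroup_is_group[OF null_normal])
  moreover have "null x #>\<^bsub>G\<^esub> a \<in> carrier (G Mod null x)" using assms by (simp add: carrier_FactGroup)
  ultimately show ?thesis
    using assms normal.inv_FactGroup[OF null_normal] normal.rcos_inv[OF null_normal]
    by (simp add: fiber_def gneg_eq)
qed

lemma carrier_fiber: "carrier (fiber x) = {(k, null x #>\<^bsub>G\<^esub> a) |k a. a \<in> gdom V}"
  by (auto simp: fiber_def carrier_FactGroup)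

lemma one_fiber: "\<one>\<^bsub>fiber x\<^esub> = (0, null x #>\<^bsub>G\<^esub> gzero V)"
  using G.coset_mult_one[of "null x"] subgroup.subset[OF null_subgroup] by (simp add: fiber_def)

lemma in_fiber_cone:
  "a \<in> gdom V \<Longrightarrow> (k, null x #>\<^bsub>G\<^esub> a) \<in> fiber_cone x \<longleftrightarrow> k > 0 \<or> k = 0 \<and> a \<in> cone x"
  by (auto simp: fiber_cone_def carrier_FactGroup coset_cone)

lemma coset_eq_iff:
  assumes "a \<in> gdom V" "b \<in> gdom V"
  shows "null x #>\<^bsub>G\<^esub> a = null x #>\<^bsub>G\<^esub> b \<longleftrightarrow> eqv a b"
proof -
  have "null x #>\<^bsub>G\<^esub> a = null x #>\<^bsub>G\<^esub> b \<longleftrightarrow> a \<otimes>\<^bsub>G\<^esub> inv\<^bsub>G\<^esub> b \<in> null x"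
    using G.rcos_self[OF _ null_subgroup, of a] assms
      G.repr_independence[OF _ _ null_subgroup, of a b] subgroup.rcos_module[OF null_subgroup G.is_group, of b a]
    by auto
  also have "\<dots> \<longleftrightarrow> eqv a b"
    using assms eqv_mult[of a b "gneg V b" "gneg V b"] eqv_mult[of "gadd V a (gneg V b)" "gzero V" b b]
      eqv_refl[of b] eqv_refl[of "gneg V b"] G.m_assoc[of a "gneg V b" b] G.l_one[of b] G.r_one[of a]
      G.l_inv[of b] G.r_inv[of b]
    by (auto simp: null_def simp flip: gneg_eq)
  finally show ?thesis .
qed

lemma fiber_linear: "linear_cone (fiber x) (fiber_cone x)"
proof -
  interpret F: comm_group "fiber x" by (rule fiber_group)
  show ?thesis
  proof
    show "fiber_cone x \<subseteq> carrier (fiber x)" by (auto simp: fiber_cone_def fiber_def)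
    fix p assume "p \<in> carrier (fiber x)"
    then obtain k a where p: "p = (k, null x #>\<^bsub>G\<^esub> a)" "a \<in> gdom V" by (auto simp: carrier_fiber)
    then show "p \<in> fiber_cone x \<or> inv\<^bsub>fiber x\<^esub> p \<in> fiber_cone x"
      using cone_total[of a] by (auto simp: in_fiber_cone fiber_inv simp flip: gneg_eq)
  next
    fix p q assume pq: "p \<in> fiber_cone x" "q \<in> fiber_cone x"
    then have "p \<in> carrier (fiber x)" "q \<in> carrier (fiber x)" by (auto simp: fiber_cone_def fiber_def)
    then obtain k a l b where "p = (k, null x #>\<^bsub>G\<^esub> a)" "a \<in> gdom V"
      "q = (l, null x #>\<^bsub>G\<^esub> b)" "b \<in> gdom V" by (auto simp: carrier_fiber)
    with pq show "p \<otimes>\<^bsub>fiber x\<^esub> q \<in> fiber_cone x"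
      using cone_mult[of a b] by (auto simp: in_fiber_cone fiber_mult)
  next
    fix p assume p: "p \<in> fiber_cone x" "inv\<^bsub>fiber x\<^esub> p \<in> fiber_cone x"
    then have "p \<in> carrier (fiber x)" by (auto simp: fiber_cone_def fiber_def)
    then obtain k a where ka: "p = (k, null x #>\<^bsub>G\<^esub> a)" "a \<in> gdom V" by (auto simp: carrier_fiber)
    with p have "k = 0" "a \<in> cone x" "gneg V a \<in> cone x"
      by (auto simp: in_fiber_cone fiber_inv)
    moreover have "eqv a (gzero V)"
      using calculation ka G.l_one[of "gneg V a"] G.r_one[of a] G.inv_one
      by (simp add: eqv_def le_def flip: gneg_eq)
    ultimately show "p = \<one>\<^bsub>fiber x\<^esub>" using ka by (simp add: one_fiber coset_eq_iff)
  qed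
qed

end

end

section \<open>The embedding into the product over doubled points, and splitting\<close>

context dense_vlgroup
begin

text \<open>With two copies of each point, every nonzero element of the lattice of \<open>V\<close> splits in the
  extension.\<close>

definition idx :: "('l set \<times> bool) set" where "idx = spec V \<times> UNIV"

definition ext :: "('l set \<times> bool \<Rightarrow> int \<times> 'g set, ('l set \<times> bool) set) vlgrp" where
  "ext = section_group idx (\<lambda>i. fiber (fst i)) (\<lambda>i. fiber_cone (fst i))"

definition emb :: "'g \<Rightarrow> 'l set \<times> bool \<Rightarrow> int \<times> 'g set" where
  "emb a = (\<lambda>i\<in>idx. (0, null (fst i) #>\<^bsub>G\<^esub> a))"

definition points :: "'l \<Rightarrow> ('l set \<times> bool) set" where
  "points l = {i\<in>idx. l \<in> fst i}"

lemma idx_spec: "i \<in> idx \<Longrightarrow> fst i \<in> spec V"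
  by (auto simp: idx_def)

lemma idx_pair: "(x, b) \<in> idx \<longleftrightarrow> x \<in> spec V"
  by (simp add: idx_def)

lemma coset_in_fiber:
  "\<lbrakk>x \<in> spec V; a \<in> gdom V\<rbrakk> \<Longrightarrow> (k, null x #>\<^bsub>G\<^esub> a) \<in> carrier (fiber x)"
  by (auto simp: carrier_fiber)

lemma ext_dense: "densely_valued_lgroup ext"
  unfolding ext_def
proof (rule section_group_dense)
  fix i assume i: "i \<in> idx"
  then show "linear_cone (fiber (fst i)) (fiber_cone (fst i))" by (simp add: fiber_linear idx_spec)
  show "\<exists>a\<in>carrier (fiber (fst i)). a \<notin> fiber_cone (fst i)"
    using i by (intro bexI[of _ "(-1, null (fst i) #>\<^bsub>G\<^esub> gzero V)"])
      (simp_all add: in_fiber_cone coset_in_fiber idx_spec)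
qed

lemma fiber_mn_mx:
  assumes x: "x \<in> spec V" and a: "a \<in> gdom V" "b \<in> gdom V"
  shows "linear_cone.mn (fiber x) (fiber_cone x) (0, null x #>\<^bsub>G\<^esub> a) (0, null x #>\<^bsub>G\<^esub> b)
      = (0, null x #>\<^bsub>G\<^esub> gmeet V a b)"
    and "linear_cone.mx (fiber x) (fiber_cone x) (0, null x #>\<^bsub>G\<^esub> a) (0, null x #>\<^bsub>G\<^esub> b)
      = (0, null x #>\<^bsub>G\<^esub> gjoin V a b)"
proof -
  have tc: "total_cone (fiber x) (fiber_cone x)"
    using fiber_linear[OF x] by (simp add: linear_cone_def)
  have le: "total_cone.le (fiber x) (fiber_cone x) (0, null x #>\<^bsub>G\<^esub> a) (0, null x #>\<^bsub>G\<^esub> b) \<longleftrightarrow> ple x a b"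
    if "a \<in> gdom V" "b \<in> gdom V" for a b
    using that x
    by (simp add: total_cone.le_def[OF tc] fiber_inv fiber_mult in_fiber_cone ple_def in_cone)
  have sym: "peq x c d \<Longrightarrow> peq x d c" for c d
    using total_cone.eqv_sym[OF cone_total_cone[OF x]] .
  have "ple x b a" if "\<not> ple x a b" using that ple_total[OF x] a by blast
  then show "linear_cone.mn (fiber x) (fiber_cone x) (0, null x #>\<^bsub>G\<^esub> a) (0, null x #>\<^bsub>G\<^esub> b)
      = (0, null x #>\<^bsub>G\<^esub> gmeet V a b)"
    "linear_cone.mx (fiber x) (fiber_cone x) (0, null x #>\<^bsub>G\<^esub> a) (0, null x #>\<^bsub>G\<^esub> b)
      = (0, null x #>\<^bsub>G\<^esub> gjoin V a b)"
    using a x peq_gmeet_gjoin[OF x, of a b, THEN sym] peq_gmeet_gjoin[OF x, of b a, THEN sym]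
    by (simp_all add: linear_cone.mn_def[OF fiber_linear] linear_cone.mx_def[OF fiber_linear]
        le coset_eq_iff)
qed

text \<open>Both injectivity claims say that points separate elements. The image has integer
  coordinate 0 in every fiber, where the fiber order is the preorder of the point, so all operations
  can be compared there.\<close>

lemma ext_embedding: "embedding emb points V ext"
  unfolding embedding_def
proof (intro conjI ballI)
  show "inj_on emb (gdom V)"
  proof (rule inj_onI)
    fix a b assume ab: "a \<in> gdom V" "b \<in> gdom V" "emb a = emb b"
    have "peq x a b" if x: "x \<in> spec V" for x
    proof -
      have "(x, True) \<in> idx" using x by (simp add: idx_def)
      moreover have "emb a (x, True) = emb b (x, True)" using ab by simp
      ultimately show ?thesis using ab x by (simp add: emb_def coset_eq_iff)
    qed
    then show "a = b" using eq_iff_peq ab by simp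
  qed
  show "emb ` gdom V \<subseteq> gdom ext"
    by (auto simp: emb_def ext_def coset_in_fiber idx_pair)
  show "inj_on points (ldom V)"
  proof (rule inj_onI)
    fix a b assume ab: "a \<in> ldom V" "b \<in> ldom V" "points a = points b"
    have "a \<in> x \<longleftrightarrow> b \<in> x" if x: "x \<in> spec V" for x
    proof -
      have "(x, True) \<in> points a \<longleftrightarrow> (x, True) \<in> points b" using ab by simp
      then show ?thesis using x by (simp add: points_def idx_def)
    qed
    then show "a = b" using lattice_eq_iff_spec ab by simp
  qed
  show "points ` ldom V \<subseteq> ldom ext" by (auto simp: points_def ext_def)
  show "emb (gzero V) = gzero ext"
    by (auto simp: emb_def ext_def one_fiber idx_pair intro!: restrict_ext)
  show "points (lbot V) = lbot ext" "points (ltop V) = ltop ext"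
    using spec_top spec_bot by (auto simp: points_def ext_def idx_def)
  fix k assume k: "k \<in> ldom V"
  fix l assume l: "l \<in> ldom V"
  show "points (lmeet V k l) = lmeet ext (points k) (points l)"
    "points (ljoin V k l) = ljoin ext (points k) (points l)"
    using k l spec_meet spec_join by (auto simp: points_def ext_def idx_pair)
next
  fix a assume a: "a \<in> gdom V"
  show "emb (gneg V a) = gneg ext (emb a)"
    using a by (auto simp: emb_def ext_def fiber_inv idx_pair intro!: restrict_ext)
  show "points (val V a) = val ext (emb a)"
    using a by (auto simp: points_def emb_def ext_def in_fiber_cone idx_pair in_cone)
  fix b assume b: "b \<in> gdom V"
  show "emb (gadd V a b) = gadd ext (emb a) (emb b)"
    "emb (gmeet V a b) = gmeet ext (emb a) (emb b)"
    "emb (gjoin V a b) = gjoin ext (emb a) (emb b)"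
    using a b by (auto simp: emb_def ext_def fiber_mult fiber_mn_mx idx_pair intro!: restrict_ext)
qed

lemma ext_sel:
  "ldom ext = Pow idx" "lbot ext = {}" "ltop ext = idx" "lmeet ext = (\<inter>)" "ljoin ext = (\<union>)"
  by (simp_all add: ext_def)

lemma existentially_closed_imp_atomless:
  assumes ec: "existentially_closed V"
  shows "atomless V"
  unfolding atomless_def
proof (intro ballI impI)
  fix l assume l: "l \<in> ldom V" "lless V (lbot V) l"
  \<comment> \<open>Lattice variable 0 is the parameter \<open>l\<close>. The formula asks for an
    element strictly between \<open>\<bottom>\<close> and \<open>l\<close>; its negations make it
    non-positive.\<close>
  define p where "p = ExL 1 (Conj (Neg (LEq (LVar 1) LBot))
    (Conj (LEq (LMeet (LVar 1) (LVar 0)) (LVar 1)) (Neg (LEq (LVar 1) (LVar 0)))))"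
  \<comment> \<open>One of the two copies of every point of \<open>l\<close>: the copy
    \<open>(x, True)\<close> makes \<open>k\<close> nonempty and \<open>(x, False)\<close> makes it
    proper.\<close>
  define k where "k = {i \<in> points l. snd i}"
  obtain x where x: "x \<in> spec V" "l \<in> x"
    using lattice_eq_iff_spec[of "lbot V" l] l spec_bot by (auto simp: lless_def)
  have "(x, True) \<in> k" "(x, False) \<in> points l" "(x, False) \<notin> k"
    using x by (auto simp: k_def points_def idx_def)
  then have k: "k \<noteq> {}" "k \<noteq> points l" by blast+
  have k': "k \<inter> points l = k" "k \<in> ldom ext" by (auto simp: k_def points_def ext_sel)
  have "sat ext (emb \<circ> (\<lambda>_. gzero V)) (points \<circ> (\<lambda>_. l)) p"
    using k k' by (auto simp: p_def ext_sel intro!: bexI[of _ k])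
  moreover have "existential p"
    unfolding p_def by (intro existential.intros quantifier_free.intros)
  ultimately have "sat V (\<lambda>_. gzero V) (\<lambda>_. l) p"
    using existentially_closed_reflects[OF ec ext_dense ext_embedding] l
    by (intro reflectsD[of existential emb points V ext]) auto
  then obtain k where "k \<in> ldom V" "k \<noteq> lbot V" "lmeet V k l = k" "k \<noteq> l"
    by (auto simp: p_def)
  then show "\<exists>k\<in>ldom V. lless V (lbot V) k \<and> lless V k l"
    using bot_lle[of k] by (intro bexI[of _ k]) (auto simp: lless_def lle_def)
qed

end


section \<open>Algebraically closed groups\<close>

text \<open>The consequences of algebraic closedness from which existential closedness is built. In
  \<open>patch_compl\<close>, \<open>m\<close> is the complement of \<open>l\<close>, and
  \<open>c\<close> is glued from \<open>a\<close> over \<open>l\<close> and \<open>b\<close> over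
  \<open>m\<close>; speaking at points is how both facts are used later.\<close>

locale tame_vlgroup = dense_vlgroup V for V :: "('g, 'l) vlgrp" +
  assumes neg_elt: "\<exists>u\<in>gdom V. val V u = lbot V"
    and divisible: "\<lbrakk>a \<in> gdom V; n > (0::nat)\<rbrakk> \<Longrightarrow> \<exists>b\<in>gdom V. b [^]\<^bsub>G\<^esub> n = a"
    and patch_compl: "\<lbrakk>a \<in> gdom V; b \<in> gdom V; l \<in> ldom V\<rbrakk> \<Longrightarrow>
      \<exists>c\<in>gdom V. \<exists>m\<in>ldom V. \<forall>x\<in>spec V. (m \<in> x \<longleftrightarrow> l \<notin> x) \<and>
        (l \<in> x \<longrightarrow> peq x c a) \<and> (l \<notin> x \<longrightarrow> peq x c b)"

primrec gpow :: "nat \<Rightarrow> gterm \<Rightarrow> gterm" where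
  "gpow 0 t = GZero"
| "gpow (Suc n) t = GAdd (gpow n t) t"

lemma geval_gpow: "geval V e (gpow n t) = geval V e t [^]\<^bsub>add_group V\<^esub> n"
  by (induction n) (simp_all add: add_group_def)

text \<open>The lattice element whose points are those at which the two variables agree. With it,
  agreement over a given lattice element is a single equation, hence a positive formula.\<close>

definition equalizer :: "nat \<Rightarrow> nat \<Rightarrow> lterm" where
  "equalizer i j = LMeet (Val (GAdd (GVar i) (GNeg (GVar j)))) (Val (GAdd (GVar j) (GNeg (GVar i))))"

context dense_vlgroup
begin

lemma equalizer_spec:
  assumes "x \<in> spec V" "e i \<in> gdom V" "e j \<in> gdom V"
  shows "leval V e d (equalizer i j) \<in> x \<longleftrightarrow> peq x (e i) (e j)"
  using assms by (auto simp: equalizer_def spec_meet ple_def total_cone.eqv_def[OF cone_total_cone])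

text \<open>At each point a positive multiple preserves and reflects the order, so it commutes with
  minimum and maximum and is injective. It keeps the sign, so the lattice part is the
  identity.\<close>

lemma power_embedding:
  assumes n: "n > (0::nat)"
  shows "embedding (\<lambda>a. a [^]\<^bsub>G\<^esub> n) id V V"
proof -
  let ?f = "\<lambda>a. a [^]\<^bsub>G\<^esub> n"
  have cl: "?f a \<in> gdom V" if "a \<in> gdom V" for a using G.nat_pow_closed[of a n] that by simp
  have le: "ple x (?f a) (?f b) \<longleftrightarrow> ple x a b" if "x \<in> spec V" "a \<in> gdom V" "b \<in> gdom V" for x a b
    using total_cone.le_pow[OF cone_total_cone] n that by simp
  have eq: "peq x (?f a) (?f b) \<longleftrightarrow> peq x a b" if "x \<in> spec V" "a \<in> gdom V" "b \<in> gdom V" for x a b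
    using that le by (simp add: total_cone.eqv_def[OF cone_total_cone])
  have trans: "peq x a c"
    if "x \<in> spec V" "a \<in> gdom V" "b \<in> gdom V" "c \<in> gdom V" "peq x a b" "peq x c b" for x a b c
    using total_cone.eqv_trans[OF cone_total_cone, of x a b c]
      total_cone.eqv_sym[OF cone_total_cone, of x c b] that by simp
  have one: "?f (gzero V) = gzero V" using G.nat_pow_one[of n] by simp
  have mm: "?f (gmeet V a b) = gmeet V (?f a) (?f b)" "?f (gjoin V a b) = gjoin V (?f a) (?f b)"
    if ab: "a \<in> gdom V" "b \<in> gdom V" for a b
  proof -
    have "peq x (?f (gmeet V a b)) (gmeet V (?f a) (?f b)) \<and> peq x (?f (gjoin V a b)) (gjoin V (?f a) (?f b))"
      if x: "x \<in> spec V" for x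
    proof (cases "ple x a b")
      case True
      note le1 = peq_gmeet_gjoin[OF x ab True] and le2 = peq_gmeet_gjoin[OF x cl cl, of a b, OF ab]
      show ?thesis
        using le1 le2 True le[OF x ab] x ab cl eq[OF x, of "gmeet V a b" a] eq[OF x, of "gjoin V a b" b]
          trans[OF x, of "?f (gmeet V a b)" "?f a" "gmeet V (?f a) (?f b)"]
          trans[OF x, of "?f (gjoin V a b)" "?f b" "gjoin V (?f a) (?f b)"]
        by simp
    next
      case False
      then have ba: "ple x b a" using ple_total x ab by blast
      note le1 = peq_gmeet_gjoin[OF x ab(2,1) ba] and le2 = peq_gmeet_gjoin[OF x cl cl, of b a, OF ab(2,1)]
      show ?thesis
        using le1 le2 ba le[OF x ab(2,1)] x ab cl eq[OF x, of "gmeet V a b" b] eq[OF x, of "gjoin V a b" a]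
          trans[OF x, of "?f (gmeet V a b)" "?f b" "gmeet V (?f a) (?f b)"]
          trans[OF x, of "?f (gjoin V a b)" "?f a" "gjoin V (?f a) (?f b)"]
        by simp
    qed
    then show "?f (gmeet V a b) = gmeet V (?f a) (?f b)" "?f (gjoin V a b) = gjoin V (?f a) (?f b)"
      using eq_iff_peq cl ab by simp_all
  qed
  have val: "val V (?f a) = val V a" if "a \<in> gdom V" for a
    using that cl lattice_eq_iff_spec[of "val V (?f a)" "val V a"] le[of _ "gzero V" a] one
    by (simp add: ple_zero)
  have inj: "a = b" if "a \<in> gdom V" "b \<in> gdom V" "?f a = ?f b" for a b
    using that eq eq_iff_peq[of a b] eq_iff_peq[of "?f a" "?f b"] cl by simp
  show ?thesis
    unfolding embedding_def
    using cl one mm val inj G.nat_pow_inv[of _ n] G.nat_pow_distrib[of _ _ n]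
    by (auto simp: inj_on_def gneg_eq)
qed

theorem algebraically_closed_imp_tame:
  assumes ac: "algebraically_closed V"
  shows "tame_vlgroup V"
proof
  note refl_ext = algebraically_closed_reflects[OF ac ext_dense ext_embedding]
  have pe: "positive_existential p \<longleftrightarrow> existential p \<and> positive p" for p
    by (simp add: positive_existential_def)
  show "\<exists>u\<in>gdom V. val V u = lbot V"
  proof -
    let ?p = "ExG 0 (LEq (Val (GVar 0)) LBot)"
    \<comment> \<open>The integer -1 in every fiber is negative at every point.\<close>
    let ?u = "\<lambda>i\<in>idx. (-1, null (fst i) #>\<^bsub>G\<^esub> gzero V)"
    have "?u \<in> gdom ext"
      by (auto simp: ext_def coset_in_fiber idx_pair)
    moreover have "val ext ?u = {}" by (auto simp: ext_def in_fiber_cone idx_pair)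
    ultimately have "sat ext (emb \<circ> (\<lambda>_. gzero V)) (points \<circ> (\<lambda>_. lbot V)) ?p"
      by (auto simp: ext_sel)
    moreover have "positive_existential ?p"
      unfolding pe by (intro conjI existential.intros quantifier_free.intros positive.intros)
    ultimately have "sat V (\<lambda>_. gzero V) (\<lambda>_. lbot V) ?p"
      by (intro reflectsD[OF refl_ext]) auto
    then show ?thesis by simp
  qed
  show "\<exists>b\<in>gdom V. b [^]\<^bsub>G\<^esub> n = a" if a: "a \<in> gdom V" and n: "n > 0" for a and n :: nat
  proof -
    let ?p = "ExG 1 (GEq (gpow n (GVar 1)) (GVar 0))"
    \<comment> \<open>Along the self-embedding the parameter \<open>a\<close> is sent to its
      \<open>n\<close>-th power, which has the root \<open>a\<close>; reflection returns a root of
      \<open>a\<close> itself.\<close>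
    have "sat V ((\<lambda>a. a [^]\<^bsub>G\<^esub> n) \<circ> (\<lambda>_. a)) (id \<circ> (\<lambda>_. lbot V)) ?p"
      using a by (auto simp: geval_gpow)
    moreover have "positive_existential ?p"
      unfolding pe by (intro conjI existential.intros quantifier_free.intros positive.intros)
    moreover have "range (\<lambda>_::nat. a) \<subseteq> gdom V" "range (\<lambda>_::nat. lbot V) \<subseteq> ldom V"
      using a by auto
    ultimately have "sat V (\<lambda>_. a) (\<lambda>_. lbot V) ?p"
      using reflectsD[OF algebraically_closed_reflects[OF ac dense power_embedding[OF n]],
          of ?p "\<lambda>_. a" "\<lambda>_. lbot V"] by blast
    then show ?thesis by (simp add: geval_gpow)
  qed
  show "\<exists>c\<in>gdom V. \<exists>m\<in>ldom V. \<forall>x\<in>spec V. (m \<in> x \<longleftrightarrow> l \<notin> x) \<and>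
        (l \<in> x \<longrightarrow> peq x c a) \<and> (l \<notin> x \<longrightarrow> peq x c b)"
    if ab: "a \<in> gdom V" "b \<in> gdom V" and l: "l \<in> ldom V" for a b l
  proof -
    \<comment> \<open>Lattice variables 0 and 1 are \<open>l\<close> and \<open>m\<close>; group
      variables 0, 1 and 2 are \<open>a\<close>, \<open>b\<close> and \<open>c\<close>. The first
      two equations say that \<open>m\<close> is a complement of \<open>l\<close>, the others that
      \<open>c\<close> agrees with \<open>a\<close> over \<open>l\<close> and with \<open>b\<close>
      over \<open>m\<close>.\<close>
    define p where "p = Conj (LEq (LMeet (LVar 0) (LVar 1)) LBot) (Conj (LEq (LJoin (LVar 0) (LVar 1)) LTop)
      (Conj (LEq (LMeet (LVar 0) (equalizer 2 0)) (LVar 0)) (LEq (LMeet (LVar 1) (equalizer 2 1)) (LVar 1))))"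
    define e where "e n = (if n = 0 then a else b)" for n :: nat
    \<comment> \<open>In a product of fibers with the full power set as lattice, gluing and
      complementation are available for every set of indices.\<close>
    let ?c = "\<lambda>i\<in>idx. if l \<in> fst i then emb a i else emb b i"
    let ?m = "idx - points l"
    have c: "?c \<in> gdom ext" using ab by (auto simp: ext_def emb_def coset_in_fiber idx_pair)
    have unit: "emb a i \<otimes>\<^bsub>fiber (fst i)\<^esub> inv\<^bsub>fiber (fst i)\<^esub> emb a i \<in> fiber_cone (fst i)"
      if "a \<in> gdom V" "i \<in> idx" for a i
      using that G.r_inv[of a]
      by (simp add: emb_def fiber_inv fiber_mult in_fiber_cone idx_spec in_cone val_gzero spec_top
          flip: gneg_eq)
    have "sat ext ((emb \<circ> e)(2 := ?c)) ((points \<circ> (\<lambda>_. l))(1 := ?m)) p"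
      using unit ab by (auto simp: p_def ext_def equalizer_def e_def points_def)
    then have "sat ext (emb \<circ> e) (points \<circ> (\<lambda>_. l)) (ExG 2 (ExL 1 p))"
      using c by (auto simp: ext_sel)
    moreover have "positive_existential (ExG 2 (ExL 1 p))"
      unfolding pe p_def by (intro conjI existential.intros quantifier_free.intros positive.intros)
    moreover have "range e \<subseteq> gdom V" "range (\<lambda>_::nat. l) \<subseteq> ldom V"
      using ab l by (auto simp: e_def)
    ultimately have "sat V e (\<lambda>_. l) (ExG 2 (ExL 1 p))"
      using reflectsD[OF refl_ext, of "ExG 2 (ExL 1 p)" e "\<lambda>_. l"] by blast
    then obtain c m where cm: "c \<in> gdom V" "m \<in> ldom V"
      and s: "sat V (e(2 := c)) ((\<lambda>_. l)(1 := m)) p" by auto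
    let ?e = "e(2 := c)" and ?d = "(\<lambda>_. l)(1 := m)"
    have eq: "lmeet V l m = lbot V" "ljoin V l m = ltop V"
      "lmeet V l (leval V ?e ?d (equalizer 2 0)) = l"
      "lmeet V m (leval V ?e ?d (equalizer 2 1)) = m"
      using s by (simp_all add: p_def)
    have rng: "range ?e \<subseteq> gdom V" "range ?d \<subseteq> ldom V" using cm ab l by (auto simp: e_def)
    have "(m \<in> x \<longleftrightarrow> l \<notin> x) \<and> (l \<in> x \<longrightarrow> peq x c a) \<and> (l \<notin> x \<longrightarrow> peq x c b)" if x: "x \<in> spec V" for x
    proof -
      have "l \<in> x \<longrightarrow> leval V ?e ?d (equalizer 2 0) \<in> x"
        using eq(3) spec_meet[OF x l leval_closed[OF dense rng], of "equalizer 2 0"] by auto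
      moreover have "m \<in> x \<longrightarrow> leval V ?e ?d (equalizer 2 1) \<in> x"
        using eq(4) spec_meet[OF x cm(2) leval_closed[OF dense rng], of "equalizer 2 1"] by auto
      moreover have "\<not> (l \<in> x \<and> m \<in> x)" "l \<in> x \<or> m \<in> x"
        using eq(1,2) spec_meet[OF x l cm(2)] spec_join[OF x l cm(2)] spec_top[OF x] spec_bot[OF x] by auto
      ultimately show ?thesis
        using equalizer_spec[OF x, of ?e 2 0 ?d] equalizer_spec[OF x, of ?e 2 1 ?d] cm ab
        by (auto simp: e_def)
    qed
    then show ?thesis using cm by blast
  qed
qed

end

section \<open>Linear forms and pointwise types\<close>

text \<open>An integer combination of variables as a list of coefficient and variable. Lists are not
  normalized, a variable may recur, and addition is concatenation.\<close>

type_synonym form = "(int \<times> nat) list"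

primrec lin :: "('g, 'l) vlgrp \<Rightarrow> (nat \<Rightarrow> 'g) \<Rightarrow> form \<Rightarrow> 'g" where
  "lin V e [] = gzero V"
| "lin V e (m # f) = gadd V (e (snd m) [^]\<^bsub>add_group V\<^esub> fst m) (lin V e f)"

definition fneg :: "form \<Rightarrow> form" where
  "fneg f = map (\<lambda>(k, i). (- k, i)) f"

text \<open>If \<open>q\<close> tells which forms are nonnegative at a point, then \<open>nform q t\<close> is equal to \<open>t\<close> at that
  point. Only the answers of \<open>q\<close> on the finite set \<open>queries t\<close> matter.\<close>

primrec nform :: "(form \<Rightarrow> bool) \<Rightarrow> gterm \<Rightarrow> form" where
  "nform q (GVar n) = [(1, n)]"
| "nform q GZero = []"
| "nform q (GAdd s t) = nform q s @ nform q t"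
| "nform q (GNeg t) = fneg (nform q t)"
| "nform q (GMeet s t) = (if q (nform q t @ fneg (nform q s)) then nform q s else nform q t)"
| "nform q (GJoin s t) = (if q (nform q t @ fneg (nform q s)) then nform q t else nform q s)"

text \<open>Contains \<open>nform q t\<close> for every \<open>q\<close>. Being finite, it allows
  the relevant forms to be fixed before any point is chosen.\<close>

primrec cands :: "gterm \<Rightarrow> form set" where
  "cands (GVar n) = {[(1, n)]}"
| "cands GZero = {[]}"
| "cands (GAdd s t) = (\<lambda>(f, g). f @ g) ` (cands s \<times> cands t)"
| "cands (GNeg t) = fneg ` cands t"
| "cands (GMeet s t) = cands s \<union> cands t"
| "cands (GJoin s t) = cands s \<union> cands t"

primrec queries :: "gterm \<Rightarrow> form set" where
  "queries (GVar n) = {}"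
| "queries GZero = {}"
| "queries (GAdd s t) = queries s \<union> queries t"
| "queries (GNeg t) = queries t"
| "queries (GMeet s t) = queries s \<union> queries t \<union> (\<lambda>(f, g). g @ fneg f) ` (cands s \<times> cands t)"
| "queries (GJoin s t) = queries s \<union> queries t \<union> (\<lambda>(f, g). g @ fneg f) ` (cands s \<times> cands t)"

lemma finite_cands: "finite (cands t)"
  by (induction t) auto

lemma finite_queries: "finite (queries t)"
  by (induction t) (auto simp: finite_cands)

lemma nform_cands: "nform q t \<in> cands t"
  by (induction t) auto

lemma nform_cong: "(\<And>f. f \<in> queries t \<Longrightarrow> q f = q' f) \<Longrightarrow> nform q t = nform q' t"
proof (induction t)
  case (GMeet s t)
  then have st: "nform q s = nform q' s" "nform q t = nform q' t" by simp_all
  have "nform q' t @ fneg (nform q' s) \<in> queries (GMeet s t)"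
    using nform_cands[of q' s] nform_cands[of q' t] by auto
  with GMeet.prems st show ?case by simp
next
  case (GJoin s t)
  then have st: "nform q s = nform q' s" "nform q t = nform q' t" by simp_all
  have "nform q' t @ fneg (nform q' s) \<in> queries (GJoin s t)"
    using nform_cands[of q' s] nform_cands[of q' t] by auto
  with GJoin.prems st show ?case by simp
qed simp_all

text \<open>Whether the value of a term belongs to a point, computed from its pattern alone:
  \<open>Q\<close> holds the forms that are nonnegative there and \<open>R\<close> the lattice
  variables whose values belong to the point.\<close>

primrec ltruth :: "form set \<Rightarrow> nat set \<Rightarrow> lterm \<Rightarrow> bool" where
  "ltruth Q R (LVar n) \<longleftrightarrow> n \<in> R"
| "ltruth Q R LBot \<longleftrightarrow> False"
| "ltruth Q R LTop \<longleftrightarrow> True"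
| "ltruth Q R (LMeet s t) \<longleftrightarrow> ltruth Q R s \<and> ltruth Q R t"
| "ltruth Q R (LJoin s t) \<longleftrightarrow> ltruth Q R s \<or> ltruth Q R t"
| "ltruth Q R (Val t) \<longleftrightarrow> nform (\<lambda>f. f \<in> Q) t \<in> Q"

primrec lforms :: "lterm \<Rightarrow> form set" where
  "lforms (LVar n) = {}"
| "lforms LBot = {}"
| "lforms LTop = {}"
| "lforms (LMeet s t) = lforms s \<union> lforms t"
| "lforms (LJoin s t) = lforms s \<union> lforms t"
| "lforms (Val t) = queries t \<union> cands t"

primrec lvars :: "lterm \<Rightarrow> nat set" where
  "lvars (LVar n) = {n}"
| "lvars LBot = {}"
| "lvars LTop = {}"
| "lvars (LMeet s t) = lvars s \<union> lvars t"
| "lvars (LJoin s t) = lvars s \<union> lvars t"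
| "lvars (Val t) = {}"

definition same :: "gterm \<Rightarrow> gterm \<Rightarrow> lterm" where
  "same s t = LMeet (Val (GAdd s (GNeg t))) (Val (GAdd t (GNeg s)))"

text \<open>Equations are tested at every pattern of \<open>T\<close>. The quantifier cases are
  default values; only quantifier-free formulas are evaluated.\<close>

primrec qsat :: "(form set \<times> nat set) set \<Rightarrow> fm \<Rightarrow> bool" where
  "qsat T (GEq s t) \<longleftrightarrow> (\<forall>(Q, R)\<in>T. ltruth Q R (same s t))"
| "qsat T (LEq s t) \<longleftrightarrow> (\<forall>(Q, R)\<in>T. ltruth Q R s \<longleftrightarrow> ltruth Q R t)"
| "qsat T (Neg p) \<longleftrightarrow> \<not> qsat T p"
| "qsat T (Conj p q) \<longleftrightarrow> qsat T p \<and> qsat T q"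
| "qsat T (Disj p q) \<longleftrightarrow> qsat T p \<or> qsat T q"
| "qsat T (ExG n p) \<longleftrightarrow> False"
| "qsat T (ExL n p) \<longleftrightarrow> False"
| "qsat T (AllG n p) \<longleftrightarrow> False"
| "qsat T (AllL n p) \<longleftrightarrow> False"

primrec fforms :: "fm \<Rightarrow> form set" where
  "fforms (GEq s t) = lforms (same s t)"
| "fforms (LEq s t) = lforms s \<union> lforms t"
| "fforms (Neg p) = fforms p"
| "fforms (Conj p q) = fforms p \<union> fforms q"
| "fforms (Disj p q) = fforms p \<union> fforms q"
| "fforms (ExG n p) = {}"
| "fforms (ExL n p) = {}"
| "fforms (AllG n p) = {}"
| "fforms (AllL n p) = {}"

primrec fvars :: "fm \<Rightarrow> nat set" where
  "fvars (GEq s t) = {}"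
| "fvars (LEq s t) = lvars s \<union> lvars t"
| "fvars (Neg p) = fvars p"
| "fvars (Conj p q) = fvars p \<union> fvars q"
| "fvars (Disj p q) = fvars p \<union> fvars q"
| "fvars (ExG n p) = {}"
| "fvars (ExL n p) = {}"
| "fvars (AllG n p) = {}"
| "fvars (AllL n p) = {}"

lemma finite_fforms: "finite (fforms p)" and finite_fvars: "finite (fvars p)"
proof -
  have "finite (lforms t)" "finite (lvars t)" for t
    by (induction t) (auto simp: finite_cands finite_queries)
  then show "finite (fforms p)" "finite (fvars p)" by (induction p) auto
qed

definition pattern ::
  "('g, 'l) vlgrp \<Rightarrow> form set \<Rightarrow> nat set \<Rightarrow> (nat \<Rightarrow> 'g) \<Rightarrow> (nat \<Rightarrow> 'l) \<Rightarrow> 'l set \<Rightarrow> form set \<times> nat set" where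
  "pattern V F I e d x = ({f \<in> F. val V (lin V e f) \<in> x}, {i \<in> I. d i \<in> x})"

text \<open>Only which patterns occur is recorded, not how often or where.\<close>

definition types ::
  "('g, 'l) vlgrp \<Rightarrow> form set \<Rightarrow> nat set \<Rightarrow> (nat \<Rightarrow> 'g) \<Rightarrow> (nat \<Rightarrow> 'l) \<Rightarrow> (form set \<times> nat set) set" where
  "types V F I e d = pattern V F I e d ` spec V"

section \<open>Terms and quantifier-free formulas evaluated from patterns\<close>

context dense_vlgroup
begin

lemma int_pow_closed [simp]: "a \<in> gdom V \<Longrightarrow> a [^]\<^bsub>G\<^esub> (k::int) \<in> gdom V"
  using G.int_pow_closed[of a k] by simp

lemma lin_closed: "range e \<subseteq> gdom V \<Longrightarrow> lin V e f \<in> gdom V"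
  by (induction f) (auto simp: image_subset_iff)

lemma lin_append:
  assumes "range e \<subseteq> gdom V"
  shows "lin V e (f @ g) = gadd V (lin V e f) (lin V e g)"
proof (induction f)
  case Nil
  show ?case using G.l_one[of "lin V e g"] lin_closed[OF assms] by simp
next
  case (Cons m f)
  have "e (snd m) \<in> gdom V" using assms by auto
  then show ?case using Cons G.m_assoc[of "e (snd m) [^]\<^bsub>G\<^esub> fst m" "lin V e f" "lin V e g"]
    lin_closed[OF assms] by simp
qed

lemma lin_fneg:
  assumes "range e \<subseteq> gdom V"
  shows "lin V e (fneg f) = gneg V (lin V e f)"
proof (induction f)
  case Nil
  show ?case using G.inv_one by (simp add: fneg_def gneg_eq)
next
  case (Cons m f)
  have "e (snd m) \<in> gdom V" using assms by auto
  then show ?case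
    using Cons G.inv_mult[of "e (snd m) [^]\<^bsub>G\<^esub> fst m" "lin V e f"] lin_closed[OF assms, of f]
      G.int_pow_neg[of "e (snd m)" "fst m"]
    by (simp add: fneg_def gneg_eq case_prod_beta)
qed

text \<open>At a point the order is total, so each meet or join is equivalent to one of its
  arguments; the query on the difference of their forms tells which.\<close>

lemma peq_lin_nform:
  assumes x: "x \<in> spec V" and e: "range e \<subseteq> gdom V"
  shows "peq x (geval V e t) (lin V e (nform (\<lambda>f. val V (lin V e f) \<in> x) t))"
proof -
  interpret total_cone G "cone x" by (rule cone_total_cone[OF x])
  let ?q = "\<lambda>f. val V (lin V e f) \<in> x"
  have ge: "geval V e t \<in> gdom V" for t by (rule geval_closed[OF dense e])
  have lc: "lin V e f \<in> gdom V" for f by (rule lin_closed[OF e])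
  have q: "?q (g @ fneg f) \<longleftrightarrow> le (lin V e f) (lin V e g)" for f g
    using ple_def[OF x lc lc] by (simp add: lin_append[OF e] lin_fneg[OF e])
  have le_iff: "le (geval V e s) (geval V e t) \<longleftrightarrow> ?q (nform ?q t @ fneg (nform ?q s))"
    if "eqv (geval V e s) (lin V e (nform ?q s))" "eqv (geval V e t) (lin V e (nform ?q t))" for s t
    unfolding q by (rule eqv_le_iff[OF that]) (simp_all add: ge lc)
  have trans: "eqv a b \<Longrightarrow> eqv b c \<Longrightarrow> a \<in> gdom V \<Longrightarrow> b \<in> gdom V \<Longrightarrow> c \<in> gdom V \<Longrightarrow> eqv a c" for a b c
    using eqv_trans[of a b c] by simp
  show ?thesis
  proof (induction t)
    case (GVar n)
    have "e n \<in> gdom V" using e by auto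
    then show ?case using G.int_pow_1[of "e n"] G.r_one[of "e n"] eqv_refl by simp
  next
    case GZero
    then show ?case using eqv_refl by simp
  next
    case (GAdd s t)
    then show ?case using eqv_mult ge lc by (simp add: lin_append[OF e])
  next
    case (GNeg t)
    then show ?case using eqv_inv ge lc by (simp add: lin_fneg[OF e] gneg_eq)
  next
    case (GMeet s t)
    note le = le_iff[OF GMeet]
    show ?case
    proof (cases "le (geval V e s) (geval V e t)")
      case True
      then show ?thesis
        using le GMeet peq_gmeet_gjoin(1)[OF x ge ge True] trans[OF _ GMeet(1)] ge lc by simp
    next
      case False
      then have "le (geval V e t) (geval V e s)" using le_total ge by auto
      then show ?thesis
        using le False peq_gmeet_gjoin(2)[OF x ge ge, of t s] trans[OF _ GMeet(2)] ge lc by simp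
    qed
  next
    case (GJoin s t)
    note le = le_iff[OF GJoin]
    show ?case
    proof (cases "le (geval V e s) (geval V e t)")
      case True
      then show ?thesis
        using le peq_gmeet_gjoin(3)[OF x ge ge True] trans[OF _ GJoin(2)] ge lc by simp
    next
      case False
      then have "le (geval V e t) (geval V e s)" using le_total ge by auto
      then show ?thesis
        using le False peq_gmeet_gjoin(4)[OF x ge ge, of t s] trans[OF _ GJoin(1)] ge lc by simp
    qed
  qed
qed

lemma ltruth_pattern:
  assumes x: "x \<in> spec V" and e: "range e \<subseteq> gdom V" and d: "range d \<subseteq> ldom V"
    and F: "lforms t \<subseteq> F" and I: "lvars t \<subseteq> I"
  shows "leval V e d t \<in> x \<longleftrightarrow> ltruth (fst (pattern V F I e d x)) (snd (pattern V F I e d x)) t"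
  using F I
proof (induction t)
  case (LVar n)
  then show ?case by (simp add: pattern_def)
next
  case (Val t)
  let ?q = "\<lambda>f. val V (lin V e f) \<in> x"
  have *: "nform (\<lambda>f. f \<in> fst (pattern V F I e d x)) t = nform ?q t"
    by (rule nform_cong) (use Val in \<open>auto simp: pattern_def\<close>)
  have "nform ?q t \<in> F" using Val nform_cands[of ?q t] by auto
  moreover have "val V (geval V e t) \<in> x \<longleftrightarrow> ?q (nform ?q t)"
    using total_cone.eqv_le_iff[OF cone_total_cone[OF x] total_cone.eqv_refl[OF cone_total_cone[OF x], of "gzero V"]
        peq_lin_nform[OF x e, of t]] x geval_closed[OF dense e, of t] lin_closed[OF e]
    by (simp add: ple_zero)
  ultimately show ?case by (simp add: *) (simp add: pattern_def)
qed (use x in \<open>simp_all add: spec_meet spec_join spec_top spec_bot leval_closed[OF dense e d]\<close>)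

text \<open>Equality in either sort is equality at all points, so an atomic formula is a universal
  statement about the occurring patterns, and its negation says that a violating pattern
  occurs.\<close>

lemma sat_types:
  assumes e: "range e \<subseteq> gdom V" and d: "range d \<subseteq> ldom V" and p: "quantifier_free p"
    and F: "fforms p \<subseteq> F" and I: "fvars p \<subseteq> I"
  shows "sat V e d p \<longleftrightarrow> qsat (types V F I e d) p"
  using p F I
proof (induction p)
  case (1 s t)
  have "geval V e s = geval V e t \<longleftrightarrow> (\<forall>x\<in>spec V. leval V e d (same s t) \<in> x)"
    using eq_iff_peq geval_closed[OF dense e]
    by (simp add: same_def spec_meet ple_def total_cone.eqv_def[OF cone_total_cone] conj_commute)
  moreover have "lvars (same s t) = {}" by (simp add: same_def)
  ultimately show ?case
    using ltruth_pattern[OF _ e d, of _ "same s t" F I] 1 by (auto simp: types_def)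
next
  case (2 s t)
  then show ?case
    using ltruth_pattern[OF _ e d, of _ s F I] ltruth_pattern[OF _ e d, of _ t F I]
      lattice_eq_iff_spec[OF leval_closed[OF dense e d] leval_closed[OF dense e d], of s t]
    by (auto simp: types_def case_prod_beta)
qed simp_all

end

section \<open>Invariance of the pattern set under embeddings\<close>

lemma lin_embedding:
  assumes "embedding f h V W" "densely_valued_lgroup V" "densely_valued_lgroup W" "range e \<subseteq> gdom V"
  shows "f (lin V e g) = lin W (f \<circ> e) g"
proof -
  interpret V: dense_vlgroup V by unfold_locales (rule assms)
  interpret W: dense_vlgroup W by unfold_locales (rule assms)
  have hom: "f \<in> hom (add_group V) (add_group W)"
    using assms(1) by (auto simp: hom_def embedding_def)
  have fpow: "f (a [^]\<^bsub>add_group V\<^esub> k) = f a [^]\<^bsub>add_group W\<^esub> k" if "a \<in> gdom V" for a and k :: int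
    using hom_int_pow[OF hom _ V.G.is_group W.G.is_group, of a k] that by simp
  have "e n \<in> gdom V" for n using assms(4) by auto
  then show ?thesis
    using assms(1) fpow V.lin_closed[OF assms(4)]
    by (induction g) (simp_all add: embedding_def)
qed

text \<open>The preimage under \<open>h\<close> of a prime filter of \<open>W\<close> is a prime
  filter of \<open>V\<close> with the same pattern. Every prime filter \<open>x\<close> of
  \<open>V\<close> arises so: \<open>h\<close> reflects the order, hence a prime filter of
  \<open>W\<close> separates the image of \<open>x\<close> from the image of its complement.\<close>

theorem types_embedding:
  assumes em: "embedding f h V W" and V: "densely_valued_lgroup V" and W: "densely_valued_lgroup W"
    and e: "range e \<subseteq> gdom V" and d: "range d \<subseteq> ldom V"
  shows "types W F I (f \<circ> e) (h \<circ> d) = types V F I e d"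
proof -
  interpret V: dense_vlgroup V by unfold_locales (rule V)
  interpret W: dense_vlgroup W by unfold_locales (rule W)
  have h: "inj_on h (ldom V)" "h ` ldom V \<subseteq> ldom W" "h (lbot V) = lbot W" "h (ltop V) = ltop W"
    and hm: "\<And>a b. \<lbrakk>a \<in> ldom V; b \<in> ldom V\<rbrakk> \<Longrightarrow> h (lmeet V a b) = lmeet W (h a) (h b)"
    and hj: "\<And>a b. \<lbrakk>a \<in> ldom V; b \<in> ldom V\<rbrakk> \<Longrightarrow> h (ljoin V a b) = ljoin W (h a) (h b)"
    and hv: "\<And>a. a \<in> gdom V \<Longrightarrow> h (val V a) = val W (f a)"
    using em by (auto simp: embedding_def)
  have hle: "lle W (h a) (h b) \<longleftrightarrow> lle V a b" if "a \<in> ldom V" "b \<in> ldom V" for a b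
    using that h(1) hm[of a b, symmetric] by (auto simp: lle_def inj_on_def)
  define r where "r y = {l \<in> ldom V. h l \<in> y}" for y
  have r: "r y \<in> spec V" if y: "y \<in> spec W" for y
  proof -
    have hc: "h a \<in> ldom W" if "a \<in> ldom V" for a using h that by auto
    have "lattice_filter V (r y)"
      unfolding lattice_filter_def
      using y hm hc W.spec_meet[OF y] W.spec_up[OF y] hle by (auto simp: r_def)
    then show ?thesis
      using h W.spec_top[OF y] W.spec_bot[OF y] W.spec_join[OF y] hj hc
      by (auto simp: spec_def r_def)
  qed
  have pat: "pattern W F I (f \<circ> e) (h \<circ> d) y = pattern V F I e d (r y)" for y
  proof -
    have "val W (lin W (f \<circ> e) g) = h (val V (lin V e g))" for g
      using lin_embedding[OF em V W e] hv V.lin_closed[OF e] by simp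
    moreover have "d i \<in> ldom V" for i using d by auto
    ultimately show ?thesis using V.lin_closed[OF e] by (simp add: pattern_def r_def)
  qed
  have "\<exists>y\<in>spec W. r y = x" if x: "x \<in> spec V" for x
  proof -
    have xs: "x \<subseteq> ldom V" using V.spec_sub[OF x] by blast
    obtain y where y: "y \<in> spec W" "h ` x \<subseteq> y" "y \<inter> h ` (ldom V - x) = {}"
    proof (rule W.prime_filter_separation[of "h ` x" "h ` (ldom V - x)"])
      show "h ` x \<subseteq> ldom W" "h ` (ldom V - x) \<subseteq> ldom W" using h xs by auto
      show "h ` x \<noteq> {}" "h ` (ldom V - x) \<noteq> {}" using V.spec_top[OF x] V.spec_bot[OF x] densely_valued_closed(6)[OF V] by blast+
      show "lmeet W a b \<in> h ` x" if ab: "a \<in> h ` x" "b \<in> h ` x" for a b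
      proof -
        obtain a' b' where "a = h a'" "b = h b'" "a' \<in> x" "b' \<in> x" using ab by auto
        moreover from this have "a' \<in> ldom V" "b' \<in> ldom V" using xs by auto
        ultimately show ?thesis using hm[of a' b'] V.spec_meet[OF x, of a' b']
          by (intro image_eqI[of _ _ "lmeet V a' b'"]) auto
      qed
      show "ljoin W a b \<in> h ` (ldom V - x)" if ab: "a \<in> h ` (ldom V - x)" "b \<in> h ` (ldom V - x)" for a b
      proof -
        obtain a' b' where "a = h a'" "b = h b'" "a' \<in> ldom V - x" "b' \<in> ldom V - x" using ab by auto
        then show ?thesis using hj[of a' b'] V.spec_join[OF x, of a' b']
          by (intro image_eqI[of _ _ "ljoin V a' b'"]) auto
      qed
      show "\<not> lle W a b" if "a \<in> h ` x" "b \<in> h ` (ldom V - x)" for a b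
        using that hle V.spec_up[OF x] xs by blast
    qed
    then have "r y = x" using xs by (auto simp: r_def)
    with y show ?thesis by blast
  qed
  then have "r ` spec W = spec V" using r by blast
  then show ?thesis unfolding types_def pat by (simp flip: image_image)
qed

section \<open>Realizing patterns\<close>

lemma (in total_cone) ex_greatest:
  assumes "finite L" "L \<noteq> {}" "\<And>s. s \<in> L \<Longrightarrow> w s \<in> carrier G"
  shows "\<exists>p\<in>L. \<forall>s\<in>L. le (w s) (w p)"
  using assms
proof (induction rule: finite_ne_induct)
  case (singleton s)
  then show ?case using le_refl by simp
next
  case (insert s L)
  then obtain p where p: "p \<in> L" "\<forall>s\<in>L. le (w s) (w p)" by auto
  have cl: "w s \<in> carrier G" "w p \<in> carrier G" "\<And>t. t \<in> L \<Longrightarrow> w t \<in> carrier G"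
    using insert.prems p by auto
  show ?case
  proof (cases "le (w s) (w p)")
    case True
    then show ?thesis using p by auto
  next
    case False
    then have "le (w p) (w s)" using le_total cl by blast
    then have "le (w t) (w s)" if "t \<in> L" for t using p cl le_trans[of "w t" "w p" "w s"] that by auto
    then show ?thesis using le_refl cl by auto
  qed
qed

lemma (in total_cone) ex_least:
  assumes "finite L" "L \<noteq> {}" "\<And>s. s \<in> L \<Longrightarrow> w s \<in> carrier G"
  shows "\<exists>p\<in>L. \<forall>s\<in>L. le (w p) (w s)"
proof -
  obtain p where p: "p \<in> L" "\<forall>s\<in>L. le (inv (w s)) (inv (w p))"
    using ex_greatest[of L "\<lambda>s. inv (w s)"] assms by auto
  then have "\<forall>s\<in>L. le (w p) (w s)" using le_inv assms(3) by blast
  with p show ?thesis by blast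
qed

text \<open>Doubling \<open>c \<le> p\<close> or \<open>q \<le> c\<close> and cancelling would give
  \<open>q \<le> p\<close>.\<close>

lemma (in total_cone) mid_strict:
  assumes "\<not> le q p" "c \<otimes> c = p \<otimes> q" "p \<in> carrier G" "q \<in> carrier G" "c \<in> carrier G"
  shows "\<not> le c p" "\<not> le q c"
proof -
  have *: "\<not> le (p \<otimes> q) (p \<otimes> p)" "\<not> le (q \<otimes> q) (p \<otimes> q)"
    using assms le_cancel by simp_all
  show "\<not> le c p"
    using le_mult[of c p c p] assms * by auto
  show "\<not> le q c"
    using le_mult[of q c q c] assms * by auto
qed

lemma (in total_cone) le_int_pow:
  assumes "a \<in> carrier G" "b \<in> carrier G" "k > (0::int)"
  shows "le (a [^] k) (b [^] k) \<longleftrightarrow> le a b"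
  using le_pow[OF assms(1,2), of "nat k"] assms(3) by (simp add: int_pow_def2 del: pow_nat)

lemma (in total_cone) eqv_int_pow:
  assumes "eqv a b" "a \<in> carrier G" "b \<in> carrier G"
  shows "eqv (a [^] (k::int)) (b [^] k)"
proof -
  have *: "eqv (a [^] n) (b [^] n)" for n :: nat
    using assms by (induction n) (auto intro: eqv_mult eqv_refl)
  show ?thesis
    using *[of "nat k"] eqv_inv[OF *[of "nat (- k)"]] assms(2,3)
    by (cases "k < 0") (simp_all add: int_pow_def2 del: pow_nat)
qed

text \<open>The cut that \<open>t\<close> makes in the values \<open>w\<close> is realized, with one element for all points
  where \<open>v\<close> is ordered like \<open>w\<close>: by \<open>v s\<close>, by the midpoint of two neighbours, or by translating
  an extreme value by the negative element.\<close>

lemma (in tame_vlgroup) realize_cut: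
  assumes H: "total_cone H D" and t: "t \<in> carrier H" and w: "\<And>s. s \<in> S \<Longrightarrow> w s \<in> carrier H"
    and v: "\<And>s. s \<in> S \<Longrightarrow> v s \<in> gdom V" and S: "finite S" "S \<noteq> {}" and M: "M > (0::nat)"
  shows "\<exists>b\<in>gdom V. \<forall>x\<in>spec V.
    (\<forall>s\<in>S. \<forall>s'\<in>S. ple x (v s) (v s') \<longleftrightarrow> total_cone.le H D (w s) (w s')) \<longrightarrow>
    (\<forall>s\<in>S. (ple x (v s) (b [^]\<^bsub>G\<^esub> M) \<longleftrightarrow> total_cone.le H D (w s) t) \<and>
      (ple x (b [^]\<^bsub>G\<^esub> M) (v s) \<longleftrightarrow> total_cone.le H D t (w s)))"
proof -
  interpret H: total_cone H D by (rule H)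
  define good where "good x \<longleftrightarrow> x \<in> spec V \<and> (\<forall>s\<in>S. \<forall>s'\<in>S. ple x (v s) (v s') \<longleftrightarrow> H.le (w s) (w s'))" for x
  define fits where "fits b x \<longleftrightarrow> (\<forall>s\<in>S. (ple x (v s) (b [^]\<^bsub>G\<^esub> M) \<longleftrightarrow> H.le (w s) t) \<and>
      (ple x (b [^]\<^bsub>G\<^esub> M) (v s) \<longleftrightarrow> H.le t (w s)))" for b x
  have pow: "b [^]\<^bsub>G\<^esub> M \<in> gdom V" if "b \<in> gdom V" for b
    using G.nat_pow_closed[of b M] that by simp
  define L where "L = {s \<in> S. H.le (w s) t}"
  define U where "U = {s \<in> S. H.le t (w s)}"
  have LU: "S = L \<union> U" using H.le_total t w by (auto simp: L_def U_def)
  have "\<exists>b\<in>gdom V. \<forall>x. good x \<longrightarrow> fits b x"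
  proof (cases "L \<inter> U = {}")
    case False
    \<comment> \<open>Here \<open>t\<close> ties with some \<open>w p\<close>, and an
      \<open>M\<close>-th root of \<open>v p\<close> fits.\<close>
    then obtain p where p: "p \<in> S" "H.le (w p) t" "H.le t (w p)" by (auto simp: L_def U_def)
    obtain b where b: "b \<in> gdom V" "b [^]\<^bsub>G\<^esub> M = v p" using divisible[OF v[OF p(1)] M] by auto
    have "fits b x" if "good x" for x
      unfolding fits_def b(2)
    proof (intro ballI conjI)
      fix s assume s: "s \<in> S"
      have "H.le (w s) (w p) \<longleftrightarrow> H.le (w s) t" "H.le (w p) (w s) \<longleftrightarrow> H.le t (w s)"
        using p s w t H.le_trans[of "w s" "w p" t] H.le_trans[of "w s" t "w p"]
          H.le_trans[of "w p" t "w s"] H.le_trans[of t "w p" "w s"] by auto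
      then show "ple x (v s) (v p) \<longleftrightarrow> H.le (w s) t" "ple x (v p) (v s) \<longleftrightarrow> H.le t (w s)"
        using that p s by (auto simp: good_def)
    qed
    with b show ?thesis by blast
  next
    case disj: True
    have fin: "finite L" "finite U" using S by (auto simp: L_def U_def)
    \<comment> \<open>Without ties it suffices to lie strictly above the largest lower value and
      strictly below the smallest upper one; either side may be empty.\<close>
    have crit: "fits b x"
      if b: "b \<in> gdom V" and x: "good x"
        and lo: "L \<noteq> {} \<Longrightarrow> \<exists>p\<in>L. (\<forall>s\<in>L. H.le (w s) (w p)) \<and> \<not> ple x (b [^]\<^bsub>G\<^esub> M) (v p)"
        and up: "U \<noteq> {} \<Longrightarrow> \<exists>q\<in>U. (\<forall>s\<in>U. H.le (w q) (w s)) \<and> \<not> ple x (v q) (b [^]\<^bsub>G\<^esub> M)" for b x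
      unfolding fits_def
    proof
      fix s assume s: "s \<in> S"
      let ?c = "b [^]\<^bsub>G\<^esub> M"
      have xs: "x \<in> spec V" using x by (simp add: good_def)
      note tr = ple_trans[OF _ _ xs]
      show "(ple x (v s) ?c \<longleftrightarrow> H.le (w s) t) \<and> (ple x ?c (v s) \<longleftrightarrow> H.le t (w s))"
      proof (cases "s \<in> L")
        case True
        then obtain p where p: "p \<in> L" "H.le (w s) (w p)" "\<not> ple x ?c (v p)" using lo by auto
        then have pS: "p \<in> S" by (simp add: L_def)
        have sp: "ple x (v s) (v p)" using x p pS s by (auto simp: good_def)
        have "ple x (v p) ?c" using p ple_total[OF xs] v[OF pS] pow[OF b] by blast
        then have "ple x (v s) ?c" using tr[OF sp] v[OF pS] v[OF s] pow[OF b] by blast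
        moreover have "\<not> ple x ?c (v s)"
          using tr[of ?c "v s" "v p"] sp p(3) v[OF pS] v[OF s] pow[OF b] by blast
        moreover have "H.le (w s) t" "\<not> H.le t (w s)" using True disj by (auto simp: L_def U_def)
        ultimately show ?thesis by simp
      next
        case False
        then have sU: "s \<in> U" using LU s by auto
        then obtain q where q: "q \<in> U" "H.le (w q) (w s)" "\<not> ple x (v q) ?c" using up by auto
        then have qS: "q \<in> S" by (simp add: U_def)
        have qs: "ple x (v q) (v s)" using x q qS s by (auto simp: good_def)
        have "ple x ?c (v q)" using q ple_total[OF xs] v[OF qS] pow[OF b] by blast
        then have "ple x ?c (v s)" using tr[OF _ qs] v[OF qS] v[OF s] pow[OF b] by blast
        moreover have "\<not> ple x (v s) ?c"
          using tr[OF qs, of ?c] q(3) v[OF qS] v[OF s] pow[OF b] by blast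
        moreover have "\<not> H.le (w s) t" "H.le t (w s)" using False sU by (auto simp: L_def U_def)
        ultimately show ?thesis by simp
      qed
    qed
    have maxL: "\<exists>p\<in>L. \<forall>s\<in>L. H.le (w s) (w p)" if "L \<noteq> {}"
      using H.ex_greatest[OF fin(1) that, of w] w by (auto simp: L_def)
    have minU: "\<exists>q\<in>U. \<forall>s\<in>U. H.le (w q) (w s)" if "U \<noteq> {}"
      using H.ex_least[OF fin(2) that, of w] w by (auto simp: U_def)
    \<comment> \<open>Adding \<open>u\<close> moves every element strictly down at every point and
      subtracting it moves up, so there are no endpoints.\<close>
    obtain u where u: "u \<in> gdom V" "val V u = lbot V" using neg_elt by auto
    have neg: "\<not> ple x (gzero V) u" if "x \<in> spec V" for x
      using ple_zero[OF that u(1)] u(2) spec_bot[OF that] by simp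
    have less: "\<not> ple x a (gadd V a u)" if "x \<in> spec V" "a \<in> gdom V" for a x
      using total_cone.le_cancel(2)[OF cone_total_cone[OF that(1)], of "gzero V" u a]
        neg[OF that(1)] that u G.r_one[of a] by simp
    consider "L \<noteq> {}" "U \<noteq> {}" | "U = {}" | "L = {}" by auto
    then show ?thesis
    proof cases
      case 1
      obtain p where p: "p \<in> L" "\<forall>s\<in>L. H.le (w s) (w p)" using maxL 1 by blast
      obtain q where q: "q \<in> U" "\<forall>s\<in>U. H.le (w q) (w s)" using minU 1 by blast
      have pq: "p \<in> S" "q \<in> S" using p q by (auto simp: L_def U_def)
      have "\<not> H.le (w q) (w p)"
        using H.le_trans[of "w q" "w p" t] p q pq w t disj by (auto simp: L_def U_def)
      then have less: "\<not> ple x (v q) (v p)" if "good x" for x using that pq by (auto simp: good_def)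
      \<comment> \<open>The exponent \<open>M + M\<close> is chosen so that the \<open>M\<close>-th
        power of \<open>b\<close>, and not \<open>b\<close> itself, is the midpoint.\<close>
      obtain b where b: "b \<in> gdom V" "b [^]\<^bsub>G\<^esub> (M + M) = gadd V (v p) (v q)"
        using divisible[of "gadd V (v p) (v q)" "M + M"] v[OF pq(1)] v[OF pq(2)] M by auto
      have bb: "gadd V (b [^]\<^bsub>G\<^esub> M) (b [^]\<^bsub>G\<^esub> M) = gadd V (v p) (v q)"
        using b G.nat_pow_mult[of b M M] by simp
      have "fits b x" if x: "good x" for x
      proof (rule crit[OF b(1) x])
        have xs: "x \<in> spec V" using x by (simp add: good_def)
        note mid = total_cone.mid_strict[OF cone_total_cone[OF xs] less[OF x], of "b [^]\<^bsub>G\<^esub> M"]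
        have "\<not> ple x (b [^]\<^bsub>G\<^esub> M) (v p)" "\<not> ple x (v q) (b [^]\<^bsub>G\<^esub> M)"
          using mid bb v[OF pq(1)] v[OF pq(2)] pow[OF b(1)] by simp_all
        then show "\<exists>p\<in>L. (\<forall>s\<in>L. H.le (w s) (w p)) \<and> \<not> ple x (b [^]\<^bsub>G\<^esub> M) (v p)"
          "\<exists>q\<in>U. (\<forall>s\<in>U. H.le (w q) (w s)) \<and> \<not> ple x (v q) (b [^]\<^bsub>G\<^esub> M)"
          using p q by blast+
      qed
      with b show ?thesis by blast
    next
      case 2
      then obtain p where p: "p \<in> L" "\<forall>s\<in>L. H.le (w s) (w p)" using maxL LU S by blast
      then have pS: "p \<in> S" by (simp add: L_def)
      let ?c = "gadd V (v p) (gneg V u)"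
      have c: "?c \<in> gdom V" "gadd V ?c u = v p"
        using v[OF pS] u G.m_assoc[of "v p" "gneg V u" u] G.l_inv[of u] G.r_one[of "v p"]
        by (simp_all flip: gneg_eq)
      obtain b where b: "b \<in> gdom V" "b [^]\<^bsub>G\<^esub> M = ?c" using divisible[OF c(1) M] by auto
      have "fits b x" if x: "good x" for x
      proof (rule crit[OF b(1) x])
        have xs: "x \<in> spec V" using x by (simp add: good_def)
        show "\<exists>p\<in>L. (\<forall>s\<in>L. H.le (w s) (w p)) \<and> \<not> ple x (b [^]\<^bsub>G\<^esub> M) (v p)"
          using p less[OF xs c(1)] unfolding c(2) b(2) by blast
      qed (use 2 in simp)
      with b show ?thesis by blast
    next
      case 3
      then obtain q where q: "q \<in> U" "\<forall>s\<in>U. H.le (w q) (w s)" using minU LU S by blast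
      then have qS: "q \<in> S" by (simp add: U_def)
      let ?c = "gadd V (v q) u"
      have c: "?c \<in> gdom V" using v[OF qS] u by simp
      obtain b where b: "b \<in> gdom V" "b [^]\<^bsub>G\<^esub> M = ?c" using divisible[OF c(1) M] by auto
      have "fits b x" if x: "good x" for x
      proof (rule crit[OF b(1) x])
        have xs: "x \<in> spec V" using x by (simp add: good_def)
        show "\<exists>q\<in>U. (\<forall>s\<in>U. H.le (w q) (w s)) \<and> \<not> ple x (v q) (b [^]\<^bsub>G\<^esub> M)"
          using q less[OF xs v[OF qS]] unfolding b(2) by blast
      qed (use 3 in simp)
      with b show ?thesis by blast
    qed
  qed
  then show ?thesis unfolding good_def fits_def by blast
qed

section \<open>Clopen sets of points and simultaneous realization of patterns\<close>

context tame_vlgroup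
begin

text \<open>The sets of points named by lattice elements. Since the lattice is Boolean, these are
  the clopen subsets of its Stone space.\<close>

definition clopen :: "'l set set \<Rightarrow> bool" where
  "clopen Y \<longleftrightarrow> (\<exists>l\<in>ldom V. Y = {x \<in> spec V. l \<in> x})"

lemma clopen_spec: "clopen (spec V)"
  unfolding clopen_def using spec_top by (intro bexI[of _ "ltop V"]) auto

lemma clopen_Int: "clopen Y \<Longrightarrow> clopen Z \<Longrightarrow> clopen (Y \<inter> Z)"
proof -
  assume "clopen Y" "clopen Z"
  then obtain l m where "l \<in> ldom V" "m \<in> ldom V" "Y = {x \<in> spec V. l \<in> x}" "Z = {x \<in> spec V. m \<in> x}"
    by (auto simp: clopen_def)
  then show ?thesis unfolding clopen_def by (intro bexI[of _ "lmeet V l m"]) (auto simp: spec_meet)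
qed

lemma complement:
  assumes "l \<in> ldom V"
  obtains m where "m \<in> ldom V" "\<And>x. x \<in> spec V \<Longrightarrow> m \<in> x \<longleftrightarrow> l \<notin> x"
proof -
  obtain m where "m \<in> ldom V" "\<forall>x\<in>spec V. m \<in> x \<longleftrightarrow> l \<notin> x"
    using patch_compl[of "gzero V" "gzero V" l] assms by auto
  then show ?thesis using that by blast
qed

lemma clopen_Compl: "clopen Y \<Longrightarrow> clopen (spec V - Y)"
proof -
  assume "clopen Y"
  then obtain l where l: "l \<in> ldom V" "Y = {x \<in> spec V. l \<in> x}" by (auto simp: clopen_def)
  obtain m where "m \<in> ldom V" "\<And>x. x \<in> spec V \<Longrightarrow> m \<in> x \<longleftrightarrow> l \<notin> x" 
    using complement[OF l(1)] by blast
  then show ?thesis unfolding clopen_def by (intro bexI[of _ m]) (auto simp: l)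
qed

lemma clopen_sub: "clopen Y \<Longrightarrow> Y \<subseteq> spec V"
  by (auto simp: clopen_def)

lemma clopen_Diff: "clopen Y \<Longrightarrow> clopen Z \<Longrightarrow> clopen (Y - Z)"
  using clopen_Int[of Y "spec V - Z"] clopen_Compl[of Z] clopen_sub[of Y]
  by (simp add: Diff_eq flip: Int_assoc) (simp add: Int_absorb2)

lemma clopen_Ball:
  assumes "finite S" "\<And>s. s \<in> S \<Longrightarrow> clopen {x \<in> spec V. Q s x}"
  shows "clopen {x \<in> spec V. \<forall>s\<in>S. Q s x}"
  using assms
proof (induction rule: finite_induct)
  case empty
  then show ?case using clopen_spec by simp
next
  case (insert s S)
  have "{x \<in> spec V. \<forall>s\<in>insert s S. Q s x} = {x \<in> spec V. Q s x} \<inter> {x \<in> spec V. \<forall>s\<in>S. Q s x}" by auto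
  then show ?case using insert clopen_Int by simp
qed

lemma clopen_iff: "l \<in> ldom V \<Longrightarrow> clopen {x \<in> spec V. l \<in> x \<longleftrightarrow> b}"
proof -
  assume l: "l \<in> ldom V"
  then have c: "clopen {x \<in> spec V. l \<in> x}" by (auto simp: clopen_def)
  have "spec V - {x \<in> spec V. l \<in> x} = {x \<in> spec V. l \<notin> x}" by auto
  then show ?thesis using c clopen_Compl[OF c] by (cases b) simp_all
qed

lemma clopen_pattern:
  assumes "range e \<subseteq> gdom V" "range d \<subseteq> ldom V" "finite F" "finite I"
  shows "clopen {x \<in> spec V. pattern V F I e d x = r}"
proof (cases "fst r \<subseteq> F \<and> snd r \<subseteq> I")
  case True
  then have "{x \<in> spec V. pattern V F I e d x = r} =
      {x \<in> spec V. \<forall>f\<in>F. val V (lin V e f) \<in> x \<longleftrightarrow> f \<in> fst r} \<inter> {x \<in> spec V. \<forall>i\<in>I. d i \<in> x \<longleftrightarrow> i \<in> snd r}"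
    by (cases r) (auto simp: pattern_def)
  moreover have "d i \<in> ldom V" for i using assms(2) by auto
  ultimately show ?thesis
    using assms(3,4) lin_closed[OF assms(1)] by (auto intro!: clopen_Int clopen_Ball clopen_iff)
next
  case False
  then have "{x \<in> spec V. pattern V F I e d x = r} = spec V - spec V" by (auto simp: pattern_def)
  then show ?thesis using clopen_Compl[OF clopen_spec] by (simp only:)
qed

lemma clopen_split:
  assumes "atomless V" "clopen Y" "Y \<noteq> {}"
  obtains Z where "clopen Z" "Z \<noteq> {}" "Z \<subset> Y"
proof -
  obtain l where l: "l \<in> ldom V" "Y = {x \<in> spec V. l \<in> x}" using assms by (auto simp: clopen_def)
  then have "lless V (lbot V) l" using assms(3) spec_bot bot_lle[of l] by (auto simp: lless_def)
  then obtain k where k: "k \<in> ldom V" "lless V (lbot V) k" "lless V k l"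
    using assms(1) l by (auto simp: atomless_def)
  let ?Z = "{x \<in> spec V. k \<in> x}"
  have "clopen ?Z" using k by (auto simp: clopen_def)
  moreover have "?Z \<noteq> {}"
    using lattice_eq_iff_spec[of "lbot V" k] k spec_bot by (auto simp: lless_def)
  moreover have "?Z \<subset> Y"
    using lattice_eq_iff_spec[of k l] lle_iff_spec[of k l] k l by (auto simp: lless_def)
  ultimately show ?thesis using that by blast
qed

text \<open>By induction on \<open>T\<close>: each pair \<open>(r, s)\<close> gets a nonempty clopen part of the set \<open>\<rho> = r\<close>. Since
  clopen sets split, something of that set is left for the other pairs over \<open>r\<close>.\<close>

lemma realize_targets:
  assumes atl: "atomless V" and K: "K \<noteq> {}"
    and patch: "\<And>a b S. \<lbrakk>a \<in> K; b \<in> K; clopen S\<rbrakk> \<Longrightarrow>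
      \<exists>c\<in>K. \<forall>x\<in>spec V. pat c x = (if x \<in> S then pat a x else pat b x)"
    and rho: "\<And>r. clopen {x \<in> spec V. \<rho> x = r}"
    and T: "finite T"
    and cand: "\<And>r s. (r, s) \<in> T \<Longrightarrow> \<exists>a\<in>K. \<forall>x\<in>spec V. \<rho> x = r \<longrightarrow> pat a x = s"
    and Y: "clopen Y" "fst ` T = \<rho> ` Y"
  shows "\<exists>a\<in>K. (\<lambda>x. (\<rho> x, pat a x)) ` Y = T"
  using T cand Y
proof (induction arbitrary: Y rule: finite_induct)
  case empty
  then show ?case using K by auto
next
  case (insert rs T)
  obtain r s where rs: "rs = (r, s)" by fastforce
  define Y0 where "Y0 = Y \<inter> {x \<in> spec V. \<rho> x = r}"
  have Ys: "Y \<subseteq> spec V" using insert.prems clopen_sub by blast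
  have Y0: "clopen Y0" using insert.prems rho clopen_Int by (simp add: Y0_def)
  have "r \<in> \<rho> ` Y" using insert.prems(3) rs by force
  then have ne: "Y0 \<noteq> {}" using Ys by (auto simp: Y0_def)
  have img: "\<rho> ` Y = Set.insert r (fst ` T)" using insert.prems(3) rs by auto
  \<comment> \<open>\<open>Z\<close> is the share of \<open>(r, s)\<close>. If \<open>r\<close>
    recurs in \<open>T\<close>, it is a proper part of \<open>Y0\<close>, so that \<open>r\<close>
    still occurs on the rest; otherwise it is all of \<open>Y0\<close>, because on the rest exactly
    the first components of \<open>T\<close> may occur.\<close>
  have "\<exists>Z. clopen Z \<and> Z \<noteq> {} \<and> Z \<subseteq> Y0 \<and> fst ` T = \<rho> ` (Y - Z)"
  proof (cases "r \<in> fst ` T")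
    case True
    obtain Z where Z: "clopen Z" "Z \<noteq> {}" "Z \<subset> Y0" using clopen_split[OF atl Y0 ne] .
    obtain x0 where x0: "x0 \<in> Y0 - Z" using Z by auto
    have "\<rho> ` Y \<subseteq> \<rho> ` (Y - Z)"
    proof
      fix t assume "t \<in> \<rho> ` Y"
      then obtain x where "x \<in> Y" "t = \<rho> x" by auto
      then show "t \<in> \<rho> ` (Y - Z)"
        using x0 Z(3) by (cases "x \<in> Z") (auto simp: Y0_def intro: rev_image_eqI[of x0])
    qed
    then have "fst ` T = \<rho> ` (Y - Z)" using True img by auto
    with Z show ?thesis by blast
  next
    case False
    have "\<rho> ` (Y - Y0) = \<rho> ` Y - {r}" using Ys by (auto simp: Y0_def)
    then have "fst ` T = \<rho> ` (Y - Y0)" using False img by auto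
    with Y0 ne show ?thesis by blast
  qed
  then obtain Z where Z: "clopen Z" "Z \<noteq> {}" "Z \<subseteq> Y0" "fst ` T = \<rho> ` (Y - Z)" by blast
  obtain b where b: "b \<in> K" "(\<lambda>x. (\<rho> x, pat b x)) ` (Y - Z) = T"
    using insert.IH[OF _ _ Z(4)] insert.prems(1) clopen_Diff[OF insert.prems(2) Z(1)] by blast
  obtain a where a: "a \<in> K" "\<forall>x\<in>spec V. \<rho> x = r \<longrightarrow> pat a x = s"
    using insert.prems(1)[of r s] rs by auto
  obtain c where c: "c \<in> K" "\<forall>x\<in>spec V. pat c x = (if x \<in> Z then pat a x else pat b x)"
    using patch[OF a(1) b(1) Z(1)] by blast
  have "Y = Z \<union> (Y - Z)" using Z(3) by (auto simp: Y0_def)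
  then have "(\<lambda>x. (\<rho> x, pat c x)) ` Y
      = (\<lambda>x. (\<rho> x, pat c x)) ` Z \<union> (\<lambda>x. (\<rho> x, pat c x)) ` (Y - Z)" by (metis image_Un)
  also have "(\<lambda>x. (\<rho> x, pat c x)) ` Z = {(r, s)}"
  proof -
    have "(\<rho> x, pat c x) = (r, s)" if "x \<in> Z" for x
      using that Z(3) a(2) c(2) by (auto simp: Y0_def)
    then show ?thesis using Z(2) by (auto simp: image_constant_conv)
  qed
  also have "(\<lambda>x. (\<rho> x, pat c x)) ` (Y - Z) = (\<lambda>x. (\<rho> x, pat b x)) ` (Y - Z)"
  proof (rule image_cong)
    fix x assume "x \<in> Y - Z"
    then show "(\<rho> x, pat c x) = (\<rho> x, pat b x)" using c(2) Ys by auto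
  qed simp
  finally show ?case using b c rs by auto
qed

end

section \<open>Extending an assignment by one element\<close>

primrec coef :: "nat \<Rightarrow> form \<Rightarrow> int" where
  "coef n [] = 0"
| "coef n (m # f) = (if snd m = n then fst m else 0) + coef n f"

definition rest :: "nat \<Rightarrow> form \<Rightarrow> form" where
  "rest n f = filter (\<lambda>m. snd m \<noteq> n) f"

definition fscale :: "int \<Rightarrow> form \<Rightarrow> form" where
  "fscale k f = map (\<lambda>(j, i). (k * j, i)) f"

text \<open>The value with which \<open>M\<close> times the variable \<open>n\<close> has to be compared to find the sign of \<open>f\<close>.\<close>

definition cut :: "nat \<Rightarrow> nat \<Rightarrow> form \<Rightarrow> form" where
  "cut n M f = fscale (- (int M div coef n f)) (rest n f)"

text \<open>The product of the absolute values of the nonzero coefficients. Scaling all forms to one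
  multiple \<open>M\<close> of the variable replaces their signs by the position of a single element
  among finitely many cut points.\<close>

lemma ex_common_multiple:
  assumes "finite F"
  shows "\<exists>M>0. \<forall>f\<in>F. coef n f \<noteq> 0 \<longrightarrow> coef n f dvd int M"
proof -
  let ?F = "{f \<in> F. coef n f \<noteq> 0}"
  let ?M = "\<Prod>f\<in>?F. nat \<bar>coef n f\<bar>"
  have "coef n f dvd int ?M" if "f \<in> ?F" for f
  proof -
    have "nat \<bar>coef n f\<bar> dvd ?M" by (rule dvd_prodI) (use that assms in auto)
    then have "int (nat \<bar>coef n f\<bar>) dvd int ?M" by (simp only: int_dvd_int_iff)
    then show ?thesis by simp
  qed
  moreover have "?M > 0" by (rule prod_pos) auto
  ultimately show ?thesis by blast
qed

lemma (in total_cone) one_le_mult_iff: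
  assumes "a \<in> carrier G" "b \<in> carrier G"
  shows "le \<one> (a \<otimes> b) \<longleftrightarrow> le (inv b) a" "le \<one> (a \<otimes> b) \<longleftrightarrow> le (inv a) b"
  using le_cancel(1)[of "inv b" a b] le_cancel(2)[of "inv a" b a] assms by simp_all

text \<open>Raise to the positive power \<open>\<bar>int M div k\<bar>\<close>: the exponent of
  \<open>b\<close> becomes \<open>M\<close> or \<open>-M\<close> according to the sign of
  \<open>k\<close>, which decides the side of the comparison.\<close>

lemma (in total_cone) one_le_pow_mult:
  assumes "b \<in> carrier G" "r \<in> carrier G" "k \<noteq> 0" "k dvd int M" "M > 0"
  shows "le \<one> (b [^] k \<otimes> r) \<longleftrightarrow>
    (if k > 0 then le (r [^] (- (int M div k))) (b [^] M) else le (b [^] M) (r [^] (- (int M div k))))"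
proof -
  define m where "m = int M div k"
  have km: "int M = k * m" using assms(4) by (simp add: m_def)
  have bM: "b [^] M = b [^] (k * m)" using km int_pow_int[of G b M] by simp
  show ?thesis
  proof (cases "k > 0")
    case True
    then have m: "m > 0" using km assms(5) by (metis of_nat_0_less_iff zero_less_mult_pos)
    have "le \<one> (b [^] k \<otimes> r) \<longleftrightarrow> le (\<one> [^] m) ((b [^] k \<otimes> r) [^] m)"
      using le_int_pow[OF _ _ m, of \<one> "b [^] k \<otimes> r"] assms by simp
    also have "\<dots> \<longleftrightarrow> le \<one> (b [^] M \<otimes> r [^] m)"
      using assms by (simp add: int_pow_distrib int_pow_pow bM)
    also have "\<dots> \<longleftrightarrow> le (r [^] (- m)) (b [^] M)"
      using assms one_le_mult_iff(1)[of "b [^] M" "r [^] m"] by (simp add: int_pow_neg)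
    finally show ?thesis using True by (simp add: m_def)
  next
    case False
    then have k: "k < 0" using assms(3) by simp
    then have m: "- m > 0" using zero_less_mult_iff[of k m] km[symmetric] assms(5) by auto
    have "le \<one> (b [^] k \<otimes> r) \<longleftrightarrow> le (\<one> [^] (- m)) ((b [^] k \<otimes> r) [^] (- m))"
      using le_int_pow[OF _ _ m, of \<one> "b [^] k \<otimes> r"] assms by simp
    also have "(b [^] k \<otimes> r) [^] (- m) = b [^] (k * - m) \<otimes> r [^] (- m)"
      using assms(1,2) int_pow_distrib[of "b [^] k" r "- m"] int_pow_pow[of b k "- m"] by simp
    also have "b [^] (k * - m) = inv (b [^] M)"
      using assms(1) bM int_pow_neg[of b "k * m"] by simp
    also have "le (\<one> [^] (- m)) (inv (b [^] M) \<otimes> r [^] (- m)) \<longleftrightarrow> le (b [^] M) (r [^] (- m))"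
      using assms(1,2) one_le_mult_iff(2)[of "inv (b [^] M)" "r [^] (- m)"] int_pow_one[of "- m"]
      by simp
    finally show ?thesis using False by (simp add: m_def)
  qed
qed

context dense_vlgroup
begin

lemma upd_range: "range e \<subseteq> A \<Longrightarrow> b \<in> A \<Longrightarrow> range (e(n := b)) \<subseteq> A"
  by auto

lemma lin_update:
  assumes e: "range e \<subseteq> gdom V" and b: "b \<in> gdom V"
  shows "lin V (e(n := b)) f = gadd V (b [^]\<^bsub>G\<^esub> coef n f) (lin V e (rest n f))"
proof (induction f)
  case Nil
  show ?case using G.r_one[of "gzero V"] by (simp add: rest_def)
next
  case (Cons m f)
  have em: "e (snd m) \<in> gdom V" using e by auto
  have cl: "lin V e (rest n f) \<in> gdom V" by (rule lin_closed[OF e])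
  show ?case
  proof (cases "snd m = n")
    case True
    then show ?thesis
      using Cons cl b G.int_pow_mult[of b "fst m" "coef n f"]
        G.m_assoc[of "b [^]\<^bsub>G\<^esub> fst m" "b [^]\<^bsub>G\<^esub> coef n f" "lin V e (rest n f)"]
      by (simp add: rest_def)
  next
    case False
    then show ?thesis
      using Cons cl b em
        G.m_lcomm[of "e (snd m) [^]\<^bsub>G\<^esub> fst m" "b [^]\<^bsub>G\<^esub> coef n f" "lin V e (rest n f)"]
      by (simp add: rest_def)
  qed
qed

lemma lin_fscale:
  assumes e: "range e \<subseteq> gdom V"
  shows "lin V e (fscale k f) = lin V e f [^]\<^bsub>G\<^esub> k"
proof (induction f)
  case Nil
  show ?case using G.int_pow_one[of k] by (simp add: fscale_def)
next
  case (Cons m f)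
  have em: "e (snd m) \<in> gdom V" using e by auto
  show ?case
    using Cons lin_closed[OF e, of f] em G.int_pow_pow[of "e (snd m)" "fst m" k]
      G.int_pow_distrib[of "e (snd m) [^]\<^bsub>G\<^esub> fst m" "lin V e f" k]
    by (simp add: fscale_def case_prod_beta mult.commute)
qed

lemma val_lin_update:
  assumes x: "x \<in> spec V" and e: "range e \<subseteq> gdom V" and b: "b \<in> gdom V"
    and f: "coef n f \<noteq> 0" "coef n f dvd int M" "M > 0"
  shows "val V (lin V (e(n := b)) f) \<in> x \<longleftrightarrow>
    (if coef n f > 0 then ple x (lin V e (cut n M f)) (b [^]\<^bsub>G\<^esub> M)
     else ple x (b [^]\<^bsub>G\<^esub> M) (lin V e (cut n M f)))"
proof -
  have "val V (lin V (e(n := b)) f) \<in> x \<longleftrightarrow> ple x (gzero V) (lin V (e(n := b)) f)"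
    using ple_zero[OF x lin_closed[OF upd_range[OF e b]]] by simp
  then show ?thesis
    using total_cone.one_le_pow_mult[OF cone_total_cone[OF x] _ _ f, of b "lin V e (rest n f)"]
      b lin_closed[OF e] by (simp add: lin_update[OF e b] cut_def lin_fscale[OF e])
qed

text \<open>A glued element therefore has, at each point, the pattern of the element it was glued
  from.\<close>

lemma peq_lin_cong:
  assumes x: "x \<in> spec V" and e: "range e \<subseteq> gdom V" and ab: "a \<in> gdom V" "b \<in> gdom V" "peq x a b"
  shows "val V (lin V (e(n := a)) f) \<in> x \<longleftrightarrow> val V (lin V (e(n := b)) f) \<in> x"
proof -
  interpret total_cone G "cone x" by (rule cone_total_cone[OF x])
  have cl: "lin V e (rest n f) \<in> gdom V" by (rule lin_closed[OF e])
  have "eqv (lin V (e(n := a)) f) (lin V (e(n := b)) f)"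
    using eqv_mult[OF eqv_int_pow[OF ab(3)] eqv_refl, of "lin V e (rest n f)" "coef n f"] ab cl
    by (simp add: lin_update[OF e])
  then show ?thesis
    using eqv_le_iff[OF eqv_refl[of "gzero V"], of "lin V (e(n := a)) f" "lin V (e(n := b)) f"]
      ple_zero[OF x] lin_closed[OF upd_range[OF e ab(1)]] lin_closed[OF upd_range[OF e ab(2)]] by simp
qed

end

lemma finite_targets:
  assumes "finite F" "finite I" "finite F'" "finite I'"
  shows "finite ((\<lambda>y. (pattern W F' I' e' d' y, pattern W F I e d y)) ` Y)"
proof (rule finite_subset)
  show "(\<lambda>y. (pattern W F' I' e' d' y, pattern W F I e d y)) ` Y
      \<subseteq> (Pow F' \<times> Pow I') \<times> (Pow F \<times> Pow I)" by (auto simp: pattern_def)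
qed (use assms in simp)

text \<open>The assignments into \<open>V\<close> and \<open>W\<close> are independent and tied only
  by their pattern sets. The induction over quantifiers needs this generality, because the witness
  found in \<open>V\<close> is unrelated to the one in \<open>W\<close> by any map.\<close>

definition type_reflects ::
  "('g, 'l) vlgrp \<Rightarrow> ('a, 'b) vlgrp \<Rightarrow> form set \<Rightarrow> nat set \<Rightarrow> fm \<Rightarrow> bool" where
  "type_reflects V W F I p \<longleftrightarrow> (\<forall>e d e' d'. range e \<subseteq> gdom V \<and> range d \<subseteq> ldom V \<and>
    range e' \<subseteq> gdom W \<and> range d' \<subseteq> ldom W \<and> types V F I e d = types W F I e' d' \<and>
    sat W e' d' p \<longrightarrow> sat V e d p)"

lemma type_reflectsD:
  assumes "type_reflects V W F I p" "range e \<subseteq> gdom V" "range d \<subseteq> ldom V"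
    "range e' \<subseteq> gdom W" "range d' \<subseteq> ldom W" "types V F I e d = types W F I e' d'" "sat W e' d' p"
  shows "sat V e d p"
  using assms(1)[unfolded type_reflects_def, rule_format, of e d e' d'] assms(2-) by simp

section \<open>One-element extensions and the induction over existential formulas\<close>

context tame_vlgroup
begin

text \<open>\<open>F'\<close> must be chosen before the assignments, so that a quantified formula
  again depends on one fixed finite set of forms.\<close>

lemma extend_group:
  fixes W :: "('a, 'b) vlgrp"
  assumes W: "densely_valued_lgroup W" and atl: "atomless V" and fin: "finite F" "finite I"
  shows "\<exists>F'. finite F' \<and> (\<forall>e d e' d' a. range e \<subseteq> gdom V \<and> range d \<subseteq> ldom V \<and>
    range e' \<subseteq> gdom W \<and> range d' \<subseteq> ldom W \<and> a \<in> gdom W \<and>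
    types V F' I e d = types W F' I e' d' \<longrightarrow>
    (\<exists>b\<in>gdom V. types V F I (e(n := b)) d = types W F I (e'(n := a)) d'))"
proof -
  interpret W: dense_vlgroup W by unfold_locales (rule W)
  obtain M where M: "M > 0" "\<And>f. f \<in> F \<Longrightarrow> coef n f \<noteq> 0 \<Longrightarrow> coef n f dvd int M"
    using ex_common_multiple[OF fin(1)] by blast
  \<comment> \<open>The zero form keeps \<open>S\<close> nonempty, as \<open>realize_cut\<close>
    requires.\<close>
  define S where "S = insert [] (cut n M ` {f \<in> F. coef n f \<noteq> 0})"
  \<comment> \<open>The first part decides the forms in which variable \<open>n\<close> cancels; the
    differences decide the order of the cut points. None of them mentions \<open>n\<close>.\<close>
  define F' where "F' = rest n ` F \<union> (\<lambda>(s, t). t @ fneg s) ` (S \<times> S)"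
  have S: "finite S" "S \<noteq> {}" using fin by (auto simp: S_def)
  have F': "finite F'" using S fin by (simp add: F'_def)
  have "\<exists>b\<in>gdom V. types V F I (e(n := b)) d = types W F I (e'(n := a)) d'"
    if e: "range e \<subseteq> gdom V" and d: "range d \<subseteq> ldom V" and e': "range e' \<subseteq> gdom W"
      and d': "range d' \<subseteq> ldom W" and a: "a \<in> gdom W"
      and ty: "types V F' I e d = types W F' I e' d'" for e d e' d' a
  proof -
    let ?\<rho> = "pattern V F' I e d" and ?\<rho>' = "pattern W F' I e' d'"
    let ?pat = "\<lambda>b. pattern V F I (e(n := b)) d" and ?pat' = "pattern W F I (e'(n := a)) d'"
    \<comment> \<open>Each refined pattern is kept together with the old pattern over which it
      occurs in \<open>W\<close>.\<close>
    let ?T = "(\<lambda>y. (?\<rho>' y, ?pat' y)) ` spec W"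
    have "\<exists>b\<in>gdom V. (\<lambda>x. (?\<rho> x, ?pat b x)) ` spec V = ?T"
    proof (rule realize_targets[OF atl])
      show "gdom V \<noteq> {}" using densely_valued_closed(1)[OF dense] by blast
      show "clopen {x \<in> spec V. ?\<rho> x = r}" for r by (rule clopen_pattern[OF e d F' fin(2)])
      show "finite ?T" by (rule finite_targets[OF fin F' fin(2)])
      show "clopen (spec V)" by (rule clopen_spec)
      show "fst ` ?T = ?\<rho> ` spec V" using ty by (simp add: types_def image_image)
      show "\<exists>c\<in>gdom V. \<forall>x\<in>spec V. ?pat c x = (if x \<in> Z then ?pat b x else ?pat b' x)"
        if b: "b \<in> gdom V" "b' \<in> gdom V" and Z: "clopen Z" for b b' Z
      proof -
        obtain l where l: "l \<in> ldom V" "Z = {x \<in> spec V. l \<in> x}" using Z by (auto simp: clopen_def)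
        obtain c where c: "c \<in> gdom V"
          "\<forall>x\<in>spec V. (l \<in> x \<longrightarrow> peq x c b) \<and> (l \<notin> x \<longrightarrow> peq x c b')"
          using patch_compl[OF b l(1)] by blast
        have "?pat c x = (if x \<in> Z then ?pat b x else ?pat b' x)" if x: "x \<in> spec V" for x
          using peq_lin_cong[OF x e c(1) b(1)] peq_lin_cong[OF x e c(1) b(2)] c(2) x l(2)
          by (auto simp: pattern_def)
        with c show ?thesis by blast
      qed
      fix r s assume "(r, s) \<in> ?T"
      then obtain y where y: "y \<in> spec W" "r = ?\<rho>' y" "s = ?pat' y" by auto
      let ?H = "add_group W"
      have t: "a [^]\<^bsub>?H\<^esub> M \<in> carrier ?H" using a W.G.nat_pow_closed[of a M] by simp
      let ?ord = "\<lambda>x. \<forall>s\<in>S. \<forall>s'\<in>S. ple x (lin V e s) (lin V e s') \<longleftrightarrow> W.ple y (lin W e' s) (lin W e' s')"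
      let ?fit = "\<lambda>b x. \<forall>s\<in>S.
          (ple x (lin V e s) (b [^]\<^bsub>G\<^esub> M) \<longleftrightarrow> W.ple y (lin W e' s) (a [^]\<^bsub>?H\<^esub> M)) \<and>
          (ple x (b [^]\<^bsub>G\<^esub> M) (lin V e s) \<longleftrightarrow> W.ple y (a [^]\<^bsub>?H\<^esub> M) (lin W e' s))"
      \<comment> \<open>\<open>b\<close> is found from the single point \<open>y\<close>. The old
        pattern decides \<open>?ord\<close>, so this \<open>b\<close> serves every point of
        \<open>V\<close> with the pattern \<open>r\<close>.\<close>
      have "\<exists>b\<in>gdom V. \<forall>x\<in>spec V. ?ord x \<longrightarrow> ?fit b x"
        by (rule realize_cut[OF W.cone_total_cone[OF y(1)] t _ _ S M(1)])
          (simp_all add: W.lin_closed[OF e'] lin_closed[OF e])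
      then obtain b where b: "b \<in> gdom V" and bx: "\<forall>x\<in>spec V. ?ord x \<longrightarrow> ?fit b x" ..
      have "?pat b x = s" if x: "x \<in> spec V" and \<rho>: "?\<rho> x = r" for x
      proof -
        have F'x: "val V (lin V e f) \<in> x \<longleftrightarrow> val W (lin W e' f) \<in> y" if "f \<in> F'" for f
          using \<rho> y(2) that by (auto simp: pattern_def set_eq_iff)
        have Ix: "{i \<in> I. d i \<in> x} = {i \<in> I. d' i \<in> y}"
          using \<rho> y(2) by (simp add: pattern_def)
        have "?ord x"
        proof (intro ballI)
          fix s s' assume "s \<in> S" "s' \<in> S"
          then have "s' @ fneg s \<in> F'" by (auto simp: F'_def)
          then show "ple x (lin V e s) (lin V e s') \<longleftrightarrow> W.ple y (lin W e' s) (lin W e' s')"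
            using F'x[of "s' @ fneg s"] ple_def[OF x lin_closed[OF e] lin_closed[OF e]]
              W.ple_def[OF y(1) W.lin_closed[OF e'] W.lin_closed[OF e']]
            by (simp add: lin_append[OF e] lin_fneg[OF e] W.lin_append[OF e'] W.lin_fneg[OF e'])
        qed
        then have bs: "?fit b x" using bx x by blast
        have "val V (lin V (e(n := b)) f) \<in> x \<longleftrightarrow> val W (lin W (e'(n := a)) f) \<in> y" if f: "f \<in> F" for f
        proof (cases "coef n f = 0")
          case True
          have "lin V (e(n := b)) f = lin V e (rest n f)" "lin W (e'(n := a)) f = lin W e' (rest n f)"
            using True G.l_one[of "lin V e (rest n f)"] W.G.l_one[of "lin W e' (rest n f)"]
              lin_closed[OF e] W.lin_closed[OF e']
            by (simp_all add: lin_update[OF e b] W.lin_update[OF e' a])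
          moreover have "rest n f \<in> F'" using f by (simp add: F'_def)
          ultimately show ?thesis using F'x by simp
        next
          case False
          then have "cut n M f \<in> S" using f by (auto simp: S_def)
          then show ?thesis
            using bs val_lin_update[OF x e b False M(2)[OF f False] M(1)]
              W.val_lin_update[OF y(1) e' a False M(2)[OF f False] M(1)] by simp
        qed
        then show ?thesis using Ix y(3) by (auto simp: pattern_def)
      qed
      with b show "\<exists>b\<in>gdom V. \<forall>x\<in>spec V. ?\<rho> x = r \<longrightarrow> ?pat b x = s" by blast
    qed
    then obtain b where b: "b \<in> gdom V" "(\<lambda>x. (?\<rho> x, ?pat b x)) ` spec V = ?T" by blast
    then have "snd ` (\<lambda>x. (?\<rho> x, ?pat b x)) ` spec V = snd ` ?T" by simp
    then show ?thesis using b(1) by (auto simp: types_def image_image)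
  qed
  note step = this
  show ?thesis
    by (rule exI[of _ F'], rule conjI[OF F'], intro allI impI, elim conjE) (rule step; assumption)
qed

text \<open>The same scheme with simpler local solutions: the new element is \<open>\<top>\<close>
  or \<open>\<bottom>\<close> according to whether \<open>k\<close> belongs to the point of
  \<open>W\<close>. Index \<open>n\<close> is left out of the old patterns because its value is
  overwritten.\<close>

lemma extend_lattice:
  fixes W :: "('a, 'b) vlgrp"
  assumes W: "densely_valued_lgroup W" and atl: "atomless V" and fin: "finite F" "finite I"
    and e: "range e \<subseteq> gdom V" and d: "range d \<subseteq> ldom V"
    and k: "k \<in> ldom W" and ty: "types V F (I - {n}) e d = types W F (I - {n}) e' d'"
  shows "\<exists>l\<in>ldom V. types V F I e (d(n := l)) = types W F I e' (d'(n := k))"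
proof -
  let ?I = "I - {n}"
  let ?\<rho> = "pattern V F ?I e d" and ?\<rho>' = "pattern W F ?I e' d'"
  let ?pat = "\<lambda>l. pattern V F I e (d(n := l))" and ?pat' = "pattern W F I e' (d'(n := k))"
  let ?T = "(\<lambda>y. (?\<rho>' y, ?pat' y)) ` spec W"
  have fI: "finite ?I" using fin by simp
  have ldoms: "lbot V \<in> ldom V" "ltop V \<in> ldom V" by (rule densely_valued_closed[OF dense])+
  have "\<exists>l\<in>ldom V. (\<lambda>x. (?\<rho> x, ?pat l x)) ` spec V = ?T"
  proof (rule realize_targets[OF atl])
    show "ldom V \<noteq> {}" using ldoms by blast
    show "clopen {x \<in> spec V. ?\<rho> x = r}" for r by (rule clopen_pattern[OF e d fin(1) fI])
    show "finite ?T" by (rule finite_targets[OF fin fin(1) fI])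
    show "clopen (spec V)" by (rule clopen_spec)
    show "fst ` ?T = ?\<rho> ` spec V" using ty by (simp add: types_def image_image)
    show "\<exists>c\<in>ldom V. \<forall>x\<in>spec V. ?pat c x = (if x \<in> Z then ?pat a x else ?pat b x)"
      if ab: "a \<in> ldom V" "b \<in> ldom V" and Z: "clopen Z" for a b Z
    proof -
      obtain l where l: "l \<in> ldom V" "Z = {x \<in> spec V. l \<in> x}" using Z by (auto simp: clopen_def)
      obtain m where m: "m \<in> ldom V" "\<And>x. x \<in> spec V \<Longrightarrow> m \<in> x \<longleftrightarrow> l \<notin> x"
        using complement[OF l(1)] by blast
      let ?c = "ljoin V (lmeet V l a) (lmeet V m b)"
      have "?c \<in> x \<longleftrightarrow> (if x \<in> Z then a \<in> x else b \<in> x)" if x: "x \<in> spec V" for x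
        using ab l m x by (simp add: spec_join spec_meet)
      then show ?thesis using ab l m by (intro bexI[of _ ?c]) (auto simp: pattern_def)
    qed
    fix r s assume "(r, s) \<in> ?T"
    then obtain y where y: "y \<in> spec W" "r = ?\<rho>' y" "s = ?pat' y" by auto
    let ?l = "if k \<in> y then ltop V else lbot V"
    have "?pat ?l x = s" if x: "x \<in> spec V" and \<rho>: "?\<rho> x = r" for x
    proof -
      have "?l \<in> x \<longleftrightarrow> k \<in> y" using spec_top[OF x] spec_bot[OF x] by simp
      moreover have "{f \<in> F. val V (lin V e f) \<in> x} = {f \<in> F. val W (lin W e' f) \<in> y}"
        "\<And>i. i \<in> I \<Longrightarrow> i \<noteq> n \<Longrightarrow> d i \<in> x \<longleftrightarrow> d' i \<in> y"
        using \<rho> y(2) by (auto simp: pattern_def set_eq_iff)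
      ultimately show ?thesis using y(3) by (auto simp: pattern_def)
    qed
    moreover have "?l \<in> ldom V" using ldoms by simp
    ultimately show "\<exists>l\<in>ldom V. \<forall>x\<in>spec V. ?\<rho> x = r \<longrightarrow> ?pat l x = s" by blast
  qed
  then obtain l where l: "l \<in> ldom V" "(\<lambda>x. (?\<rho> x, ?pat l x)) ` spec V = ?T" by blast
  then have "snd ` (\<lambda>x. (?\<rho> x, ?pat l x)) ` spec V = snd ` ?T" by simp
  then show ?thesis using l(1) by (auto simp: types_def image_image)
qed

text \<open>\<open>sat_types\<close> settles the quantifier-free kernel, and each quantifier changes
  the finite sets by one extension step.\<close>

lemma types_reflect_existential:
  fixes W :: "('a, 'b) vlgrp"
  assumes W: "densely_valued_lgroup W" and atl: "atomless V" and p: "existential p"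
  shows "\<exists>F I. finite F \<and> finite I \<and> type_reflects V W F I p"
  using p
proof (induction p)
  case (1 p)
  interpret W: dense_vlgroup W by unfold_locales (rule W)
  have "type_reflects V W (fforms p) (fvars p) p"
    unfolding type_reflects_def
  proof (intro allI impI, elim conjE)
    fix e d e' d'
    assume H: "range e \<subseteq> gdom V" "range d \<subseteq> ldom V" "range e' \<subseteq> gdom W" "range d' \<subseteq> ldom W"
      "types V (fforms p) (fvars p) e d = types W (fforms p) (fvars p) e' d'" "sat W e' d' p"
    then show "sat V e d p"
      using sat_types[OF H(1,2) 1 order_refl order_refl]
        W.sat_types[OF H(3,4) 1 order_refl order_refl] by simp
  qed
  then show ?case using finite_fforms finite_fvars by blast
next
  case (2 p n)
  then obtain F I where FI: "finite F" "finite I" and IH: "type_reflects V W F I p" by blast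
  obtain F' where F': "finite F'" and ext: "\<forall>e d e' d' a. range e \<subseteq> gdom V \<and> range d \<subseteq> ldom V \<and>
    range e' \<subseteq> gdom W \<and> range d' \<subseteq> ldom W \<and> a \<in> gdom W \<and>
    types V F' I e d = types W F' I e' d' \<longrightarrow>
    (\<exists>b\<in>gdom V. types V F I (e(n := b)) d = types W F I (e'(n := a)) d')"
    using extend_group[OF W atl FI, of n] by (elim exE conjE) (rule that)
  have "type_reflects V W F' I (ExG n p)"
    unfolding type_reflects_def
  proof (intro allI impI, elim conjE)
    fix e d e' d'
    assume H: "range e \<subseteq> gdom V" "range d \<subseteq> ldom V" "range e' \<subseteq> gdom W" "range d' \<subseteq> ldom W"
      "types V F' I e d = types W F' I e' d'" and s: "sat W e' d' (ExG n p)"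
    obtain a where a: "a \<in> gdom W" "sat W (e'(n := a)) d' p" using s by auto
    obtain b where b: "b \<in> gdom V" "types V F I (e(n := b)) d = types W F I (e'(n := a)) d'"
      using ext[rule_format, of e d e' d' a] H a(1) by auto
    have "range (e(n := b)) \<subseteq> gdom V" "range (e'(n := a)) \<subseteq> gdom W" using H a b by auto
    then have "sat V (e(n := b)) d p" using type_reflectsD[OF IH _ H(2) _ H(4) b(2) a(2)] by blast
    with b(1) show "sat V e d (ExG n p)" by auto
  qed
  then show ?case using F' FI(2) by blast
next
  case (3 p n)
  then obtain F I where FI: "finite F" "finite I" and IH: "type_reflects V W F I p" by blast
  have "type_reflects V W F (I - {n}) (ExL n p)"
    unfolding type_reflects_def
  proof (intro allI impI, elim conjE)
    fix e d e' d'
    assume H: "range e \<subseteq> gdom V" "range d \<subseteq> ldom V" "range e' \<subseteq> gdom W" "range d' \<subseteq> ldom W"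
      "types V F (I - {n}) e d = types W F (I - {n}) e' d'" and s: "sat W e' d' (ExL n p)"
    obtain k where k: "k \<in> ldom W" "sat W e' (d'(n := k)) p" using s by auto
    obtain l where l: "l \<in> ldom V" "types V F I e (d(n := l)) = types W F I e' (d'(n := k))"
      using extend_lattice[OF W atl FI H(1,2) k(1) H(5)] by blast
    have "range (d(n := l)) \<subseteq> ldom V" "range (d'(n := k)) \<subseteq> ldom W" using H k l by auto
    then have "sat V e (d(n := l)) p" using type_reflectsD[OF IH H(1) _ H(3) _ l(2) k(2)] by blast
    with l(1) show "sat V e d (ExL n p)" by auto
  qed
  moreover have "finite (I - {n})" using FI by simp
  ultimately show ?case using FI(1) by blast
qed

text \<open>The embedding enters only through \<open>types_embedding\<close>, which provides the
  initial equality of pattern sets.\<close>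

lemma atomless_reflects:
  assumes W: "densely_valued_lgroup W" and em: "embedding f h V W" and atl: "atomless V"
  shows "reflects existential f h V W"
  unfolding reflects_def
proof (intro allI impI, elim conjE)
  fix p e d
  assume H: "existential p" "range e \<subseteq> gdom V" "range d \<subseteq> ldom V" "sat W (f \<circ> e) (h \<circ> d) p"
  obtain F I where FI: "type_reflects V W F I p"
    using types_reflect_existential[OF W atl H(1)] by blast
  have "f ` gdom V \<subseteq> gdom W" "h ` ldom V \<subseteq> ldom W" using em by (simp_all add: embedding_def)
  then have "range (f \<circ> e) \<subseteq> gdom W" "range (h \<circ> d) \<subseteq> ldom W" using H(2,3) by fastforce+
  then show "sat V e d p"
    using type_reflectsD[OF FI H(2,3)] types_embedding[OF em dense W H(2,3)] H(4) by metis
qed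

end

theorem mainTheorem10:
  fixes V :: "('g, 'l) vlgrp"
  assumes "algebraically_closed V"
  shows "existentially_closed V \<longleftrightarrow> atomless V"
proof
  have V: "densely_valued_lgroup V" using assms by (simp add: algebraically_closed_def)
  then interpret dense_vlgroup V by unfold_locales
  show "existentially_closed V \<Longrightarrow> atomless V" by (rule existentially_closed_imp_atomless)
  interpret tame_vlgroup V by (rule algebraically_closed_imp_tame[OF assms])
  show "atomless V \<Longrightarrow> existentially_closed V"
    unfolding existentially_closed_def using V atomless_reflects by blast
qed

end
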